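(* Let $G$ be a finite group. Then $\lambda(G)<\frac52$ if and only if there are positive integers $m,n,r$ with $$\gcd(m,n)=\gcd(m,r-1)=1,\qquad r^n\equiv1\pmod m,$$ such that $G\cong ZM(m,n,r)$ and $$\sum_{m_1\mid m}\ \sum_{n_1\mid n}\gcd\bigl(m_1,R(n_1)\bigr)<5\cdot2^{\pi(mn)-1},$$ where, for $n_1\mid n$, $R(n_1)=\sum_{j=0}^{n/n_1-1}r^{jn_1}$.
   Context: For a finite group $G$, $\mathrm{sub}(G)$ denotes the number of subgroups of $G$ (including the trivial subgroup and $G$), $\pi(G)$ denotes the number of distinct prime divisors of $|G|$, and $\lambda(G)=\mathrm{sub}(G)/2^{\pi(G)}$. For a positive integer $k$, $\pi(k)$ is the number of distinct prime divisors of $k$ ($\pi(1)=0$). For positive integers $m,n,r$ with $\gcd(m,n)=\gcd(m,r-1)=1$ and $r^n\equiv1\pmod m$, $$ZM(m,n,r)=\langle a,b\mid a^m=b^n=1,\ b^{-1}ab=a^r\rangle,$$ a group of order $mn$. Convention: $\gcd(m,0)=m$; the case $m=1$, $r=1$ is allowed and $ZM(1,n,1)\cong C_n$. Sums over $m_1\mid m$, $n_1\mid n$ run over positive divisors. *)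

theory Defs
  imports
    Complex_Main
    "HOL-Algebra.Coset"
    "HOL-Number_Theory.Cong"
    "HOL-Computational_Algebra.Primes"
begin

section \<open>Groups given by generators and relations\<close>

text \<open>
  A letter is a generator \<^term>\<open>x\<close> tagged with a flag: \<^term>\<open>(x, True)\<close> stands for \<^term>\<open>x\<close> and
  \<^term>\<open>(x, False)\<close> for its formal inverse.
\<close>

type_synonym 'x group_word = "('x \<times> bool) list"

inductive word_equiv :: "('x group_word \<times> 'x group_word) set \<Rightarrow> 'x group_word \<Rightarrow> 'x group_word \<Rightarrow> bool"
  for R where
    relator: "(u, v) \<in> R \<Longrightarrow> word_equiv R u v"
  | cancel: "word_equiv R [(x, e), (x, \<not> e)] []"
  | refl: "word_equiv R u u"
  | sym: "word_equiv R u v \<Longrightarrow> word_equiv R v u"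
  | trans: "word_equiv R u v \<Longrightarrow> word_equiv R v w \<Longrightarrow> word_equiv R u w"
  | append: "word_equiv R u u' \<Longrightarrow> word_equiv R v v' \<Longrightarrow> word_equiv R (u @ v) (u' @ v')"

definition word_class :: "('x group_word \<times> 'x group_word) set \<Rightarrow> 'x group_word \<Rightarrow> 'x group_word set" where
  "word_class R u = {v. word_equiv R u v}"

text \<open>The generators are all the elements of the type \<^typ>\<open>'x\<close>.\<close>

definition presented_group :: "('x group_word \<times> 'x group_word) set \<Rightarrow> 'x group_word set monoid" where
  "presented_group R =
    \<lparr>carrier = range (word_class R),
     monoid.mult = (\<lambda>X Y. \<Union>u\<in>X. \<Union>v\<in>Y. word_class R (u @ v)),
     one = word_class R []\<rparr>"

lemma word_class_eq_iff: "word_class R u = word_class R v \<longleftrightarrow> word_equiv R u v"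
  unfolding word_class_def by (auto intro: word_equiv.intros)

lemma word_class_mult:
  "word_class R u \<otimes>\<^bsub>presented_group R\<^esub> word_class R v = word_class R (u @ v)"
proof -
  have "word_class R (u' @ v') = word_class R (u @ v)"
    if "u' \<in> word_class R u" "v' \<in> word_class R v" for u' v'
    using that unfolding word_class_eq_iff
    by (auto simp: word_class_def intro: word_equiv.intros)
  moreover have "u \<in> word_class R u" "v \<in> word_class R v"
    by (auto simp: word_class_def intro: word_equiv.refl)
  ultimately show ?thesis
    unfolding presented_group_def monoid.simps by blast
qed

lemma word_equiv_inverse: "word_equiv R (rev (map (apsnd Not) u) @ u) []"
proof (induction u)
  case Nil
  show ?case by (simp add: word_equiv.refl)
next
  case (Cons l u)
  obtain x e where l: "l = (x, e)" by (cases l)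
  have "word_equiv R ([(x, \<not> e), (x, e)] @ u) u"
    using word_equiv.append[OF word_equiv.cancel[of R x "\<not> e"] word_equiv.refl[of R u]] by simp
  from word_equiv.append[OF word_equiv.refl[of R "rev (map (apsnd Not) u)"] this]
  have "word_equiv R (rev (map (apsnd Not) (l # u)) @ l # u) (rev (map (apsnd Not) u) @ u)"
    by (simp add: l)
  then show ?case using Cons.IH by (rule word_equiv.trans)
qed

lemma group_presented_group: "group (presented_group R)"
proof (rule groupI)
  let ?P = "presented_group R"
  have carr: "carrier ?P = range (word_class R)" and one: "\<one>\<^bsub>?P\<^esub> = word_class R []"
    by (simp_all add: presented_group_def)
  show "\<one>\<^bsub>?P\<^esub> \<in> carrier ?P" by (simp add: carr one)
  show "X \<otimes>\<^bsub>?P\<^esub> Y \<in> carrier ?P" if "X \<in> carrier ?P" "Y \<in> carrier ?P" for X Y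
    using that by (auto simp: carr word_class_mult)
  show "X \<otimes>\<^bsub>?P\<^esub> Y \<otimes>\<^bsub>?P\<^esub> Z = X \<otimes>\<^bsub>?P\<^esub> (Y \<otimes>\<^bsub>?P\<^esub> Z)"
    if "X \<in> carrier ?P" "Y \<in> carrier ?P" "Z \<in> carrier ?P" for X Y Z
    using that by (auto simp: carr word_class_mult)
  show "\<one>\<^bsub>?P\<^esub> \<otimes>\<^bsub>?P\<^esub> X = X" if X: "X \<in> carrier ?P" for X
    using X by (auto simp: carr one word_class_mult)
  show "\<exists>Y\<in>carrier ?P. Y \<otimes>\<^bsub>?P\<^esub> X = \<one>\<^bsub>?P\<^esub>" if X: "X \<in> carrier ?P" for X
  proof -
    obtain u where "X = word_class R u" using X by (auto simp: carr)
    then have "word_class R (rev (map (apsnd Not) u)) \<otimes>\<^bsub>?P\<^esub> X = \<one>\<^bsub>?P\<^esub>"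
      by (simp add: one word_class_mult word_class_eq_iff word_equiv_inverse)
    then show ?thesis by (auto simp: carr)
  qed
qed


section \<open>ZM groups\<close>

datatype zm_gen = Gen_a | Gen_b

text \<open>\<open>ZM(m, n, r) = \<langle>a, b | a^m = b^n = 1, b^-1 a b = a^r\<rangle>\<close>\<close>

definition ZM :: "nat \<Rightarrow> nat \<Rightarrow> nat \<Rightarrow> zm_gen group_word set monoid" where
  "ZM m n r = presented_group
    {(replicate m (Gen_a, True), []),
     (replicate n (Gen_b, True), []),
     ([(Gen_b, False), (Gen_a, True), (Gen_b, True)], replicate r (Gen_a, True))}"


section \<open>Numbers of subgroups and of prime divisors\<close>

definition sub_count :: "('a, 'b) monoid_scheme \<Rightarrow> nat" where
  "sub_count G = card {H. subgroup H G}"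

definition prime_count :: "nat \<Rightarrow> nat" where
  "prime_count k = card {p. prime p \<and> p dvd k}"

definition lambda_ratio :: "('a, 'b) monoid_scheme \<Rightarrow> real" where
  "lambda_ratio G = real (sub_count G) / 2 ^ prime_count (order G)"

definition R_sum :: "nat \<Rightarrow> nat \<Rightarrow> nat \<Rightarrow> nat" where
  "R_sum n r n1 = (\<Sum>j<n div n1. r ^ (j * n1))"

end

(*
  By Frobenius' theorem the number of solutions of x^k = 1 in a group is a multiple of every
  divisor k of its order. Since the number of cyclic subgroups is the sum over x of
  1 / totient (ord x), this gives at least 2^pi cyclic subgroups, where pi is the number of primes
  dividing the order, and at least 4 * 2^(pi - 1) of them if a Sylow subgroup P is not cyclic.
  In the latter case there are also at least 2^(pi - 1) noncyclic subgroups, namely those in which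
  a conjugate of P is normal, so that lambda(G) >= 5/2. Hence lambda(G) < 5/2 forces every Sylow
  subgroup to be cyclic. Counting roots of the identity again, the elements whose orders involve
  only the primes above a given bound form a normal subgroup; it follows that the derived subgroup
  and its quotient are both cyclic, of coprime orders m and n, and G is a group ZM(m, n, r).
  Its subgroups are parametrized by the triples (m1, n1, s) with m1 | m, n1 | n, 0 <= s < m1 and
  m1 | s R(n1), and for fixed m1, n1 there are gcd(m1, R(n1)) such s.
*)
theory Submission
  imports
    Defs
    "HOL-Algebra.Sylow"
    "HOL-Algebra.Zassenhaus"
    "HOL-Number_Theory.Residues"
begin

text \<open>The lower bound for cyclic subgroups is a product with one factor 1 + (q^v - 1) /
  totient (q^e) for each prime q, where q^v is the exact power in the group order and q^e bounds the
  q-part of element orders. For e = v the factor is at least 2; a noncyclic Sylow subgroup allows e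
  = v - 1, and the factor is then at least 4. The Klein four-group, with five subgroups, attains
  5/2. The structure theory uses counting instead of transfer. If x^k = 1 has exactly k solutions
  for k = p^(i+1) h, then divisibility by totient (p^(i+1)) makes the count exact for p^i h as well,
  provided h is prime to p - 1. This is why primes are removed in increasing order. The derived
  subgroup centralizes every cyclic normal subgroup, because power automorphisms commute; generators
  belonging to different primes can therefore be multiplied. The locale \<open>zm_group\<close>
  records the normal form b^j a^i. Both G and the presented group satisfy it, so the isomorphism and
  the subgroup count become arithmetic of exponents.\<close>

lemma dvd_sum_by_fibres:
  fixes f :: "'a \<Rightarrow> nat"
  assumes "finite S" and "\<And>y. y \<in> S \<Longrightarrow> m dvd (\<Sum>z\<in>{z \<in> S. g z = g y}. f z)"
  shows "m dvd (\<Sum>z\<in>S. f z)"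
proof -
  have "(\<Sum>z\<in>S. f z) = (\<Sum>c\<in>g ` S. \<Sum>z\<in>{z \<in> S. g z = c}. f z)"
    by (rule sum.image_gen[OF assms(1)])
  also have "m dvd \<dots>" by (rule dvd_sum) (use assms(2) in auto)
  finally show ?thesis .
qed

lemma (in group) pow_eq_pow_iff:
  assumes "x \<in> carrier G"
  shows "x [^] (i::nat) = x [^] (j::nat) \<longleftrightarrow> [i = j] (mod ord x)"
proof -
  have "x [^] int i = x [^] int j \<longleftrightarrow> [int j = int i] (mod int (ord x))"
    by (simp add: int_pow_eq[OF assms] cong_iff_dvd_diff)
  then show ?thesis by (simp add: int_pow_int cong_int_iff cong_sym_eq)
qed

lemma (in group) pow_eq_pow_of_cong:
  assumes "x \<in> carrier G" "x [^] k = \<one>" "[i = j] (mod k)"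
  shows "x [^] (i::nat) = x [^] (j::nat)"
  using assms pow_eq_id pow_eq_pow_iff cong_dvd_modulus_nat by blast

section \<open>Generators of cyclic subgroups and orbit counting\<close>

locale finite_group = group G for G (structure) +
  assumes finite_carrier [simp, intro]: "finite (carrier G)"
begin

lemma ord_pos: "x \<in> carrier G \<Longrightarrow> 0 < ord x"
  using ord_ge_1[OF finite_carrier] by fastforce

lemma finite_subgroup: "subgroup H G \<Longrightarrow> finite H"
  using finite_subset finite_carrier subgroup.subset by metis

lemma subgroup_pow_closed: "subgroup H G \<Longrightarrow> x \<in> H \<Longrightarrow> x [^] (k::nat) \<in> H"
  by (induction k) (auto simp: subgroup.one_closed subgroup.m_closed)

lemma card_subgroup_dvd:
  assumes "subgroup K G" "subgroup H G" "K \<subseteq> H"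
  shows "card K dvd card H"
proof -
  interpret H: group "G\<lparr>carrier := H\<rparr>" using assms(2) subgroup_imp_group by blast
  have "subgroup K (G\<lparr>carrier := H\<rparr>)" using assms subgroup_incl by blast
  from H.lagrange[OF this] show ?thesis by (simp add: order_def) (metis dvd_triv_right)
qed

lemma generate_singleton: "x \<in> carrier G \<Longrightarrow> generate G {x} = range (\<lambda>k::nat. x [^] k)"
  using generate_pow_on_finite_carrier[OF finite_carrier] by auto

lemma subgroup_generate_singleton: "x \<in> carrier G \<Longrightarrow> subgroup (generate G {x}) G"
  by (rule generate_is_subgroup) auto

lemma ord_dvd_card_subgroup: "subgroup H G \<Longrightarrow> x \<in> H \<Longrightarrow> ord x dvd card H"
  using card_subgroup_dvd[OF subgroup_generate_singleton] generate_pow_card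
    generate_subgroup_incl[of "{x}" H] by (metis bot_least insert_subset subgroup.mem_carrier)

lemma generators_eq_image:
  assumes "x \<in> carrier G"
  shows "{z \<in> carrier G. generate G {z} = generate G {x}} = (\<lambda>k. x [^] k) ` totatives (ord x)"
proof (intro equalityI subsetI)
  fix z assume "z \<in> {z \<in> carrier G. generate G {z} = generate G {x}}"
  then have z: "z \<in> carrier G" and eq: "generate G {z} = generate G {x}" by auto
  have "z \<in> generate G {x}" using eq generate.incl by fastforce
  then obtain k :: nat where k: "z = x [^] k" using generate_singleton assms by auto
  have oz: "ord z = ord x" using eq generate_pow_card z assms by metis
  \<comment> \<open>\<open>totatives\<close> takes its representatives from 1 to
    \<open>ord x\<close>, so the residue 0 is represented by \<open>ord x\<close> itself; this
    matters for \<open>ord x = 1\<close>.\<close>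
  define k' where "k' = (if k mod ord x = 0 then ord x else k mod ord x)"
  have ck: "coprime k (ord x)" using oz pow_ord_eq_ord_iff[OF finite_carrier assms] k by simp
  have ck': "[k' = k] (mod ord x)" by (auto simp: k'_def cong_def)
  then have "x [^] k' = x [^] k" using assms by (simp add: pow_eq_pow_iff)
  moreover have "k' \<in> totatives (ord x)"
    using ord_pos[OF assms] cong_imp_coprime[OF cong_sym[OF ck'] ck]
    by (auto simp: in_totatives_iff k'_def less_imp_le split: if_splits)
  ultimately show "z \<in> (\<lambda>k. x [^] k) ` totatives (ord x)" using k by (metis image_eqI)
next
  fix z assume "z \<in> (\<lambda>k. x [^] k) ` totatives (ord x)"
  then obtain k where k: "coprime k (ord x)" "z = x [^] k" by (auto simp: in_totatives_iff)
  have z: "z \<in> carrier G" using k assms by simp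
  have o: "ord z = ord x" using k pow_ord_eq_ord_iff[OF finite_carrier assms] by simp
  have "generate G {z} \<subseteq> generate G {x}"
    using generate_singleton[OF assms] generate_singleton[OF z] k assms by (auto simp: nat_pow_pow)
  moreover have "finite (generate G {x})"
    using finite_subgroup subgroup_generate_singleton assms by blast
  ultimately have "generate G {z} = generate G {x}"
    using card_subset_eq o generate_pow_card z assms by metis
  then show "z \<in> {z \<in> carrier G. generate G {z} = generate G {x}}" using z by simp
qed

lemma card_generators:
  assumes "x \<in> carrier G"
  shows "card {z \<in> carrier G. generate G {z} = generate G {x}} = totient (ord x)"
proof -
  have "inj_on (\<lambda>k. x [^] k) (totatives (ord x))"
    by (rule inj_on_subset[OF ord_inj'[OF assms]]) (auto simp: in_totatives_iff)
  then show ?thesis unfolding generators_eq_image[OF assms] totient_def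
    by (rule card_image)
qed

text \<open>S is a disjoint union of sets of all generators of one cyclic subgroup, and such a set
  has \<open>totient (ord x)\<close> elements.\<close>

lemma dvd_card_closed_generators:
  assumes "S \<subseteq> carrier G"
    and "\<And>x z. x \<in> S \<Longrightarrow> z \<in> carrier G \<Longrightarrow> generate G {z} = generate G {x} \<Longrightarrow> z \<in> S"
    and "\<And>x. x \<in> S \<Longrightarrow> d dvd totient (ord x)"
  shows "d dvd card S"
proof -
  have "d dvd (\<Sum>z\<in>S. 1)"
  proof (rule dvd_sum_by_fibres[where g = "\<lambda>z. generate G {z}"])
    show "finite S" using assms(1) finite_subset by blast
    fix y assume y: "y \<in> S"
    then have "{z \<in> S. generate G {z} = generate G {y}} = {z \<in> carrier G. generate G {z} = generate G {y}}"
      using assms by blast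
    then show "d dvd (\<Sum>z\<in>{z \<in> S. generate G {z} = generate G {y}}. 1)"
      using card_generators[of y] assms y by auto
  qed
  then show ?thesis by simp
qed

text \<open>A cyclic subgroup of order d has \<open>totient d\<close> generators, so the weights of
  its generators add up to 1.\<close>

lemma card_cyclic_subgroups:
  "real (card ((\<lambda>x. generate G {x}) ` carrier G)) = (\<Sum>x\<in>carrier G. 1 / real (totient (ord x)))"
proof -
  have "(\<Sum>x\<in>carrier G. 1 / real (totient (ord x))) =
    (\<Sum>C\<in>(\<lambda>x. generate G {x}) ` carrier G.
       \<Sum>x\<in>{x \<in> carrier G. generate G {x} = C}. 1 / real (totient (ord x)))"
    by (rule sum.image_gen) simp
  also have "\<dots> = (\<Sum>C\<in>(\<lambda>x. generate G {x}) ` carrier G. 1)"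
  proof (rule sum.cong[OF HOL.refl])
    fix C assume "C \<in> (\<lambda>x. generate G {x}) ` carrier G"
    then obtain x where x: "x \<in> carrier G" "C = generate G {x}" by auto
    have "(\<Sum>z\<in>{z \<in> carrier G. generate G {z} = C}. 1 / real (totient (ord z)))
        = (\<Sum>z\<in>{z \<in> carrier G. generate G {z} = C}. 1 / real (totient (ord x)))"
      by (intro sum.cong) (use x generate_pow_card in auto)
    also have "\<dots> = 1" using card_generators[OF x(1)] x ord_pos[OF x(1)] by simp
    finally show "(\<Sum>z\<in>{z \<in> carrier G. generate G {z} = C}. 1 / real (totient (ord z))) = 1" .
  qed
  finally show ?thesis by simp
qed

text \<open>The hypothesis on f says that the fibre through h is the left coset h C, so all fibres
  have \<open>card C\<close> elements. It is used with a centralizer and with the normalizer of a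
  Sylow subgroup as C.\<close>

lemma card_orbit:
  assumes H: "subgroup H G" and C: "C \<subseteq> H"
    and f: "\<And>g h. g \<in> H \<Longrightarrow> h \<in> H \<Longrightarrow> f g = f h \<longleftrightarrow> inv h \<otimes> g \<in> C"
  shows "card (f ` H) * card C = card H"
proof -
  have HG: "\<And>h. h \<in> H \<Longrightarrow> h \<in> carrier G" using H subgroup.mem_carrier by metis
  have fibre: "card {g \<in> H. f g = z} = card C" if "z \<in> f ` H" for z
  proof -
    obtain h where h: "h \<in> H" "z = f h" using \<open>z \<in> f ` H\<close> by auto
    have "bij_betw (\<lambda>c. h \<otimes> c) C {g \<in> H. f g = z}"
    proof (rule bij_betwI[where g = "\<lambda>g. inv h \<otimes> g"])
      show "(\<otimes>) h \<in> C \<rightarrow> {g \<in> H. f g = z}"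
      proof
        fix c assume c: "c \<in> C"
        have "h \<otimes> c \<in> H" using c C h H by (auto simp: subgroup.m_closed)
        moreover have "inv h \<otimes> (h \<otimes> c) = c" using c C h HG by (simp add: m_assoc[symmetric] subsetD)
        ultimately show "h \<otimes> c \<in> {g \<in> H. f g = z}" using f c h by simp
      qed
      show "(\<otimes>) (inv h) \<in> {g \<in> H. f g = z} \<rightarrow> C" using f h by auto
    qed (use h HG C in \<open>auto simp: m_assoc[symmetric] subsetD\<close>)
    then show ?thesis by (simp add: bij_betw_same_card)
  qed
  have "card H = (\<Sum>z\<in>f ` H. \<Sum>g\<in>{g \<in> H. f g = z}. 1)"
    using sum.image_gen[OF finite_subgroup[OF H], of "\<lambda>_. 1::nat" f] by simp
  also have "\<dots> = (\<Sum>z\<in>f ` H. card C)" using fibre by (intro sum.cong) auto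
  finally show ?thesis by simp
qed

lemma card_conjugates:
  assumes H: "subgroup H G" and y: "y \<in> H"
  shows "card ((\<lambda>g. g \<otimes> y \<otimes> inv g) ` H) * card {x \<in> H. x \<otimes> y = y \<otimes> x} = card H"
proof (rule card_orbit[OF H])
  fix g h assume gh: "g \<in> H" "h \<in> H"
  then have c: "g \<in> carrier G" "h \<in> carrier G" "y \<in> carrier G"
    using y subgroup.mem_carrier[OF H] by auto
  have "g \<otimes> y \<otimes> inv g = h \<otimes> y \<otimes> inv h \<longleftrightarrow> g \<otimes> y = h \<otimes> y \<otimes> inv h \<otimes> g"
    using c by (metis inv_closed inv_solve_right m_closed)
  also have "\<dots> \<longleftrightarrow> inv h \<otimes> (g \<otimes> y) = y \<otimes> inv h \<otimes> g"
    using c by (metis inv_closed inv_solve_left m_assoc m_closed)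
  finally show "g \<otimes> y \<otimes> inv g = h \<otimes> y \<otimes> inv h \<longleftrightarrow> inv h \<otimes> g \<in> {x \<in> H. x \<otimes> y = y \<otimes> x}"
    using c gh H by (simp add: m_assoc subgroup.m_closed subgroup.m_inv_closed)
qed auto

end

section \<open>Roots of the identity\<close>

text \<open>The arithmetic of root sets: an element that becomes a root of the identity only when
  the exponent p^a m is multiplied by p has order divisible by p^(a+1).\<close>

lemma prime_power_dvd_of_not_dvd:
  fixes p d m :: nat
  assumes "prime p" "d dvd p ^ Suc a * m" "\<not> d dvd p ^ a * m"
  shows "p ^ Suc a dvd d"
proof -
  obtain d1 d2 where d: "d = d1 * d2" "d1 dvd p ^ Suc a" "d2 dvd m"
    using division_decomp[OF assms(2)] by blast
  obtain i where i: "i \<le> Suc a" "d1 = p ^ i" using d(2) assms(1) divides_primepow_nat by blast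
  have "i = Suc a"
  proof (rule ccontr)
    assume "i \<noteq> Suc a"
    then have "d1 dvd p ^ a" using i by (simp add: le_imp_power_dvd)
    then show False using d assms(3) mult_dvd_mono by blast
  qed
  then show ?thesis using d i by simp
qed

lemma dvd_totient_of_prime_power_dvd:
  assumes "prime p" "p ^ Suc a dvd d"
  shows "p ^ a * (p - 1) dvd totient d"
  using totient_dvd[OF assms(2)] assms(1) by (simp add: totient_prime_power_Suc del: power_Suc)

context finite_group
begin

definition nroots :: "'a set \<Rightarrow> nat \<Rightarrow> nat" where
  "nroots H k = card {x \<in> H. x [^] k = \<one>}"

lemma pow_eq_one_iff: "x \<in> carrier G \<Longrightarrow> x [^] (n::nat) = \<one> \<longleftrightarrow> ord x dvd n"
  by (rule pow_eq_id)

text \<open>Orders of elements of H divide \<open>card H\<close>. This makes Frobenius' theorem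
  usable in a centralizer whose order the exponent need not divide.\<close>

lemma nroots_gcd:
  assumes "subgroup H G"
  shows "nroots H (gcd k (card H)) = nroots H k"
proof -
  have "{x \<in> H. x [^] gcd k (card H) = \<one>} = {x \<in> H. x [^] k = \<one>}"
    using assms ord_dvd_card_subgroup subgroup.mem_carrier[OF assms] by (auto simp: pow_eq_one_iff)
  then show ?thesis by (simp add: nroots_def)
qed

lemma nroots_card: "subgroup H G \<Longrightarrow> nroots H (card H) = card H"
proof -
  assume H: "subgroup H G"
  then have "{x \<in> H. x [^] card H = \<one>} = H"
    using ord_dvd_card_subgroup subgroup.mem_carrier[OF H] by (auto simp: pow_eq_one_iff)
  then show ?thesis by (simp add: nroots_def)
qed

text \<open>The roots gained in passing from p^a m to p^(a+1) m have orders divisible by p^(a+1) and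
  come in full sets of generators, so their number is a multiple of totient (p^(a+1)) = p^a (p -
  1).\<close>

lemma nroots_diff_dvd:
  assumes H: "subgroup H G" and p: "prime p"
  shows "nroots H (p ^ a * m) \<le> nroots H (p ^ Suc a * m)"
    and "p ^ a * (p - 1) dvd nroots H (p ^ Suc a * m) - nroots H (p ^ a * m)"
proof -
  let ?A = "{x \<in> H. x [^] (p ^ Suc a * m) = \<one>}" and ?B = "{x \<in> H. x [^] (p ^ a * m) = \<one>}"
  have "p ^ a * m dvd p ^ Suc a * m" by simp
  then have "x [^] (p ^ Suc a * m) = \<one>" if "x \<in> H" "x [^] (p ^ a * m) = \<one>" for x
    using that subgroup.mem_carrier[OF H] dvd_trans pow_eq_one_iff by metis
  then have sub: "?B \<subseteq> ?A" by blast
  have fin: "finite ?A" using finite_subgroup[OF H] by simp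
  show "nroots H (p ^ a * m) \<le> nroots H (p ^ Suc a * m)"
    unfolding nroots_def by (rule card_mono[OF fin sub])
  have "p ^ a * (p - 1) dvd card (?A - ?B)"
  proof (rule dvd_card_closed_generators)
    show "?A - ?B \<subseteq> carrier G" using subgroup.subset[OF H] by auto
    show "z \<in> ?A - ?B" if x: "x \<in> ?A - ?B" and z: "z \<in> carrier G" "generate G {z} = generate G {x}" for x z
    proof -
      have xc: "x \<in> carrier G" using x subgroup.mem_carrier[OF H] by auto
      have "ord z = ord x" using z xc generate_pow_card by metis
      moreover have "z \<in> H"
        using z(2) x generate_subgroup_incl[OF _ H, of "{x}"] generate.incl[of z "{z}"] by auto
      ultimately show ?thesis using x xc z by (auto simp: pow_eq_one_iff)
    qed
    show "p ^ a * (p - 1) dvd totient (ord x)" if "x \<in> ?A - ?B" for x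
      using that subgroup.mem_carrier[OF H] p
      by (intro dvd_totient_of_prime_power_dvd prime_power_dvd_of_not_dvd) (auto simp: pow_eq_one_iff)
  qed
  then show "p ^ a * (p - 1) dvd nroots H (p ^ Suc a * m) - nroots H (p ^ a * m)"
    unfolding nroots_def using card_Diff_subset[OF _ sub] fin finite_subset[OF sub] by simp
qed

abbreviation centralizer_in :: "'a set \<Rightarrow> 'a \<Rightarrow> 'a set" where
  "centralizer_in H y \<equiv> {x \<in> H. x \<otimes> y = y \<otimes> x}"

lemma subgroup_centralizer_in:
  assumes H: "subgroup H G" and y: "y \<in> carrier G"
  shows "subgroup (centralizer_in H y) G"
proof (rule subgroupI)
  have c: "\<And>h. h \<in> H \<Longrightarrow> h \<in> carrier G" using H subgroup.mem_carrier by metis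
  show "centralizer_in H y \<subseteq> carrier G" using c by auto
  show "centralizer_in H y \<noteq> {}" using subgroup.one_closed[OF H] y by auto
  show "inv a \<in> centralizer_in H y" if "a \<in> centralizer_in H y" for a
  proof -
    have a: "a \<in> carrier G" "a \<otimes> y = y \<otimes> a" using that c by auto
    then have "y = inv a \<otimes> (y \<otimes> a)" using y by (simp add: inv_solve_left)
    then have "inv a \<otimes> y = y \<otimes> inv a" using a y by (metis inv_closed inv_solve_right m_assoc m_closed)
    then show ?thesis using that H by (auto simp: subgroup.m_inv_closed)
  qed
  show "a \<otimes> b \<in> centralizer_in H y" if "a \<in> centralizer_in H y" "b \<in> centralizer_in H y" for a b
  proof -
    have ab: "a \<otimes> y = y \<otimes> a" "b \<otimes> y = y \<otimes> b" "a \<in> carrier G" "b \<in> carrier G" using that c by auto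
    have "a \<otimes> b \<otimes> y = a \<otimes> (y \<otimes> b)" using ab y by (simp add: m_assoc)
    also have "\<dots> = y \<otimes> a \<otimes> b" using ab y by (simp add: m_assoc[symmetric])
    finally show ?thesis using that H ab y by (auto simp: subgroup.m_closed m_assoc)
  qed
qed

text \<open>Every element is uniquely a product of commuting elements of orders dividing \<open>q\<close> and \<open>m\<close>.\<close>

lemma nroots_coprime_mult:
  assumes H: "subgroup H G" and co: "coprime q m"
  shows "nroots H (q * m) = (\<Sum>y\<in>{y \<in> H. y [^] q = \<one>}. nroots (centralizer_in H y) m)"
proof -
  have c: "\<And>h. h \<in> H \<Longrightarrow> h \<in> carrier G" using H subgroup.mem_carrier by metis
  let ?Y = "{y \<in> H. y [^] q = \<one>}" and ?Z = "\<lambda>y. {z \<in> centralizer_in H y. z [^] m = \<one>}"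
  \<comment> \<open>\<open>s\<close> and \<open>t\<close> are the idempotents of the Chinese
    remainder theorem: x^s and x^t are the two components of x, and s + t = 1 modulo q m recombines
    them.\<close>
  obtain s where s: "[s = 1] (mod q)" "[s = 0] (mod m)" using binary_chinese_remainder_nat[OF co] by blast
  obtain t where t: "[t = 0] (mod q)" "[t = 1] (mod m)" using binary_chinese_remainder_nat[OF co] by blast
  have "bij_betw (\<lambda>(y, z). y \<otimes> z) (Sigma ?Y ?Z) {x \<in> H. x [^] (q * m) = \<one>}"
  proof (rule bij_betwI[where g = "\<lambda>x. (x [^] s, x [^] t)"])
    show "(\<lambda>(y, z). y \<otimes> z) \<in> Sigma ?Y ?Z \<rightarrow> {x \<in> H. x [^] (q * m) = \<one>}"
    proof safe
      fix y z assume a: "y \<in> H" "y [^] q = \<one>" "z \<in> H" "z \<otimes> y = y \<otimes> z" "z [^] m = \<one>"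
      show "y \<otimes> z \<in> H" using a H by (simp add: subgroup.m_closed)
      have "y [^] (q * m) = \<one>" "z [^] (q * m) = \<one>" using a c by (auto simp: pow_eq_one_iff)
      then show "(y \<otimes> z) [^] (q * m) = \<one>" using a c by (simp add: pow_mult_distrib)
    qed
    show "(\<lambda>x. (x [^] s, x [^] t)) \<in> {x \<in> H. x [^] (q * m) = \<one>} \<rightarrow> Sigma ?Y ?Z"
    proof (intro funcsetI)
      fix x assume x: "x \<in> {x \<in> H. x [^] (q * m) = \<one>}"
      then have xc: "x \<in> carrier G" using c by auto
      have "q * m dvd s * q" "q * m dvd t * m" using s t
        by (auto simp: cong_0_iff mult.commute mult_dvd_mono)
      then have "x [^] (s * q) = \<one>" "x [^] (t * m) = \<one>"
        using x xc pow_eq_one_iff dvd_trans by blast+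
      moreover have "x [^] t \<otimes> x [^] s = x [^] s \<otimes> x [^] t" using xc by (simp add: nat_pow_mult add.commute)
      ultimately show "(x [^] s, x [^] t) \<in> Sigma ?Y ?Z"
        using x xc subgroup_pow_closed[OF H] by (auto simp: nat_pow_pow)
    qed
    show "(\<lambda>x. (x [^] s, x [^] t)) ((\<lambda>(y, z). y \<otimes> z) a) = a" if "a \<in> Sigma ?Y ?Z" for a
    proof -
      obtain y z where a: "a = (y, z)" "y \<in> H" "y [^] q = \<one>" "z \<in> H" "z \<otimes> y = y \<otimes> z" "z [^] m = \<one>"
        using \<open>a \<in> Sigma ?Y ?Z\<close> by auto
      have yz: "y \<in> carrier G" "z \<in> carrier G" using a c by auto
      have "y [^] s = y" "z [^] s = \<one>" "y [^] t = \<one>" "z [^] t = z"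
        using pow_eq_pow_of_cong[OF yz(1) a(3) s(1)] pow_eq_pow_of_cong[OF yz(2) a(6) s(2)]
          pow_eq_pow_of_cong[OF yz(1) a(3) t(1)] pow_eq_pow_of_cong[OF yz(2) a(6) t(2)] yz by auto
      then show ?thesis using a yz by (simp add: pow_mult_distrib)
    qed
    show "(\<lambda>(y, z). y \<otimes> z) ((\<lambda>x. (x [^] s, x [^] t)) x) = x" if "x \<in> {x \<in> H. x [^] (q * m) = \<one>}" for x
    proof -
      have xc: "x \<in> carrier G" using that c by auto
      have "[s + t = 1 + 0] (mod q)" "[s + t = 0 + 1] (mod m)" using s t by (intro cong_add; simp)+
      then have "[s + t = 1] (mod (q * m))" using co by (simp add: coprime_cong_mult_nat)
      then have "x [^] (s + t) = x" using pow_eq_pow_of_cong[OF xc, of "q * m" "s + t" 1] that xc by simp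
      then show ?thesis using xc by (simp add: nat_pow_mult)
    qed
  qed
  then have "nroots H (q * m) = card (Sigma ?Y ?Z)" by (simp add: nroots_def bij_betw_same_card)
  also have "\<dots> = (\<Sum>y\<in>?Y. card (?Z y))"
    using finite_subgroup[OF H] by (intro card_SigmaI) auto
  finally show ?thesis by (simp add: nroots_def)
qed

end

section \<open>Conjugation\<close>

context group
begin

definition conj_by :: "'a \<Rightarrow> 'a \<Rightarrow> 'a" where
  "conj_by g x = g \<otimes> x \<otimes> inv g"

lemma conj_by_closed [simp]: "g \<in> carrier G \<Longrightarrow> x \<in> carrier G \<Longrightarrow> conj_by g x \<in> carrier G"
  by (simp add: conj_by_def)

lemma conj_by_mult:
  assumes "g \<in> carrier G" "x \<in> carrier G" "y \<in> carrier G"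
  shows "conj_by g (x \<otimes> y) = conj_by g x \<otimes> conj_by g y"
proof -
  have "inv g \<otimes> (g \<otimes> (y \<otimes> inv g)) = y \<otimes> inv g" using assms by (simp add: m_assoc[symmetric])
  then show ?thesis using assms by (simp add: conj_by_def m_assoc)
qed

lemma conj_by_one [simp]: "g \<in> carrier G \<Longrightarrow> conj_by g \<one> = \<one>"
  by (simp add: conj_by_def)

lemma conj_by_one_left [simp]: "x \<in> carrier G \<Longrightarrow> conj_by \<one> x = x"
  by (simp add: conj_by_def)

lemma conj_by_pow:
  "g \<in> carrier G \<Longrightarrow> x \<in> carrier G \<Longrightarrow> conj_by g (x [^] (n::nat)) = conj_by g x [^] n"
  by (induction n) (simp_all add: conj_by_mult)

lemma conj_by_conj_by:
  "g \<in> carrier G \<Longrightarrow> h \<in> carrier G \<Longrightarrow> x \<in> carrier G \<Longrightarrow> conj_by g (conj_by h x) = conj_by (g \<otimes> h) x"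
  by (simp add: conj_by_def m_assoc inv_mult_group)

lemma conj_by_inv_cancel [simp]:
  "g \<in> carrier G \<Longrightarrow> x \<in> carrier G \<Longrightarrow> conj_by (inv g) (conj_by g x) = x"
  "g \<in> carrier G \<Longrightarrow> x \<in> carrier G \<Longrightarrow> conj_by g (conj_by (inv g) x) = x"
  by (simp_all add: conj_by_conj_by)

lemma inj_on_conj_by: "g \<in> carrier G \<Longrightarrow> inj_on (conj_by g) (carrier G)"
  by (rule inj_on_inverseI[where g = "conj_by (inv g)"]) simp

lemma commute_inv:
  assumes "a \<in> carrier G" "x \<in> carrier G" "a \<otimes> x = x \<otimes> a"
  shows "inv a \<otimes> x = x \<otimes> inv a"
proof -
  have "x = inv a \<otimes> (x \<otimes> a)" using assms by (simp add: inv_solve_left)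
  then show ?thesis using assms by (metis inv_closed inv_solve_right m_assoc m_closed)
qed

lemma subgroup_conj_by_closed:
  "subgroup H G \<Longrightarrow> g \<in> H \<Longrightarrow> x \<in> H \<Longrightarrow> conj_by g x \<in> H"
  by (simp add: conj_by_def subgroup.m_closed subgroup.m_inv_closed)

end

context finite_group
begin

lemma exists_subgroup_prime_power:
  assumes H: "subgroup H G" and p: "prime p" "p ^ a dvd card H"
  shows "\<exists>P. subgroup P G \<and> P \<subseteq> H \<and> card P = p ^ a"
proof -
  obtain k where k: "card H = p ^ a * k" using p(2) by blast
  have "\<exists>P. subgroup P (G\<lparr>carrier := H\<rparr>) \<and> card P = p ^ a"
    using k finite_subgroup[OF H] subgroup_imp_group[OF H] p(1)
    by (intro sylow_thm) (auto simp: order_def)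
  then obtain P where P: "subgroup P (G\<lparr>carrier := H\<rparr>)" "card P = p ^ a" by blast
  then show ?thesis using incl_subgroup[OF H] subgroup.subset by fastforce
qed

lemma cauchy:
  assumes H: "subgroup H G" and p: "prime p" "p dvd card H"
  shows "\<exists>x\<in>H. ord x = p"
proof -
  obtain P where P: "subgroup P G" "P \<subseteq> H" "card P = p"
    using exists_subgroup_prime_power[OF H p(1), of 1] p(2) by auto
  have "P \<noteq> {\<one>}" using P p(1) by auto
  then obtain x where x: "x \<in> P" "x \<noteq> \<one>" using subgroup.one_closed[OF P(1)] by auto
  have xc: "x \<in> carrier G" using x P subgroup.mem_carrier by metis
  have "ord x dvd p" using ord_dvd_card_subgroup[OF P(1) x(1)] P by simp
  moreover have "ord x \<noteq> 1" using x xc ord_eq_1 by blast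
  ultimately have "ord x = p" using p(1) by (metis prime_nat_iff)
  then show ?thesis using x P by blast
qed

end

section \<open>Frobenius' theorem\<close>

context finite_group
begin

text \<open>A root x for p^j m is a commuting product y z with y^(p^j) = 1 and z^m = 1. The terms
  with y outside the centre of H add up to a multiple of m for every j, by the induction hypothesis
  on centralizers. A central y contributes \<open>nroots H m\<close>. At the exponent A of
  \<open>top\<close> the whole count is a multiple of m, and the number of central y is then prime
  to m, so m divides \<open>nroots H m\<close> and hence the count for every exponent.\<close>

lemma frobenius_coprime_part:
  assumes H: "subgroup H G" and p: "prime p" and m: "m dvd card H" "\<not> p dvd m"
    and top: "m dvd nroots H (p ^ A * m)"
    and IH: "\<And>C. subgroup C G \<Longrightarrow> C \<subset> H \<Longrightarrow> gcd m (card C) dvd nroots C (gcd m (card C))"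
  shows "m dvd nroots H (p ^ i * m)"
proof -
  have c: "\<And>h. h \<in> H \<Longrightarrow> h \<in> carrier G" using H subgroup.mem_carrier by metis
  have co: "coprime (p ^ j) m" for j using p m(2) by (simp add: prime_imp_coprime)
  let ?Y = "\<lambda>j. {y \<in> H. y [^] (p ^ j) = \<one>}"
  define Z where "Z = {y \<in> H. \<forall>x\<in>H. x \<otimes> y = y \<otimes> x}"
  have ZI: "y \<in> Z" if "y \<in> H" "\<And>x. x \<in> H \<Longrightarrow> x \<otimes> y = y \<otimes> x" for y using that by (simp add: Z_def)
  have ZH: "y \<in> H" if "y \<in> Z" for y using that by (simp add: Z_def)
  have ZD: "x \<otimes> y = y \<otimes> x" if "y \<in> Z" "x \<in> H" for x y using that unfolding Z_def by blast
  let ?N = "\<lambda>y. nroots (centralizer_in H y) m"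
  have split: "nroots H (p ^ j * m) = (\<Sum>y\<in>?Y j - Z. ?N y) + card (?Y j \<inter> Z) * nroots H m" for j
  proof -
    have 1: "nroots H (p ^ j * m) = (\<Sum>y\<in>?Y j. ?N y)" by (rule nroots_coprime_mult[OF H co])
    have 2: "(\<Sum>y\<in>?Y j. ?N y) = (\<Sum>y\<in>?Y j - Z. ?N y) + (\<Sum>y\<in>?Y j \<inter> Z. ?N y)"
      using finite_subgroup[OF H] by (subst add.commute, intro sum.Int_Diff) auto
    have "(\<Sum>y\<in>?Y j \<inter> Z. ?N y) = (\<Sum>y\<in>?Y j \<inter> Z. nroots H m)"
    proof (rule sum.cong[OF HOL.refl])
      fix y assume "y \<in> ?Y j \<inter> Z"
      then have "centralizer_in H y = H" using ZD by blast
      then show "?N y = nroots H m" by simp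
    qed
    then show ?thesis unfolding 1 2 by simp
  qed
  have noncentral: "m dvd (\<Sum>y\<in>?Y j - Z. ?N y)" for j
  proof -
    let ?cl = "\<lambda>y. (\<lambda>g. conj_by g y) ` H"
    have cl_eq: "?cl z = ?cl y" if z: "z \<in> ?cl y" and y: "y \<in> H" for y z
    proof -
      have sub: "?cl z \<subseteq> ?cl y" if z: "z \<in> ?cl y" and y: "y \<in> H" for y z
      proof
        fix w assume "w \<in> ?cl z"
        then obtain g h where gh: "g \<in> H" "h \<in> H" "z = conj_by g y" "w = conj_by h z"
          using z by auto
        then have "w = conj_by (h \<otimes> g) y" using c y by (simp add: conj_by_conj_by)
        then show "w \<in> ?cl y" using gh subgroup.m_closed[OF H] by blast
      qed
      have y': "y \<in> ?cl z"
      proof -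
        obtain g where "g \<in> H" "z = conj_by g y" using z by auto
        then have "y = conj_by (inv g) z" "inv g \<in> H" using c y subgroup.m_inv_closed[OF H] by auto
        then show ?thesis by blast
      qed
      have "z \<in> H" using z y subgroup_conj_by_closed[OF H] by blast
      then show ?thesis using equalityI[OF sub[OF z y] sub[OF y']] by simp
    qed
    have self: "y \<in> ?cl y" if "y \<in> H" for y
      using that c subgroup.one_closed[OF H] by (auto intro!: image_eqI[of _ _ \<one>])
    show ?thesis
    proof (rule dvd_sum_by_fibres[where g = ?cl])
      show "finite (?Y j - Z)" using finite_subgroup[OF H] by simp
      fix y assume y: "y \<in> ?Y j - Z"
      then have yH: "y \<in> H" and yc: "y \<in> carrier G" using c by auto
      let ?C = "centralizer_in H y"
      have fibre: "{z \<in> ?Y j - Z. ?cl z = ?cl y} = ?cl y"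
      proof (intro equalityI subsetI)
        fix z assume "z \<in> {z \<in> ?Y j - Z. ?cl z = ?cl y}"
        then show "z \<in> ?cl y" using self by auto
      next
        fix z assume z: "z \<in> ?cl y"
        then obtain g where g: "g \<in> H" "z = conj_by g y" by auto
        have zH: "z \<in> H" using g yH subgroup_conj_by_closed[OF H] by auto
        have "z [^] (p ^ j) = conj_by g (y [^] (p ^ j))" using g c yc by (simp add: conj_by_pow)
        then have "z [^] (p ^ j) = \<one>" using y g c by simp
        moreover have "z \<notin> Z"
        proof
          assume Z: "z \<in> Z"
          have "inv g \<otimes> z = z \<otimes> inv g" using ZD[OF Z] g subgroup.m_inv_closed[OF H] by blast
          then have "conj_by (inv g) z = z" using g c zH by (simp add: conj_by_def m_assoc)
          then have "y = z" using g c yc by simp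
          then show False using Z y by blast
        qed
        ultimately show "z \<in> {z \<in> ?Y j - Z. ?cl z = ?cl y}" using zH cl_eq[OF z yH] by blast
      qed
      have const: "?N z = ?N y" if "z \<in> ?cl y" for z
      proof -
        obtain g where g: "g \<in> H" "z = conj_by g y" using \<open>z \<in> ?cl y\<close> by auto
        have gc: "g \<in> carrier G" using g c by auto
        have "bij_betw (conj_by g) {x \<in> ?C. x [^] m = \<one>} {x \<in> centralizer_in H z. x [^] m = \<one>}"
        proof (rule bij_betwI[where g = "conj_by (inv g)"])
          show "conj_by g \<in> {x \<in> ?C. x [^] m = \<one>} \<rightarrow> {x \<in> centralizer_in H z. x [^] m = \<one>}"
            using g gc yc c subgroup_conj_by_closed[OF H]
            by (auto simp: conj_by_pow[symmetric] conj_by_mult[symmetric])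
          show "conj_by (inv g) \<in> {x \<in> centralizer_in H z. x [^] m = \<one>} \<rightarrow> {x \<in> ?C. x [^] m = \<one>}"
          proof
            fix x assume x: "x \<in> {x \<in> centralizer_in H z. x [^] m = \<one>}"
            then have xc: "x \<in> carrier G" using c by auto
            have zc: "z \<in> carrier G" using g gc yc by simp
            have yz: "y = conj_by (inv g) z" using g gc yc by simp
            have "conj_by (inv g) x \<otimes> y = y \<otimes> conj_by (inv g) x"
              unfolding yz using x xc zc gc by (simp add: conj_by_mult[symmetric])
            then show "conj_by (inv g) x \<in> {x \<in> ?C. x [^] m = \<one>}"
              using x xc gc g subgroup_conj_by_closed[OF H] subgroup.m_inv_closed[OF H]
              by (auto simp: conj_by_pow[symmetric])
          qed
        qed (use gc c in auto)
        then show ?thesis by (simp add: nroots_def bij_betw_same_card)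
      qed
      have C: "subgroup ?C G" by (rule subgroup_centralizer_in[OF H yc])
      have "?C \<subset> H" using y ZI by blast
      from IH[OF C this] have "gcd m (card ?C) dvd ?N y" by (simp add: nroots_gcd[OF C])
      then have A: "card (?cl y) * gcd m (card ?C) dvd card (?cl y) * ?N y" by (rule mult_dvd_mono[OF dvd_refl])
      \<comment> \<open>The class size times \<open>card ?C\<close> is \<open>card H\<close>, so m
        divides both the class size times m and the class size times \<open>card ?C\<close>, hence
        their gcd.\<close>
      have B: "m dvd card (?cl y) * gcd m (card ?C)"
        using card_conjugates[OF H yH] m(1)
        by (simp add: conj_by_def gcd_mult_distrib_nat)
      have "(\<Sum>z\<in>{z \<in> ?Y j - Z. ?cl z = ?cl y}. ?N z) = card (?cl y) * ?N y"
        unfolding fibre using const by simp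
      then show "m dvd (\<Sum>z\<in>{z \<in> ?Y j - Z. ?cl z = ?cl y}. ?N z)"
        using dvd_trans[OF B A] by simp
    qed
  qed
  have YZ: "subgroup (?Y A \<inter> Z) G"
  proof (rule subgroupI)
    show "?Y A \<inter> Z \<subseteq> carrier G" using c by auto
    have "\<one> \<in> ?Y A \<inter> Z" using c subgroup.one_closed[OF H] by (auto intro: ZI)
    then show "?Y A \<inter> Z \<noteq> {}" by blast
    fix a assume a: "a \<in> ?Y A \<inter> Z"
    have "x \<otimes> inv a = inv a \<otimes> x" if "x \<in> H" for x
      using commute_inv[of a x] a c that ZD[of a x] by simp
    moreover have "inv a \<in> H" "inv a [^] (p ^ A) = \<one>"
      using a c subgroup.m_inv_closed[OF H] by (auto simp: nat_pow_inv)
    ultimately show "inv a \<in> ?Y A \<inter> Z" using ZI by blast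
    fix b assume b: "b \<in> ?Y A \<inter> Z"
    have "x \<otimes> (a \<otimes> b) = a \<otimes> b \<otimes> x" if "x \<in> H" for x
    proof -
      have ax: "x \<otimes> a = a \<otimes> x" "x \<otimes> b = b \<otimes> x" using ZD a b that by auto
      have cc: "a \<in> carrier G" "b \<in> carrier G" "x \<in> carrier G" using a b that c by auto
      have "x \<otimes> (a \<otimes> b) = a \<otimes> (x \<otimes> b)" using ax cc by (metis m_assoc)
      then show ?thesis using ax cc by (simp add: m_assoc)
    qed
    moreover have "(a \<otimes> b) [^] (p ^ A) = \<one>"
      using a b c ZD[of b a] by (subst pow_mult_distrib) simp_all
    moreover have "a \<otimes> b \<in> H" using a b subgroup.m_closed[OF H] by simp
    ultimately show "a \<otimes> b \<in> ?Y A \<inter> Z" using ZI by blast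
  qed
  \<comment> \<open>This subgroup consists of p-elements; by Cauchy a prime divisor q of its order
    is p, which does not divide m.\<close>
  have "coprime m (card (?Y A \<inter> Z))"
  proof (rule ccontr)
    assume "\<not> coprime m (card (?Y A \<inter> Z))"
    then obtain q where q: "prime q" "q dvd m" "q dvd card (?Y A \<inter> Z)"
      using prime_factor_nat[of "gcd m (card (?Y A \<inter> Z))"] by (auto simp: coprime_iff_gcd_eq_1)
    then obtain x where x: "x \<in> ?Y A \<inter> Z" "ord x = q" using cauchy[OF YZ] by blast
    then have "q dvd p ^ A" using c pow_eq_one_iff by fastforce
    then have "q = p" using q p by (meson prime_dvd_power primes_dvd_imp_eq)
    then show False using q m by simp
  qed
  moreover have "m dvd card (?Y A \<inter> Z) * nroots H m"
    using top unfolding split[of A] dvd_add_right_iff[OF noncentral] .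
  ultimately have "m dvd nroots H m" using coprime_dvd_mult_right_iff by blast
  then show ?thesis
    by (subst split) (rule dvd_add[OF noncentral dvd_mult])
qed

text \<open>The outer induction is on \<open>card H\<close>. The inner one descends through the
  divisors k, starting at k = \<open>card H\<close>, where every element is a root. With k = p^a m,
  the factor p^a is inherited from the count for p k through \<open>nroots_diff_dvd\<close>, and the
  factor m comes from \<open>frobenius_coprime_part\<close>.\<close>

theorem frobenius_dvd_nroots:
  assumes "subgroup H G" "k dvd card H"
  shows "k dvd nroots H k"
  using assms
proof (induction "card H" arbitrary: H k rule: less_induct)
  case (less H)
  note IH = less.hyps and H = less.prems(1)
  have fin: "finite H" using finite_subgroup[OF H] .
  have n0: "0 < card H" using fin subgroup.one_closed[OF H] card_gt_0_iff by blast
  have "k dvd nroots H k" if "k dvd card H" for k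
    using that
  proof (induction "card H - k" arbitrary: k rule: less_induct)
    case (less k)
    note IH2 = less.hyps
    show ?case
    proof (cases "k = card H")
      case True
      then show ?thesis using nroots_card[OF H] by simp
    next
      case False
      obtain l where l: "card H = k * l" using less.prems by blast
      then have "l \<noteq> 1" using False by auto
      \<comment> \<open>The prime is taken from the cofactor of k, so that p k is a larger divisor
        of \<open>card H\<close>, already settled by the inner induction.\<close>
      then obtain p where p: "prime p" "p dvd l" using prime_factor_nat by blast
      then have pk: "p * k dvd card H" using l by (simp add: mult.commute mult_dvd_mono)
      have k0: "0 < k" using n0 l by (cases k) auto
      obtain a m where am: "k = p ^ a * m" "\<not> p dvd m"
        using multiplicity_decompose'[of k p] k0 p(1) by (metis mult.commute not_gr_zero not_prime_unit)
      have up: "j dvd nroots H j" if "j dvd card H" "k < j" for j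
        using IH2[of j] that n0 dvd_imp_le[OF that(1) n0] by simp
      have pk': "p ^ Suc a * m dvd nroots H (p ^ Suc a * m)"
        using up[of "p * k"] pk k0 prime_gt_1_nat[OF p(1)] am by (simp add: mult.assoc)
      have "p ^ a dvd nroots H k"
      proof -
        have "p ^ a dvd nroots H (p ^ Suc a * m) - nroots H (p ^ a * m)"
          using nroots_diff_dvd(2)[OF H p(1)] dvd_mult_left by blast
        moreover have "p ^ a dvd p ^ Suc a * m" by (simp add: dvd_mult2)
        then have "p ^ a dvd nroots H (p ^ Suc a * m)" using pk' dvd_trans by blast
        ultimately show ?thesis
          using nroots_diff_dvd(1)[OF H p(1), of a m] am by (metis dvd_diffD1)
      qed
      moreover have "m dvd nroots H k"
      proof -
        have top: "m dvd nroots H (p ^ Suc a * m)" using pk' dvd_mult_right by blast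
        have "gcd m (card C) dvd nroots C (gcd m (card C))" if "subgroup C G" "C \<subset> H" for C
          using IH[of C] that psubset_card_mono[OF fin] by simp
        moreover have "m dvd card H" using less.prems am dvd_mult_right by blast
        ultimately show ?thesis unfolding am(1)
          using frobenius_coprime_part[OF H p(1) _ am(2) top] by blast
      qed
      moreover have "coprime (p ^ a) m" using p am by (simp add: prime_imp_coprime)
      ultimately show ?thesis unfolding am(1) by (simp add: divides_mult)
    qed
  qed
  then show ?case using less.prems by blast
qed

end

section \<open>Lower bounds for the number of subgroups\<close>

lemma prod_if_restrict:
  fixes f :: "'a \<Rightarrow> real"
  assumes "finite A"
  shows "(\<Prod>x\<in>A. if P x then f x else 1) = (\<Prod>x\<in>{x \<in> A. P x}. f x)"
  using assms by (simp add: prod.If_cases Int_def)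

lemma prime_count_eq: "0 < k \<Longrightarrow> prime_count k = card (prime_factors k)"
  unfolding prime_count_def by (simp add: prime_factors_dvd Collect_conj_eq)

text \<open>The expression is 1 + (q^v - 1) / totient (q^v), and totient (q^v) is at most q^v -
  1.\<close>

lemma two_le_factor:
  assumes "prime (q::nat)" "0 < v"
  shows "(2::real) \<le> 1 - 1 / real (q ^ (v - 1) * (q - 1)) + real (q ^ v) / real (q ^ (v - 1) * (q - 1))"
proof -
  have q: "2 \<le> q" using prime_ge_2_nat[OF assms(1)] .
  have "q ^ (v - 1) * (q - 1) + 1 \<le> q ^ v"
  proof -
    have "q ^ v = q ^ (v - 1) * q" using assms(2) by (simp flip: power_Suc2)
    moreover have "q = q - 1 + 1" using q by simp
    ultimately have "q ^ v = q ^ (v - 1) * (q - 1) + q ^ (v - 1)"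
      by (metis add_mult_distrib2 mult.right_neutral)
    then show ?thesis using q by simp
  qed
  then have "real (q ^ (v - 1) * (q - 1)) + 1 \<le> real (q ^ v)" by (metis of_nat_1 of_nat_add of_nat_le_iff)
  moreover have "0 < real (q ^ (v - 1) * (q - 1))" using q by simp
  ultimately show ?thesis by (simp add: field_simps del: of_nat_mult of_nat_power)
qed

text \<open>The expression is 1 + (p^v - 1) / totient (p^(v-1)). The bound 3 totient (p^(v-1)) + 1
  \<le> p^v rests on p^2 = 3 (p - 1) + 1 + (p - 2)(p - 1), with equality throughout only for p = v =
  2.\<close>

lemma four_le_factor:
  assumes "prime (p::nat)" "2 \<le> v"
  shows "(4::real) \<le> 1 - 1 / real (p ^ (v - 2) * (p - 1)) + real (p ^ v) / real (p ^ (v - 2) * (p - 1))"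
proof -
  define u where "u = p - 2"
  have p: "p = u + 2" using prime_ge_2_nat[OF assms(1)] by (simp add: u_def)
  have "3 * (p ^ (v - 2) * (p - 1)) + 1 \<le> p ^ v"
  proof -
    have "v = v - 2 + 2" using assms(2) by simp
    then have "p ^ v = p ^ (v - 2) * p ^ 2" by (metis power_add)
    moreover have "p ^ 2 = 3 * (p - 1) + 1 + (u ^ 2 + u)" by (simp add: p power2_eq_square algebra_simps)
    ultimately have "p ^ v = 3 * (p ^ (v - 2) * (p - 1)) + p ^ (v - 2) + p ^ (v - 2) * (u ^ 2 + u)"
      by (simp add: algebra_simps)
    moreover have "1 \<le> p ^ (v - 2)" by (simp add: p)
    ultimately show ?thesis by linarith
  qed
  from of_nat_mono[OF this, where 'a = real] have "3 * real (p ^ (v - 2) * (p - 1)) + 1 \<le> real (p ^ v)"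
    by (simp only: of_nat_add of_nat_mult of_nat_numeral of_nat_1)
  moreover have "0 < p ^ (v - 2) * (p - 1)" by (simp add: p)
  then have "0 < real (p ^ (v - 2) * (p - 1))" by (simp only: of_nat_0_less_iff)
  ultimately show ?thesis by (simp add: field_simps del: of_nat_mult of_nat_power)
qed

context finite_group
begin

lemma order_pos: "0 < order G"
  using order_gt_0_iff_finite by simp

lemma nroots_ge:
  assumes "subgroup H G" "k dvd card H"
  shows "k \<le> nroots H k"
proof (rule dvd_imp_le[OF frobenius_dvd_nroots[OF assms]])
  have "\<one> \<in> {x \<in> H. x [^] k = \<one>}" using subgroup.one_closed[OF assms(1)] by simp
  moreover have "finite {x \<in> H. x [^] k = \<one>}" using finite_subgroup[OF assms(1)] by simp
  ultimately show "0 < nroots H k" unfolding nroots_def card_gt_0_iff by blast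
qed

text \<open>
  The weight \<open>1 / totient (ord x)\<close> is at least a product over the primes \<open>q\<close> of factors
  \<open>(1 - 1 / c q) * [q not dividing ord x] + 1 / c q\<close>. Expanding the product over sets \<open>T\<close> of
  primes and summing over \<open>x\<close> leaves the numbers of elements of order prime to \<open>T\<close>,
  which Frobenius' theorem bounds from below.
\<close>

lemma card_cyclic_subgroups_ge_prod:
  fixes c :: "nat \<Rightarrow> real"
  assumes c: "\<And>q. q \<in> prime_factors (order G) \<Longrightarrow> 1 \<le> c q"
    and bound: "\<And>x. x \<in> carrier G \<Longrightarrow>
      real (totient (ord x)) \<le> (\<Prod>q\<in>{q \<in> prime_factors (order G). q dvd ord x}. c q)"
  shows "(\<Prod>q\<in>prime_factors (order G). 1 - 1 / c q + real (q ^ multiplicity q (order G)) / c q)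
    \<le> real (card ((\<lambda>x. generate G {x}) ` carrier G))"
proof -
  define n where "n = order G"
  define P where "P = prime_factors n"
  have fin: "finite P" by (simp add: P_def)
  let ?g = "\<lambda>x q. if q dvd ord x then 0 else 1 - 1 / c q"
  let ?W = "\<lambda>T. (\<Prod>q\<in>T. 1 - 1 / c q) * (\<Prod>q\<in>P - T. 1 / c q)"
  have c1: "1 \<le> c q" if "q \<in> P" for q using c that by (simp add: P_def n_def)
  have weight: "(\<Sum>T\<in>Pow P. (\<Prod>q\<in>T. ?g x q) * (\<Prod>q\<in>P - T. 1 / c q)) \<le> 1 / real (totient (ord x))"
    if x: "x \<in> carrier G" for x
  proof -
    have "(\<Sum>T\<in>Pow P. (\<Prod>q\<in>T. ?g x q) * (\<Prod>q\<in>P - T. 1 / c q)) = (\<Prod>q\<in>P. ?g x q + 1 / c q)"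
      by (rule prod_add[OF fin, symmetric])
    also have "\<dots> = (\<Prod>q\<in>P. if q dvd ord x then 1 / c q else 1)" by (rule prod.cong) auto
    also have "\<dots> = (\<Prod>q\<in>{q \<in> P. q dvd ord x}. 1 / c q)" by (rule prod_if_restrict[OF fin])
    also have "\<dots> = 1 / (\<Prod>q\<in>{q \<in> P. q dvd ord x}. c q)" by (simp add: prod_dividef)
    also have "\<dots> \<le> 1 / real (totient (ord x))"
    proof -
      have "0 < real (totient (ord x))" using ord_pos[OF x] by simp
      then show ?thesis using bound[OF x] by (simp add: P_def n_def frac_le)
    qed
    finally show ?thesis .
  qed
  have count: "(\<Prod>q\<in>P - T. real (q ^ multiplicity q n)) \<le> real (card {x \<in> carrier G. \<forall>q\<in>T. \<not> q dvd ord x})"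
    if T: "T \<subseteq> P" for T
  proof -
    \<comment> \<open>k is the part of n prime to T. A root of x^k = 1 has order prime to T, and
      Frobenius' theorem provides at least k such roots.\<close>
    define k where "k = (\<Prod>q\<in>P - T. q ^ multiplicity q n)"
    have n: "n = (\<Prod>q\<in>P. q ^ multiplicity q n)"
      unfolding P_def using order_pos by (intro prime_factorization_nat) (simp add: n_def)
    have "k dvd (\<Prod>q\<in>P. q ^ multiplicity q n)" unfolding k_def by (rule prod_dvd_prod_subset[OF fin]) auto
    then have "k dvd n" using n by simp
    then have "k \<le> nroots (carrier G) k" using nroots_ge[OF subgroup_self] by (simp add: n_def order_def)
    also have "nroots (carrier G) k \<le> card {x \<in> carrier G. \<forall>q\<in>T. \<not> q dvd ord x}"
      unfolding nroots_def
    proof (rule card_mono)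
      show "finite {x \<in> carrier G. \<forall>q\<in>T. \<not> q dvd ord x}" by simp
      show "{x \<in> carrier G. x [^] k = \<one>} \<subseteq> {x \<in> carrier G. \<forall>q\<in>T. \<not> q dvd ord x}"
      proof (intro subsetI CollectI conjI ballI notI)
        fix x q assume x: "x \<in> {x \<in> carrier G. x [^] k = \<one>}" and q: "q \<in> T" "q dvd ord x"
        have pq: "prime q" using q T by (auto simp: P_def)
        have "q dvd k" using x q pow_eq_one_iff dvd_trans by blast
        then obtain q' where q': "q' \<in> P - T" "q dvd q' ^ multiplicity q' n"
          unfolding k_def using prime_dvd_prod_iff[of "P - T" q] pq fin by auto
        then have "q = q'" using pq prime_dvd_power primes_dvd_imp_eq[of q q'] by (auto simp: P_def)
        then show False using q' q by simp
      qed simp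
    qed
    finally have "real k \<le> real (card {x \<in> carrier G. \<forall>q\<in>T. \<not> q dvd ord x})" by (simp only: of_nat_le_iff)
    then show ?thesis by (simp only: k_def of_nat_prod)
  qed
  \<comment> \<open>The hypothesis 1 \<le> \<open>c q\<close> makes all coefficients nonnegative, so
    the lower bounds for the counts may be inserted term by term.\<close>
  have W0: "0 \<le> ?W T" if "T \<subseteq> P" for T
  proof -
    have "0 \<le> 1 - 1 / c q" "0 \<le> 1 / c q" if "q \<in> P" for q using c1[OF that] by simp_all
    then show ?thesis using that by (intro mult_nonneg_nonneg prod_nonneg) blast+
  qed
  have "(\<Prod>q\<in>P. 1 - 1 / c q + real (q ^ multiplicity q n) / c q)
      = (\<Sum>T\<in>Pow P. (\<Prod>q\<in>T. 1 - 1 / c q) * (\<Prod>q\<in>P - T. real (q ^ multiplicity q n) / c q))"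
    by (rule prod_add[OF fin])
  also have "\<dots> = (\<Sum>T\<in>Pow P. ?W T * (\<Prod>q\<in>P - T. real (q ^ multiplicity q n)))"
    by (intro sum.cong HOL.refl) (simp add: prod_dividef)
  also have "\<dots> \<le> (\<Sum>T\<in>Pow P. ?W T * real (card {x \<in> carrier G. \<forall>q\<in>T. \<not> q dvd ord x}))"
    using count W0 by (intro sum_mono mult_left_mono) auto
  also have "\<dots> = (\<Sum>T\<in>Pow P. \<Sum>x\<in>carrier G. (\<Prod>q\<in>T. ?g x q) * (\<Prod>q\<in>P - T. 1 / c q))"
  proof (intro sum.cong HOL.refl)
    fix T assume T: "T \<in> Pow P"
    have finT: "finite T" using T fin finite_subset by auto
    \<comment> \<open>One prime of T dividing \<open>ord x\<close> annihilates the product, so it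
      acts as an indicator of order prime to T.\<close>
    have "(\<Prod>q\<in>T. ?g x q) = (if \<forall>q\<in>T. \<not> q dvd ord x then (\<Prod>q\<in>T. 1 - 1 / c q) else 0)" for x
      using finT by (auto simp: prod_zero_iff)
    then have "(\<Sum>x\<in>carrier G. (\<Prod>q\<in>T. ?g x q) * (\<Prod>q\<in>P - T. 1 / c q))
      = (\<Sum>x\<in>carrier G. if \<forall>q\<in>T. \<not> q dvd ord x then ?W T else 0)"
      by (intro sum.cong HOL.refl) simp
    also have "\<dots> = (\<Sum>x\<in>{x \<in> carrier G. \<forall>q\<in>T. \<not> q dvd ord x}. ?W T)"
      by (rule sum.inter_filter[symmetric]) simp
    finally show "?W T * real (card {x \<in> carrier G. \<forall>q\<in>T. \<not> q dvd ord x})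
      = (\<Sum>x\<in>carrier G. (\<Prod>q\<in>T. ?g x q) * (\<Prod>q\<in>P - T. 1 / c q))" by simp
  qed
  also have "\<dots> = (\<Sum>x\<in>carrier G. \<Sum>T\<in>Pow P. (\<Prod>q\<in>T. ?g x q) * (\<Prod>q\<in>P - T. 1 / c q))"
    by (rule sum.swap)
  also have "\<dots> \<le> (\<Sum>x\<in>carrier G. 1 / real (totient (ord x)))" by (rule sum_mono[OF weight])
  finally show ?thesis unfolding card_cyclic_subgroups by (simp add: P_def n_def)
qed

text \<open>Supplies the hypothesis \<open>bound\<close> of
  \<open>card_cyclic_subgroups_ge_prod\<close>. The cap \<open>e q\<close> is the exponent of q in
  the group order, lowered by one at a prime whose Sylow subgroup is not cyclic.\<close>

lemma totient_ord_le:
  assumes x: "x \<in> carrier G"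
    and e: "\<And>q. prime q \<Longrightarrow> q dvd ord x \<Longrightarrow> multiplicity q (ord x) \<le> e q"
  shows "real (totient (ord x)) \<le>
    (\<Prod>q\<in>{q \<in> prime_factors (order G). q dvd ord x}. real (q ^ (e q - 1) * (q - 1)))"
proof -
  have "{q \<in> prime_factors (order G). q dvd ord x} = prime_factors (ord x)"
    using ord_dvd_group_order[OF x] ord_pos[OF x] order_pos
    by (auto simp: prime_factors_dvd intro: dvd_trans)
  moreover have "(\<Prod>q\<in>prime_factors (ord x). q ^ (multiplicity q (ord x) - 1) * (q - 1))
      \<le> (\<Prod>q\<in>prime_factors (ord x). q ^ (e q - 1) * (q - 1))"
  proof (intro prod_mono conjI mult_le_mono1 power_increasing)
    fix q assume "q \<in> prime_factors (ord x)"
    then have q: "prime q" "q dvd ord x" by (auto simp: prime_factors_dvd)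
    show "multiplicity q (ord x) - 1 \<le> e q - 1" using e[OF q] by simp
    show "1 \<le> q" using prime_gt_0_nat[OF q(1)] by simp
  qed simp
  ultimately show ?thesis
    unfolding totient_formula1[OF ord_pos[OF x]] by (simp flip: of_nat_prod of_nat_mult of_nat_power)
qed

lemma multiplicity_ord_le: "x \<in> carrier G \<Longrightarrow> multiplicity q (ord x) \<le> multiplicity q (order G)"
  using ord_dvd_group_order order_pos by (simp add: dvd_imp_multiplicity_le)

lemma two_power_le_card_cyclic_subgroups:
  "2 ^ prime_count (order G) \<le> card ((\<lambda>x. generate G {x}) ` carrier G)"
proof -
  let ?e = "\<lambda>q. multiplicity q (order G)"
  let ?c = "\<lambda>q. real (q ^ (?e q - 1) * (q - 1))"
  have "(2::real) ^ prime_count (order G) = (\<Prod>q\<in>prime_factors (order G). 2)"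
    by (simp add: prime_count_eq order_pos)
  also have "\<dots> \<le> (\<Prod>q\<in>prime_factors (order G). 1 - 1 / ?c q + real (q ^ ?e q) / ?c q)"
    by (intro prod_mono conjI two_le_factor) (auto simp: prime_factors_multiplicity)
  also have "\<dots> \<le> real (card ((\<lambda>x. generate G {x}) ` carrier G))"
  proof (rule card_cyclic_subgroups_ge_prod)
    show "1 \<le> ?c q" if "q \<in> prime_factors (order G)" for q
    proof -
      have "1 < q" using that prime_gt_1_nat by auto
      then have "0 < q ^ (?e q - 1) * (q - 1)" by simp
      then show ?thesis by (metis One_nat_def Suc_leI of_nat_1 of_nat_le_iff)
    qed
    fix x assume x: "x \<in> carrier G"
    show "real (totient (ord x)) \<le> (\<Prod>q\<in>{q \<in> prime_factors (order G). q dvd ord x}. ?c q)"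
      using multiplicity_ord_le[OF x] by (intro totient_ord_le[OF x]) auto
  qed
  finally show ?thesis by (metis of_nat_le_iff of_nat_numeral of_nat_power)
qed

lemma four_times_two_power_le_card_cyclic_subgroups:
  assumes p: "prime p" "p dvd order G"
    and no_elt: "\<And>x. x \<in> carrier G \<Longrightarrow> ord x \<noteq> p ^ multiplicity p (order G)"
  shows "4 * 2 ^ (prime_count (order G) - 1) \<le> card ((\<lambda>x. generate G {x}) ` carrier G)"
proof -
  let ?v = "\<lambda>q. multiplicity q (order G)"
  \<comment> \<open>Without an element of order p^v the p-part of every element order is at most
    p^(v-1); the smaller \<open>?c p\<close> enlarges the factor at p.\<close>
  let ?e = "\<lambda>q. if q = p then ?v q - 1 else ?v q"
  let ?c = "\<lambda>q. real (q ^ (?e q - 1) * (q - 1))"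
  let ?f = "\<lambda>q. 1 - 1 / ?c q + real (q ^ ?v q) / ?c q"
  have pP: "p \<in> prime_factors (order G)" using p order_pos by (simp add: prime_factors_dvd)
  obtain y where y: "y \<in> carrier G" "ord y = p"
    using cauchy[OF subgroup_self p(1)] p(2) by (auto simp: order_def)
  \<comment> \<open>If p divided the order exactly once, Cauchy's element y would have the excluded
    order.\<close>
  have "?v p \<noteq> 1" using no_elt[OF y(1)] y(2) by auto
  moreover have "0 < ?v p" using pP by (simp add: prime_factors_multiplicity)
  ultimately have v2: "2 \<le> ?v p" by simp
  \<comment> \<open>An element whose order has the full p-part would have a power of order exactly
    p^v.\<close>
  have mult_lt: "multiplicity p (ord x) < ?v p" if x: "x \<in> carrier G" for x
  proof (rule ccontr)
    assume "\<not> ?thesis"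
    then have "multiplicity p (ord x) = ?v p" using multiplicity_ord_le[OF x, of p] by simp
    then have "p ^ ?v p dvd ord x" by (metis multiplicity_dvd)
    then obtain k where k: "ord x = p ^ ?v p * k" by blast
    have "k \<noteq> 0" using k ord_pos[OF x] by (metis mult_0_right less_irrefl)
    then have "ord (x [^] k) = p ^ ?v p" using ord_pow[OF x, of k] k by simp
    then show False using no_elt x by blast
  qed
  have "4 * (2::real) ^ (prime_count (order G) - 1) = 4 * (\<Prod>q\<in>prime_factors (order G) - {p}. 2)"
    using pP by (simp add: prime_count_eq order_pos)
  also have "\<dots> \<le> ?f p * (\<Prod>q\<in>prime_factors (order G) - {p}. ?f q)"
  proof (intro mult_mono prod_mono conjI)
    show "4 \<le> ?f p" using four_le_factor[OF p(1) v2] by (simp add: numeral_2_eq_2 del: of_nat_mult of_nat_power)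
    then show "0 \<le> ?f p" by linarith
    show "2 \<le> ?f q" if "q \<in> prime_factors (order G) - {p}" for q
      using two_le_factor[of q "?v q"] that by (simp add: prime_factors_multiplicity del: of_nat_mult of_nat_power)
  qed (auto intro: prod_nonneg)
  also have "\<dots> = (\<Prod>q\<in>prime_factors (order G). ?f q)"
    using pP by (simp add: prod.remove del: of_nat_mult of_nat_power)
  also have "\<dots> \<le> real (card ((\<lambda>x. generate G {x}) ` carrier G))"
  proof (rule card_cyclic_subgroups_ge_prod)
    show "1 \<le> ?c q" if "q \<in> prime_factors (order G)" for q
    proof -
      have "1 < q" using that prime_gt_1_nat by auto
      then have "0 < q ^ (?e q - 1) * (q - 1)" by simp
      then show ?thesis by (metis One_nat_def Suc_leI of_nat_1 of_nat_le_iff)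
    qed
    fix x assume x: "x \<in> carrier G"
    show "real (totient (ord x)) \<le> (\<Prod>q\<in>{q \<in> prime_factors (order G). q dvd ord x}. ?c q)"
      using mult_lt[OF x] multiplicity_ord_le[OF x] by (intro totient_ord_le[OF x]) auto
  qed
  finally have "real (4 * 2 ^ (prime_count (order G) - 1)) \<le> real (card ((\<lambda>x. generate G {x}) ` carrier G))"
    by simp
  then show ?thesis by (simp only: of_nat_le_iff)
qed

lemma card_cyclic_subgroups_le: "card ((\<lambda>x. generate G {x}) ` carrier G) \<le> sub_count G"
  unfolding sub_count_def
proof (rule card_mono)
  have "{H. subgroup H G} \<subseteq> Pow (carrier G)" using subgroup.subset by auto
  then show "finite {H. subgroup H G}" using finite_subset by blast
  show "(\<lambda>x. generate G {x}) ` carrier G \<subseteq> {H. subgroup H G}" using subgroup_generate_singleton by auto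
qed

section \<open>Quotients and normal Hall subgroups\<close>

lemma finite_group_subgroup: "subgroup K G \<Longrightarrow> finite_group (G\<lparr>carrier := K\<rparr>)"
  by (simp add: finite_group_def finite_group_axioms_def subgroup_imp_group finite_subgroup)

lemma finite_group_FactGroup: "N \<lhd> G \<Longrightarrow> finite_group (G Mod N)"
  by (simp add: finite_group_def finite_group_axioms_def normal.factorgroup_is_group carrier_FactGroup)

lemma order_FactGroup: "N \<lhd> G \<Longrightarrow> order (G Mod N) * card N = order G"
  using lagrange[OF normal_imp_subgroup] by (simp add: FactGroup_def order_def)

lemma card_normal_pos: "N \<lhd> G \<Longrightarrow> 0 < card N"
  using finite_subgroup[OF normal_imp_subgroup] subgroup.one_closed[OF normal_imp_subgroup]
  by (auto simp: card_gt_0_iff)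

lemma FactGroup_pow_eq_one_iff:
  assumes N: "N \<lhd> G" and x: "x \<in> carrier G"
  shows "(N #> x) [^]\<^bsub>G Mod N\<^esub> (k::nat) = \<one>\<^bsub>G Mod N\<^esub> \<longleftrightarrow> x [^] k \<in> N"
  using normal.FactGroup_pow[OF N x] coset_join1[of N "x [^] k"] coset_join2[of "x [^] k" N]
    x normal_imp_subgroup[OF N] subgroup.subset by auto

lemma pow_index_mem_normal:
  assumes N: "N \<lhd> G" and x: "x \<in> carrier G"
  shows "x [^] (order G div card N) \<in> N"
proof -
  interpret Q: finite_group "G Mod N" by (rule finite_group_FactGroup[OF N])
  have "(N #> x) [^]\<^bsub>G Mod N\<^esub> order (G Mod N) = \<one>\<^bsub>G Mod N\<^esub>"
    using x by (intro Q.pow_order_eq_1) (simp add: carrier_FactGroup)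
  moreover have "order (G Mod N) = order G div card N"
    using order_FactGroup[OF N] card_normal_pos[OF N] by (metis nonzero_mult_div_cancel_right not_gr_zero)
  ultimately show ?thesis using FactGroup_pow_eq_one_iff[OF N x] by simp
qed

text \<open>For x with x^|N| = 1, choose s congruent to 1 modulo |N| and to 0 modulo the index. Then
  x = x^s is a power of an element of N.\<close>

lemma normal_hall_eq_roots:
  assumes N: "N \<lhd> G" and co: "coprime (card N) (order G div card N)"
  shows "N = {x \<in> carrier G. x [^] card N = \<one>}"
proof (intro equalityI subsetI)
  fix x assume "x \<in> N"
  then show "x \<in> {x \<in> carrier G. x [^] card N = \<one>}"
    using ord_dvd_card_subgroup normal_imp_subgroup[OF N] subgroup.mem_carrier
    by (fastforce simp: pow_eq_one_iff)
next
  let ?k = "order G div card N"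
  fix x assume x: "x \<in> {x \<in> carrier G. x [^] card N = \<one>}"
  obtain s where s: "[s = 1] (mod card N)" "[s = 0] (mod ?k)"
    using binary_chinese_remainder_nat[OF co] by blast
  then obtain l where "s = ?k * l" by (auto simp: cong_0_iff)
  then have "x [^] s = (x [^] ?k) [^] l" using x by (simp add: nat_pow_pow)
  then have "x [^] s \<in> N"
    using subgroup_pow_closed[OF normal_imp_subgroup[OF N] pow_index_mem_normal[OF N]] x by simp
  moreover have "x [^] s = x" using pow_eq_pow_of_cong[of x "card N" s 1] s x by simp
  ultimately show "x \<in> N" by simp
qed

lemma normal_in_subgroupI:
  assumes K: "subgroup K G" and P: "subgroup P G" "P \<subseteq> K"
    and conj: "\<And>g h. g \<in> K \<Longrightarrow> h \<in> P \<Longrightarrow> conj_by g h \<in> P"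
  shows "P \<lhd> G\<lparr>carrier := K\<rparr>"
proof -
  interpret K: group "G\<lparr>carrier := K\<rparr>" using K by (rule subgroup_imp_group)
  show ?thesis
  proof (rule K.normal_invI)
    show "subgroup P (G\<lparr>carrier := K\<rparr>)" using subgroup_incl[OF P(1) K P(2)] .
    show "x \<otimes>\<^bsub>G\<lparr>carrier := K\<rparr>\<^esub> h \<otimes>\<^bsub>G\<lparr>carrier := K\<rparr>\<^esub> inv\<^bsub>G\<lparr>carrier := K\<rparr>\<^esub> x \<in> P"
      if "x \<in> carrier (G\<lparr>carrier := K\<rparr>)" "h \<in> P" for x h
      using conj that m_inv_consistent[OF K] by (simp add: conj_by_def)
  qed
qed

text \<open>P is a normal Hall subgroup of K, so K alone determines it. This keeps the subgroups
  counted over different conjugates of P distinct.\<close>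

lemma normal_sylow_in_subgroup_eq_roots:
  assumes K: "subgroup K G" and P: "subgroup P G" "P \<subseteq> K" "card P = p ^ multiplicity p (order G)"
    and p: "prime p" and conj: "\<And>g h. g \<in> K \<Longrightarrow> h \<in> P \<Longrightarrow> conj_by g h \<in> P"
  shows "P = {x \<in> K. x [^] card P = \<one>}"
proof -
  interpret K: finite_group "G\<lparr>carrier := K\<rparr>" using finite_group_subgroup[OF K] .
  have N: "P \<lhd> G\<lparr>carrier := K\<rparr>" by (rule normal_in_subgroupI[OF K P(1,2) conj])
  have "\<not> p dvd card K div card P"
  proof
    assume "p dvd card K div card P"
    then have "p * card P dvd card K"
      using card_subgroup_dvd[OF P(1) K P(2)] by (metis dvd_div_mult_self mult_dvd_mono dvd_refl)
    moreover have "card K dvd order G"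
      using card_subgroup_dvd[OF K subgroup_self] subgroup.subset[OF K] by (simp add: order_def)
    ultimately have "p ^ Suc (multiplicity p (order G)) dvd order G" using P(3) dvd_trans by simp
    then show False using p order_pos
      by (metis not_prime_unit power_dvd_iff_le_multiplicity not_less_eq_eq order_refl less_irrefl)
  qed
  then have "coprime (card P) (card K div card P)" using p P(3) by (simp add: prime_imp_coprime)
  from K.normal_hall_eq_roots[OF N] this
  have "P = {x \<in> K. x [^]\<^bsub>G\<lparr>carrier := K\<rparr>\<^esub> card P = \<one>}" by (simp add: order_def)
  then show ?thesis by (simp add: nat_pow_consistent[symmetric])
qed

section \<open>Conjugate subgroups and normalizers of Sylow subgroups\<close>

lemma subgroup_conj_by_image:
  assumes "subgroup H G" "g \<in> carrier G"
  shows "subgroup (conj_by g ` H) G"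
proof (rule subgroupI)
  have c: "\<And>h. h \<in> H \<Longrightarrow> h \<in> carrier G" using assms(1) subgroup.mem_carrier by metis
  show "conj_by g ` H \<subseteq> carrier G" using c assms by auto
  show "conj_by g ` H \<noteq> {}" using subgroup.one_closed[OF assms(1)] by auto
  fix a assume "a \<in> conj_by g ` H"
  then obtain x where x: "x \<in> H" "a = conj_by g x" by auto
  have "inv a = conj_by g (inv x)"
    using x c assms by (simp add: conj_by_def inv_mult_group m_assoc)
  then show "inv a \<in> conj_by g ` H" using x subgroup.m_inv_closed[OF assms(1)] by auto
  fix b assume "b \<in> conj_by g ` H"
  then obtain y where y: "y \<in> H" "b = conj_by g y" by auto
  have "a \<otimes> b = conj_by g (x \<otimes> y)" using x y c assms by (simp add: conj_by_mult)
  then show "a \<otimes> b \<in> conj_by g ` H" using x y subgroup.m_closed[OF assms(1)] by auto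
qed

lemma conj_by_image_conj_by_image:
  "g \<in> carrier G \<Longrightarrow> h \<in> carrier G \<Longrightarrow> H \<subseteq> carrier G \<Longrightarrow>
    conj_by g ` (conj_by h ` H) = conj_by (g \<otimes> h) ` H"
  by (force simp: image_image conj_by_conj_by subset_iff)

lemma conj_by_inv_image:
  "g \<in> carrier G \<Longrightarrow> H \<subseteq> carrier G \<Longrightarrow> conj_by (inv g) ` (conj_by g ` H) = H"
  by (force simp: image_image subset_iff)

lemma conj_by_one_image: "H \<subseteq> carrier G \<Longrightarrow> conj_by \<one> ` H = H"
  by (force simp: subset_iff)

lemma conj_by_image_eq_iff:
  assumes "g \<in> carrier G" "h \<in> carrier G" "H \<subseteq> carrier G"
  shows "conj_by g ` H = conj_by h ` H \<longleftrightarrow> conj_by (inv h \<otimes> g) ` H = H"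
proof -
  have "conj_by g ` H = conj_by h ` H \<longleftrightarrow> conj_by (inv h) ` conj_by g ` H = conj_by (inv h) ` conj_by h ` H"
    using assms by (intro inj_on_image_eq_iff[OF inj_on_conj_by, symmetric]) auto
  then show ?thesis using assms by (simp add: conj_by_image_conj_by_image conj_by_one_image)
qed

lemma subgroup_set_stabilizer:
  assumes "H \<subseteq> carrier G"
  shows "subgroup {g \<in> carrier G. conj_by g ` H = H} G"
proof (rule subgroupI)
  show "{g \<in> carrier G. conj_by g ` H = H} \<noteq> {}"
    using conj_by_one_image[OF assms] by blast
  show "inv a \<in> {g \<in> carrier G. conj_by g ` H = H}" if "a \<in> {g \<in> carrier G. conj_by g ` H = H}" for a
    using that conj_by_inv_image[of a H] assms by auto
  show "a \<otimes> b \<in> {g \<in> carrier G. conj_by g ` H = H}"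
    if "a \<in> {g \<in> carrier G. conj_by g ` H = H}" "b \<in> {g \<in> carrier G. conj_by g ` H = H}" for a b
    using that conj_by_image_conj_by_image[of a b H] assms by auto
qed auto

text \<open>
  For a Sylow subgroup \<open>P\<close> with normalizer \<open>N\<close>, the subgroups of \<open>G\<close> in which some conjugate of
  \<open>P\<close> is normal number \<open>[G : N]\<close> times the number of subgroups of \<open>N / P\<close>.
\<close>

lemma two_power_le_card_subgroups_above_sylow:
  assumes p: "prime p" "p dvd order G"
  shows "2 ^ (prime_count (order G) - 1) \<le> card {K. subgroup K G \<and> p ^ multiplicity p (order G) dvd card K}"
proof -
  let ?v = "multiplicity p (order G)"
  have "p ^ ?v dvd card (carrier G)" using multiplicity_dvd by (simp add: order_def)
  then obtain P where P: "subgroup P G" "card P = p ^ ?v"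
    using exists_subgroup_prime_power[OF subgroup_self p(1)] by blast
  have PG: "P \<subseteq> carrier G" using P(1) by (rule subgroup.subset)
  define N where "N = {g \<in> carrier G. conj_by g ` P = P}"
  have N: "subgroup N G" unfolding N_def by (rule subgroup_set_stabilizer[OF PG])
  have NG: "N \<subseteq> carrier G" using N by (rule subgroup.subset)
  have PN: "P \<subseteq> N"
  proof
    fix g assume g: "g \<in> P"
    have "conj_by g ` P \<subseteq> P" using subgroup_conj_by_closed[OF P(1) g] by auto
    moreover have "card (conj_by g ` P) = card P"
      using inj_on_subset[OF inj_on_conj_by PG] g PG by (auto intro!: card_image)
    ultimately have "conj_by g ` P = P" using card_subset_eq[OF finite_subgroup[OF P(1)]] by metis
    then show "g \<in> N" using g PG by (auto simp: N_def)
  qed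
  have normal: "P \<lhd> G\<lparr>carrier := N\<rparr>"
    by (rule normal_in_subgroupI[OF N P(1) PN]) (auto simp: N_def)
  interpret N: finite_group "G\<lparr>carrier := N\<rparr>" using finite_group_subgroup[OF N] .
  define Q where "Q = G\<lparr>carrier := N\<rparr> Mod P"
  interpret Q: finite_group Q unfolding Q_def by (rule N.finite_group_FactGroup[OF normal])
  let ?C = "(\<lambda>g. conj_by g ` P) ` carrier G"
  have index: "card ?C * card N = order G"
    unfolding order_def
  proof (rule card_orbit[OF subgroup_self NG])
    fix g h assume "g \<in> carrier G" "h \<in> carrier G"
    then show "conj_by g ` P = conj_by h ` P \<longleftrightarrow> inv h \<otimes> g \<in> N"
      using conj_by_image_eq_iff[OF _ _ PG] by (simp add: N_def)
  qed
  have orderQ: "order Q * card P = card N"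
    unfolding Q_def using N.order_FactGroup[OF normal] by (simp add: order_def)
  have total: "order G = card ?C * order Q * p ^ ?v" using index orderQ P(2) by (simp add: mult.assoc)
  have C0: "0 < card ?C" using total order_pos by (metis gr0I mult_0)

  \<comment> \<open>One conjugating element is fixed for each conjugate X of P; it carries the
    subgroups between P and N to subgroups in which X is normal.\<close>
  define rep where "rep X = (SOME g. g \<in> carrier G \<and> conj_by g ` P = X)" for X
  have rep: "rep X \<in> carrier G" "conj_by (rep X) ` P = X" if "X \<in> ?C" for X
  proof -
    have "\<exists>g. g \<in> carrier G \<and> conj_by g ` P = X" using that by auto
    from someI_ex[OF this] show "rep X \<in> carrier G" "conj_by (rep X) ` P = X" by (auto simp: rep_def)
  qed
  \<comment> \<open>A subgroup A of N / P is a set of cosets, and its union is the preimage in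
    N.\<close>
  let ?F = "\<lambda>(X, A). conj_by (rep X) ` \<Union>A"
  let ?S = "{K. subgroup K G \<and> p ^ ?v dvd card K}"
  have UA: "subgroup (\<Union>A) G" "\<Union>A \<subseteq> N" "P \<subseteq> \<Union>A" if "subgroup A Q" for A
  proof -
    have s: "subgroup (\<Union>A) (G\<lparr>carrier := N\<rparr>)"
      using normal.factgroup_subgroup_union_subgroup[OF normal] that by (simp add: Q_def)
    then show "subgroup (\<Union>A) G" using incl_subgroup[OF N] by simp
    show "\<Union>A \<subseteq> N" using subgroup.subset[OF s] by simp
    show "P \<subseteq> \<Union>A" using subgroup.one_closed[OF that] by (auto simp: Q_def)
  qed
  have sub: "subgroup (conj_by (rep X) ` \<Union>A) G" "X \<subseteq> conj_by (rep X) ` \<Union>A"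
    "card X = p ^ ?v" "subgroup X G"
    "\<And>g h. g \<in> conj_by (rep X) ` \<Union>A \<Longrightarrow> h \<in> X \<Longrightarrow> conj_by g h \<in> X"
    if X: "X \<in> ?C" and A: "subgroup A Q" for X A
  proof -
    note r = rep[OF X] and U = UA[OF A]
    show "subgroup (conj_by (rep X) ` \<Union>A) G" using subgroup_conj_by_image[OF U(1) r(1)] .
    show "X \<subseteq> conj_by (rep X) ` \<Union>A" using r(2) U(3) by blast
    show "subgroup X G" using subgroup_conj_by_image[OF P(1) r(1)] r(2) by simp
    show "card X = p ^ ?v"
      using card_image[OF inj_on_subset[OF inj_on_conj_by[OF r(1)] PG]] r(2) P(2) by simp
    fix g h assume g: "g \<in> conj_by (rep X) ` \<Union>A" and h: "h \<in> X"
    obtain u where u: "u \<in> \<Union>A" "g = conj_by (rep X) u" using g by blast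
    obtain y where y: "y \<in> P" "h = conj_by (rep X) y" using h r(2) by blast
    have uN: "u \<in> N" using u U(2) by blast
    have c: "u \<in> carrier G" "y \<in> carrier G" using uN NG y PG by auto
    have "conj_by g h = conj_by (rep X) (conj_by u y)"
      using u y c r(1) by (simp add: conj_by_conj_by) (simp add: conj_by_def m_assoc)
    moreover have "conj_by u y \<in> P" using uN y by (auto simp: N_def)
    ultimately show "conj_by g h \<in> X" using r(2) by blast
  qed
  have inj: "inj_on ?F (?C \<times> {A. subgroup A Q})"
  proof (rule inj_onI)
    fix a b assume "a \<in> ?C \<times> {A. subgroup A Q}" "b \<in> ?C \<times> {A. subgroup A Q}" and eq: "?F a = ?F b"
    then obtain X A Y B where a: "a = (X, A)" "b = (Y, B)" "X \<in> ?C" "subgroup A Q" "Y \<in> ?C" "subgroup B Q"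
      by (auto simp del: image_iff)
    note sX = sub[OF a(3,4)] and sY = sub[OF a(5,6)]
    have e: "conj_by (rep X) ` \<Union>A = conj_by (rep Y) ` \<Union>B" using eq a by simp
    have "X = {x \<in> conj_by (rep X) ` \<Union>A. x [^] card X = \<one>}"
      using normal_sylow_in_subgroup_eq_roots[OF sX(1,4,2,3) p(1) sX(5)] .
    moreover have "Y = {x \<in> conj_by (rep Y) ` \<Union>B. x [^] card Y = \<one>}"
      using normal_sylow_in_subgroup_eq_roots[OF sY(1,4,2,3) p(1) sY(5)] .
    ultimately have XY: "X = Y" using e sX(3) sY(3) by simp
    have "\<Union>A \<subseteq> carrier G" "\<Union>B \<subseteq> carrier G" using UA[OF a(4)] UA[OF a(6)] NG by blast+
    then have "\<Union>A = \<Union>B"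
      using e inj_on_image_eq_iff[OF inj_on_conj_by[OF rep(1)[OF a(3)]]] XY by simp
    then have "A = B"
      using normal.factgroup_subgroup_union_factor[OF normal] a(4,6) unfolding Q_def by metis
    then show "a = b" using a XY by simp
  qed
  have "?F ` (?C \<times> {A. subgroup A Q}) \<subseteq> ?S"
  proof
    fix K assume "K \<in> ?F ` (?C \<times> {A. subgroup A Q})"
    then obtain X A where K: "K = conj_by (rep X) ` \<Union>A" "X \<in> ?C" "subgroup A Q" by auto
    note s = sub[OF K(2,3)]
    show "K \<in> ?S" using card_subgroup_dvd[OF s(4,1,2)] s K(1) by simp
  qed
  moreover have "finite ?S"
    by (rule finite_subset[of _ "Pow (carrier G)"]) (auto dest: subgroup.subset)
  ultimately have "card (?C \<times> {A. subgroup A Q}) \<le> card ?S" using card_inj_on_le[OF inj] by blast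
  then have le: "card ?C * sub_count Q \<le> card ?S" by (simp add: card_cartesian_product sub_count_def)
  \<comment> \<open>Every prime of the order other than p divides the index [G : N] or the order of
    N / P. For the index, 2 to the number of its primes is at most the index; for N / P, the cyclic
    subgroups already suffice.\<close>
  have "2 ^ (prime_count (order G) - 1) \<le> card ?C * 2 ^ prime_count (order Q)"
  proof -
    have "prime_factors (order G) \<subseteq> insert p (prime_factors (card ?C) \<union> prime_factors (order Q))"
    proof
      fix q assume "q \<in> prime_factors (order G)"
      then have q: "prime q" "q dvd card ?C * order Q * p ^ ?v" using total by (auto simp: prime_factors_dvd)
      then have "q dvd card ?C \<or> q dvd order Q \<or> q = p"
        using p(1) by (metis prime_dvd_mult_iff prime_dvd_power primes_dvd_imp_eq)
      then show "q \<in> insert p (prime_factors (card ?C) \<union> prime_factors (order Q))"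
        using q(1) C0 Q.order_pos by (auto simp: prime_factors_dvd)
    qed
    then have "card (prime_factors (order G)) \<le> card (insert p (prime_factors (card ?C) \<union> prime_factors (order Q)))"
      by (intro card_mono) auto
    also have "\<dots> \<le> Suc (card (prime_factors (card ?C)) + card (prime_factors (order Q)))"
      by (simp add: card_insert_if card_Un_le le_SucI)
    finally have "prime_count (order G) - 1 \<le> card (prime_factors (card ?C)) + prime_count (order Q)"
      by (simp add: prime_count_eq order_pos Q.order_pos)
    then have "(2::nat) ^ (prime_count (order G) - 1) \<le> 2 ^ card (prime_factors (card ?C)) * 2 ^ prime_count (order Q)"
      unfolding power_add[symmetric] by (rule power_increasing) simp
    also have "2 ^ card (prime_factors (card ?C)) \<le> card ?C"
    proof -
      have "2 ^ card (prime_factors (card ?C)) = (\<Prod>q\<in>prime_factors (card ?C). (2::nat))" by simp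
      also have "\<dots> \<le> (\<Prod>q\<in>prime_factors (card ?C). q)"
        by (intro prod_mono) (auto intro: prime_ge_2_nat)
      also have "\<dots> \<le> (\<Prod>q\<in>prime_factors (card ?C). q ^ multiplicity q (card ?C))"
      proof (intro prod_mono conjI)
        fix q assume "q \<in> prime_factors (card ?C)"
        then have "0 < multiplicity q (card ?C)" "0 < q"
          by (auto simp: prime_factors_multiplicity prime_gt_0_nat)
        then show "q \<le> q ^ multiplicity q (card ?C)" by (simp add: self_le_power)
      qed simp
      also have "\<dots> = card ?C" using prime_factorization_nat[OF C0] by simp
      finally show ?thesis .
    qed
    finally show ?thesis by simp
  qed
  also have "\<dots> \<le> card ?C * sub_count Q"
    using Q.two_power_le_card_cyclic_subgroups Q.card_cyclic_subgroups_le order_trans by (intro mult_left_mono) auto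
  finally show ?thesis using le by simp
qed

text \<open>The 5 is 4 + 1: the two families, cyclic subgroups and subgroups of order divisible by
  p^v, are disjoint, since a cyclic group of such order contains an element of order p^v.\<close>

theorem sub_count_ge_of_noncyclic_sylow:
  assumes p: "prime p" "p dvd order G"
    and no_elt: "\<And>x. x \<in> carrier G \<Longrightarrow> ord x \<noteq> p ^ multiplicity p (order G)"
  shows "5 * 2 ^ (prime_count (order G) - 1) \<le> sub_count G"
proof -
  let ?v = "multiplicity p (order G)"
  let ?A = "(\<lambda>x. generate G {x}) ` carrier G"
  let ?B = "{K. subgroup K G \<and> p ^ ?v dvd card K}"
  have fin: "finite {H. subgroup H G}"
    by (rule finite_subset[of _ "Pow (carrier G)"]) (auto dest: subgroup.subset)
  have "?A \<inter> ?B = {}"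
  proof (rule ccontr)
    assume "?A \<inter> ?B \<noteq> {}"
    then obtain x where x: "x \<in> carrier G" "p ^ ?v dvd ord x" using generate_pow_card by auto
    then obtain k where k: "ord x = p ^ ?v * k" by blast
    have "k \<noteq> 0" using k ord_pos[OF x(1)] by (metis mult_0_right less_irrefl)
    then have "ord (x [^] k) = p ^ ?v" using ord_pow[OF x(1), of k] k by simp
    then show False using no_elt x(1) by blast
  qed
  then have "card ?A + card ?B = card (?A \<union> ?B)" using fin by (intro card_Un_disjoint[symmetric]) auto
  also have "\<dots> \<le> sub_count G"
    unfolding sub_count_def using fin subgroup_generate_singleton by (intro card_mono) auto
  finally show ?thesis
    using four_times_two_power_le_card_cyclic_subgroups[OF p no_elt]
      two_power_le_card_subgroups_above_sylow[OF p] by linarith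
qed

end

section \<open>Groups with cyclic Sylow subgroups\<close>

context group
begin

lemma ord_mult_coprime:
  assumes c: "x \<in> carrier G" "y \<in> carrier G" and xy: "x \<otimes> y = y \<otimes> x" and co: "coprime (ord x) (ord y)"
  shows "ord (x \<otimes> y) = ord x * ord y"
proof (rule dvd_antisym)
  show "ord (x \<otimes> y) dvd ord x * ord y" using ord_mul_divides[OF xy c] .
  let ?n = "ord (x \<otimes> y)"
  have 1: "x [^] (?n * k) \<otimes> y [^] (?n * k) = \<one>" for k
  proof -
    have "x [^] (?n * k) \<otimes> y [^] (?n * k) = (x \<otimes> y) [^] (?n * k)"
      by (rule pow_mult_distrib[OF xy c, symmetric])
    also have "\<dots> = \<one>" using c by (simp add: pow_eq_id)
    finally show ?thesis .
  qed
  have "y [^] (?n * ord y) = \<one>" "x [^] (?n * ord x) = \<one>" using c by (simp_all add: pow_eq_id)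
  then have "x [^] (?n * ord y) = \<one>" "y [^] (?n * ord x) = \<one>" using 1[of "ord y"] 1[of "ord x"] c by simp_all
  then have "ord x dvd ?n * ord y" "ord y dvd ?n * ord x" using c by (simp_all add: pow_eq_id)
  then have "ord x dvd ?n" "ord y dvd ?n" using co by (simp_all add: coprime_dvd_mult_left_iff coprime_commute)
  then show "ord x * ord y dvd ?n" using co by (simp add: divides_mult)
qed

end

context finite_group
begin

lemma generate_eq_of_ord:
  assumes "subgroup H G" "z \<in> H" "ord z = card H"
  shows "H = generate G {z}"
proof -
  have zc: "z \<in> carrier G" using assms subgroup.mem_carrier by metis
  have "generate G {z} \<subseteq> H" using generate_subgroup_incl[OF _ assms(1)] assms(2) by blast
  then show ?thesis using card_subset_eq[OF finite_subgroup[OF assms(1)]] generate_pow_card[OF zc] assms(3) by metis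
qed

text \<open>Conjugation acts on a cyclic normal subgroup by power maps, and power maps commute. So g
  h and h g act alike, and the commutator (g h)(h g)^-1 acts trivially.\<close>

lemma derived_centralizes_cyclic_normal:
  assumes N: "N \<lhd> G" and z: "z \<in> N" "ord z = card N"
    and g: "g \<in> derived G (carrier G)" and k: "k \<in> N"
  shows "g \<otimes> k = k \<otimes> g"
proof -
  have sub: "subgroup N G" using N by (rule normal_imp_subgroup)
  have Nc: "\<And>x. x \<in> N \<Longrightarrow> x \<in> carrier G" using subgroup.mem_carrier[OF sub] .
  have gen: "\<exists>i::nat. x = z [^] i" if "x \<in> N" for x
    using that generate_eq_of_ord[OF sub z] generate_singleton[of z] Nc[OF z(1)] by auto
  have conjN: "conj_by h x \<in> N" if "h \<in> carrier G" "x \<in> N" for h x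
    using normal_invE(2)[OF N that] by (simp add: conj_by_def)
  have conj_pow: "conj_by h x = x [^] i" if h: "h \<in> carrier G" "conj_by h z = z [^] i" and x: "x \<in> N" for h x and i :: nat
  proof -
    obtain j :: nat where j: "x = z [^] j" using gen x by blast
    then have "conj_by h x = (z [^] i) [^] j" using h Nc z by (simp add: conj_by_pow)
    then show ?thesis using j Nc z by (simp add: nat_pow_pow mult.commute)
  qed
  have comm: "conj_by (g \<otimes> h) x = conj_by (h \<otimes> g) x" if gh: "g \<in> carrier G" "h \<in> carrier G" and x: "x \<in> N" for g h x
  proof -
    obtain i j :: nat where ij: "conj_by g z = z [^] i" "conj_by h z = z [^] j"
      using gen conjN gh z by meson
    have "conj_by (g \<otimes> h) x = (x [^] j) [^] i"
      using conj_pow[OF gh(1) ij(1)] conj_pow[OF gh(2) ij(2) x] gh x Nc subgroup_pow_closed[OF sub x]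
      by (simp add: conj_by_conj_by[symmetric])
    moreover have "conj_by (h \<otimes> g) x = (x [^] i) [^] j"
      using conj_pow[OF gh(2) ij(2)] conj_pow[OF gh(1) ij(1) x] gh x Nc subgroup_pow_closed[OF sub x]
      by (simp add: conj_by_conj_by[symmetric])
    ultimately show ?thesis using Nc x by (simp add: nat_pow_pow mult.commute)
  qed
  define C where "C = {g \<in> carrier G. \<forall>k\<in>N. conj_by g k = k}"
  have C: "subgroup C G"
  proof (rule subgroupI)
    show "C \<subseteq> carrier G" by (auto simp: C_def)
    have "\<one> \<in> C" using Nc by (simp add: C_def)
    then show "C \<noteq> {}" by blast
    show "inv a \<in> C" if "a \<in> C" for a
    proof -
      have "conj_by (inv a) k = k" if "k \<in> N" for k
      proof -
        have "a \<in> carrier G" "conj_by a k = k" using \<open>a \<in> C\<close> that by (simp_all add: C_def)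
        then show ?thesis using conj_by_inv_cancel(1)[of a k] Nc[OF that] by simp
      qed
      then show ?thesis using that by (simp add: C_def)
    qed
    show "a \<otimes> b \<in> C" if "a \<in> C" "b \<in> C" for a b
      using that Nc by (simp add: C_def conj_by_conj_by[symmetric])
  qed
  have "derived_set G (carrier G) \<subseteq> C"
  proof
    fix c assume "c \<in> derived_set G (carrier G)"
    then obtain g h where gh: "g \<in> carrier G" "h \<in> carrier G" "c = g \<otimes> h \<otimes> inv g \<otimes> inv h" by auto
    have c: "c = (g \<otimes> h) \<otimes> inv (h \<otimes> g)" using gh by (simp add: m_assoc inv_mult_group)
    have "conj_by c k = k" if k: "k \<in> N" for k
    proof -
      let ?w = "conj_by (inv (h \<otimes> g)) k"
      have w: "?w \<in> N" using conjN k gh by simp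
      have "conj_by c k = conj_by (g \<otimes> h) ?w" unfolding c using gh Nc k by (simp add: conj_by_conj_by)
      also have "\<dots> = conj_by (h \<otimes> g) ?w" using comm gh w by simp
      also have "\<dots> = k" using gh Nc k by simp
      finally show ?thesis .
    qed
    then show "c \<in> C" using gh by (simp add: C_def)
  qed
  then have "derived G (carrier G) \<subseteq> C" unfolding derived_def by (rule generate_subgroup_incl[OF _ C])
  then have "conj_by g k = k" "g \<in> carrier G" using g k by (auto simp: C_def)
  then have "g \<otimes> k \<otimes> inv g = k" by (simp add: conj_by_def)
  then show ?thesis using \<open>g \<in> carrier G\<close> Nc[OF k] by (metis inv_solve_right m_closed)
qed

text \<open>By Frobenius the count for p^i h is p^i h c with 1 \<le> c \<le> p, and c = p is
  excluded because x is a root only at the higher level. The difference p^i h (p - c) is a multiple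
  of p^i (p - 1), so p - 1 divides p - c, which leaves c = 1.\<close>

lemma nroots_eq_below:
  assumes p: "prime p" and d: "p ^ Suc i * h dvd order G" and h: "coprime h p" "coprime h (p - 1)"
    and eq: "nroots (carrier G) (p ^ Suc i * h) = p ^ Suc i * h"
    and x: "x \<in> carrier G" "ord x = p ^ Suc i"
  shows "nroots (carrier G) (p ^ i * h) = p ^ i * h"
proof -
  let ?N = "nroots (carrier G)"
  have d': "p ^ i * h dvd order G" using d by (metis dvd_mult_right mult.assoc power_Suc)
  have h0: "0 < h" using d order_pos by (cases h) auto
  have p0: "1 < p" using prime_gt_1_nat[OF p] .
  obtain c where c: "?N (p ^ i * h) = p ^ i * h * c"
    using frobenius_dvd_nroots[OF subgroup_self, of "p ^ i * h"] d' by (auto simp: order_def)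
  have le: "?N (p ^ i * h) \<le> p ^ Suc i * h" using nroots_diff_dvd(1)[OF subgroup_self p, of i h] eq by simp
  have "p ^ i * h \<le> ?N (p ^ i * h)" using nroots_ge[OF subgroup_self, of "p ^ i * h"] d' by (simp add: order_def)
  then have c1: "1 \<le> c" using c h0 p0 by (cases c) auto
  have "(p ^ i * h) * c \<le> (p ^ i * h) * p" using le c by (simp add: mult_ac)
  then have cp: "c \<le> p" using h0 p0 by simp
  have "c \<noteq> p"
  proof
    assume "c = p"
    then have "?N (p ^ i * h) = ?N (p ^ Suc i * h)" using c eq by (simp add: mult_ac)
    moreover have sub: "{x \<in> carrier G. x [^] (p ^ i * h) = \<one>} \<subseteq> {x \<in> carrier G. x [^] (p ^ Suc i * h) = \<one>}"
      by (auto simp: pow_eq_one_iff mult.assoc)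
    ultimately have "{x \<in> carrier G. x [^] (p ^ i * h) = \<one>} = {x \<in> carrier G. x [^] (p ^ Suc i * h) = \<one>}"
      unfolding nroots_def by (intro card_subset_eq) auto
    moreover have "x \<in> {x \<in> carrier G. x [^] (p ^ Suc i * h) = \<one>}" using x by (simp add: pow_eq_one_iff)
    ultimately have "x [^] (p ^ i * h) = \<one>" by blast
    then have "p ^ i * p dvd p ^ i * h" using x by (simp add: pow_eq_one_iff mult.commute)
    then have "p dvd h" using p0 by simp
    then show False using h(1) p by (metis coprime_absorb_right not_prime_unit is_unit_gcd coprime_iff_gcd_eq_1 gcd_nat.absorb_iff2 not_prime_1)
  qed
  have "p ^ i * (p - 1) dvd p ^ Suc i * h - p ^ i * h * c"
    using nroots_diff_dvd(2)[OF subgroup_self p, of i h] eq c by simp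
  moreover have "p ^ Suc i * h - p ^ i * h * c = p ^ i * (h * (p - c))"
    by (simp add: diff_mult_distrib2 mult_ac)
  ultimately have "p - 1 dvd h * (p - c)" using p0 by simp
  then have "p - 1 dvd p - c" using h(2) by (simp add: coprime_dvd_mult_right_iff coprime_commute)
  then have "p - 1 \<le> p - c" using cp \<open>c \<noteq> p\<close> by (intro dvd_imp_le) auto
  then have "c = 1" using c1 cp \<open>c \<noteq> p\<close> by linarith
  then show ?thesis using c by simp
qed

end

text \<open>An element of this order generates a Sylow p-subgroup. At primes not dividing the order
  the exponent is 0 and the identity is the witness.\<close>

locale zgroup = finite_group +
  assumes exists_sylow_generator: "prime p \<Longrightarrow> \<exists>x\<in>carrier G. ord x = p ^ multiplicity p (order G)"
begin

text \<open>The part of the group order built from the primes above t. Indexing by all naturals lets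
  inductions move between t and t + 1, whether or not t + 1 is a prime divisor of the order.\<close>

definition upper :: "nat \<Rightarrow> nat" where
  "upper t = (\<Prod>q\<in>{q \<in> prime_factors (order G). t < q}. q ^ multiplicity q (order G))"

lemma upper_0: "upper 0 = order G"
proof -
  have "{q \<in> prime_factors (order G). 0 < q} = prime_factors (order G)" using prime_gt_0_nat by blast
  then show ?thesis unfolding upper_def using prime_factorization_nat[OF order_pos] by simp
qed

lemma upper_eq_1: "order G \<le> t \<Longrightarrow> upper t = 1"
proof -
  assume "order G \<le> t"
  then have "{q \<in> prime_factors (order G). t < q} = {}"
    using order_pos by (auto simp: prime_factors_dvd dest: dvd_imp_le)
  then show ?thesis unfolding upper_def by (simp only: prod.empty)
qed

lemma upper_step:
  "upper t = (if Suc t \<in> prime_factors (order G) then Suc t ^ multiplicity (Suc t) (order G) else 1) * upper (Suc t)"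
proof (cases "Suc t \<in> prime_factors (order G)")
  case True
  then have "{q \<in> prime_factors (order G). t < q} = insert (Suc t) {q \<in> prime_factors (order G). Suc t < q}"
    by auto
  then show ?thesis using True by (simp add: upper_def)
next
  case False
  then have "{q \<in> prime_factors (order G). t < q} = {q \<in> prime_factors (order G). Suc t < q}"
    using Suc_lessI Suc_lessD by blast
  then show ?thesis using False by (simp add: upper_def)
qed

lemma upper_dvd_order: "upper t dvd order G"
proof -
  have "upper t dvd (\<Prod>q\<in>prime_factors (order G). q ^ multiplicity q (order G))"
    unfolding upper_def by (rule prod_dvd_prod_subset) auto
  then show ?thesis using prime_factorization_nat[OF order_pos] by simp
qed

lemma prime_dvd_upper: "prime q \<Longrightarrow> q dvd upper t \<Longrightarrow> t < q"
proof -
  assume q: "prime q" "q dvd upper t"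
  then obtain q' where q': "q' \<in> prime_factors (order G)" "t < q'" "q dvd q' ^ multiplicity q' (order G)"
    unfolding upper_def by (subst (asm) prime_dvd_prod_iff) auto
  then have "q = q'" using q(1) prime_dvd_power primes_dvd_imp_eq[of q q'] by auto
  then show ?thesis using q' by simp
qed

text \<open>All primes of \<open>upper t\<close> exceed t. For t = p this makes h =
  \<open>upper p\<close> prime to p and to p - 1, as \<open>nroots_eq_below\<close>
  requires.\<close>

lemma coprime_upper: "0 < k \<Longrightarrow> k \<le> t \<Longrightarrow> coprime (upper t) k"
proof (rule ccontr)
  assume k: "0 < k" "k \<le> t" and "\<not> coprime (upper t) k"
  then obtain q where "prime q" "q dvd upper t" "q dvd k"
    using prime_factor_nat[of "gcd (upper t) k"] by (auto simp: coprime_iff_gcd_eq_1)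
  then have "t < q" "q \<le> k" using prime_dvd_upper dvd_imp_le k by blast+
  then show False using k by simp
qed

text \<open>At t = 0 every element is a root. Primes are then removed in increasing order, and the
  inner induction on j removes one factor p at a time by \<open>nroots_eq_below\<close>, with a
  power of the Sylow generator as the element of order p^(i+1).\<close>

lemma nroots_upper: "nroots (carrier G) (upper t) = upper t"
proof (induction t)
  case 0
  show ?case using nroots_card[OF subgroup_self] by (simp add: upper_0 order_def)
next
  case (Suc t)
  show ?case
  proof (cases "Suc t \<in> prime_factors (order G)")
    case False
    then show ?thesis using Suc upper_step[of t] by simp
  next
    case True
    let ?p = "Suc t" and ?h = "upper (Suc t)"
    let ?v = "multiplicity ?p (order G)"
    have p: "prime ?p" using True by auto
    have u: "upper t = ?p ^ ?v * ?h" using upper_step[of t] True by simp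
    obtain x where x: "x \<in> carrier G" "ord x = ?p ^ ?v" using exists_sylow_generator[OF p] by blast
    have t0: "0 < t" using prime_gt_1_nat[OF p] by simp
    have "nroots (carrier G) (?p ^ (?v - j) * ?h) = ?p ^ (?v - j) * ?h" for j
    proof (induction j)
      case 0
      show ?case using Suc.IH u by simp
    next
      case (Suc j)
      show ?case
      proof (cases "j < ?v")
        case False
        then show ?thesis using Suc.IH by simp
      next
        case True
        define i where "i = ?v - Suc j"
        have i: "?v - j = Suc i" "?v = Suc i + j" using True by (auto simp: i_def)
        have o: "ord (x [^] (?p ^ j)) = ?p ^ Suc i"
          using ord_pow[OF x(1), of "?p ^ j"] x(2) i(2) by (simp add: power_add)
        have d: "?p ^ Suc i * ?h dvd order G"
        proof (rule dvd_trans[OF _ upper_dvd_order[of t]])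
          have "upper t = ?p ^ Suc i * ?h * ?p ^ j" unfolding u i(2) power_add by (simp only: mult_ac)
          then show "?p ^ Suc i * ?h dvd upper t" by simp
        qed
        have co: "coprime ?h ?p" "coprime ?h (?p - 1)"
          using coprime_upper[of ?p ?p] coprime_upper[of t ?p] t0 by simp_all
        have "nroots (carrier G) (?p ^ Suc i * ?h) = ?p ^ Suc i * ?h" using Suc.IH unfolding i(1) .
        then show ?thesis unfolding i_def[symmetric]
          using nroots_eq_below[OF p d co _ _ o] x(1) by blast
      qed
    qed
    from this[of ?v] show ?thesis by simp
  qed
qed

definition upper_part :: "nat \<Rightarrow> 'a set" where
  "upper_part t = {x \<in> carrier G. x [^] upper t = \<one>}"

lemma card_upper_part: "card (upper_part t) = upper t"
  using nroots_upper by (simp add: upper_part_def nroots_def)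

text \<open>A root set is closed under conjugation, so only closure under products is at issue.
  Descending from the trivial case t = \<open>order G\<close>, the product T of the normal subgroup
  for t + 1 with a cyclic Sylow subgroup for p = t + 1 has order \<open>upper t\<close>. T therefore
  lies in the root set, which by \<open>nroots_upper\<close> has no further elements.\<close>

lemma upper_part_normal: "upper_part t \<lhd> G"
proof -
  have sub: "subgroup (upper_part t) G \<and> (\<forall>g\<in>carrier G. \<forall>x\<in>upper_part t. conj_by g x \<in> upper_part t)" for t
  proof -
    have conj: "conj_by g x \<in> upper_part t" if "g \<in> carrier G" "x \<in> upper_part t" for g x t
      using that by (simp add: upper_part_def conj_by_pow[symmetric])
    have "subgroup (upper_part (order G - j)) G" for j
    proof (induction j)
      case 0
      have "upper_part (order G) = {\<one>}" by (auto simp: upper_part_def upper_eq_1)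
      then show ?case using triv_subgroup by simp
    next
      case (Suc j)
      show ?case
      proof (cases "j < order G")
        case False
        then show ?thesis using Suc by simp
      next
        case True
        define t where "t = order G - Suc j"
        have t: "order G - j = Suc t" using True by (simp add: t_def)
        have IH: "subgroup (upper_part (Suc t)) G" using Suc t by simp
        show ?thesis unfolding t_def[symmetric]
        proof (cases "Suc t \<in> prime_factors (order G)")
          case False
          then have "upper_part t = upper_part (Suc t)" using upper_step[of t] by (simp add: upper_part_def)
          then show "subgroup (upper_part t) G" using IH by simp
        next
          case True
          let ?p = "Suc t" and ?S = "upper_part (Suc t)"
          let ?v = "multiplicity ?p (order G)"
          have p: "prime ?p" using True by auto
          have u: "upper t = upper ?p * ?p ^ ?v" using upper_step[of t] True by simp
          obtain x where x: "x \<in> carrier G" "ord x = ?p ^ ?v" using exists_sylow_generator[OF p] by blast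
          let ?X = "generate G {x}"
          have X: "subgroup ?X G" "card ?X = ?p ^ ?v"
            using subgroup_generate_singleton[OF x(1)] generate_pow_card[OF x(1)] x(2) by simp_all
          have N: "?S \<lhd> G" by (rule normal_invI[OF IH]) (use conj in \<open>simp add: conj_by_def\<close>)
          define T where "T = ?S <#> ?X"
          have T: "subgroup T G" unfolding T_def by (rule mult_norm_subgroup[OF N X(1)])
          have sc: "?S \<subseteq> carrier G" "?X \<subseteq> carrier G" using subgroup.subset IH X(1) by auto
          have "?S \<subseteq> T"
          proof
            fix s assume s: "s \<in> ?S"
            then have "s = s \<otimes> \<one>" using sc by auto
            then show "s \<in> T" using s subgroup.one_closed[OF X(1)] unfolding T_def set_mult_def by blast
          qed
          moreover have "?X \<subseteq> T"
          proof
            fix s assume s: "s \<in> ?X"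
            then have "s = \<one> \<otimes> s" using sc by auto
            then show "s \<in> T" using s subgroup.one_closed[OF IH] unfolding T_def set_mult_def by blast
          qed
          ultimately have "upper ?p dvd card T" "?p ^ ?v dvd card T"
            using card_subgroup_dvd[OF IH T] card_subgroup_dvd[OF X(1) T] card_upper_part X(2) by simp_all
          moreover have "coprime (upper ?p) (?p ^ ?v)" using coprime_upper[of ?p ?p] by simp
          ultimately have dvd: "upper t dvd card T" unfolding u by (simp only: divides_mult)
          have "T = (\<lambda>(s, y). s \<otimes> y) ` (?S \<times> ?X)" unfolding T_def set_mult_def by auto
          then have "card T \<le> card (?S \<times> ?X)"
            using card_image_le[of "?S \<times> ?X"] finite_subgroup IH X(1) by simp
          then have "card T \<le> upper t" using X(2) card_upper_part u by (simp add: card_cartesian_product)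
          moreover have "0 < card T" using finite_subgroup[OF T] subgroup.one_closed[OF T] by (auto simp: card_gt_0_iff)
          ultimately have cT: "card T = upper t" using dvd by (simp add: dvd_imp_le le_antisym)
          have "T \<subseteq> upper_part t"
            using ord_dvd_card_subgroup[OF T] subgroup.mem_carrier[OF T] cT
            by (auto simp: upper_part_def pow_eq_one_iff)
          then have "T = upper_part t"
            using cT card_upper_part by (intro card_subset_eq) (auto simp: upper_part_def)
          then show "subgroup (upper_part t) G" using T by simp
        qed
      qed
    qed
    from this[of "order G - t"] have "subgroup (upper_part t) G" if "t \<le> order G" for t
      using that \<open>\<And>j. subgroup (upper_part (order G - j)) G\<close>[of "order G - t"] by simp
    moreover have "upper_part t = upper_part (order G)" if "order G \<le> t" for t
      using that by (simp add: upper_part_def upper_eq_1)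
    ultimately have "subgroup (upper_part t) G" by (metis linear order_refl)
    then show ?thesis using conj by blast
  qed
  then show ?thesis by (intro normal_invI) (auto simp: conj_by_def)
qed

text \<open>
  Comparing the orders of the image of a Sylow generator in \<open>G / N\<close> and of its power in \<open>N\<close>
  with the orders of these groups shows that both are as large as possible.
\<close>

lemma sylow_generator_mod_normal:
  assumes N: "N \<lhd> G" and p: "prime p"
  obtains x where "x \<in> carrier G" "ord x = p ^ multiplicity p (order G)"
    "\<And>k. x [^] k \<in> N \<longleftrightarrow> p ^ multiplicity p (order (G Mod N)) dvd k"
    "ord (x [^] (p ^ multiplicity p (order (G Mod N)))) = p ^ multiplicity p (card N)"
proof -
  interpret Q: finite_group "G Mod N" by (rule finite_group_FactGroup[OF N])
  let ?v = "multiplicity p (order G)" and ?f = "multiplicity p (order (G Mod N))"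
  let ?e = "multiplicity p (card N)"
  have p1: "1 < p" using prime_gt_1_nat[OF p] .
  have v: "?v = ?f + ?e"
    using order_FactGroup[OF N] prime_elem_multiplicity_mult_distrib[of p "order (G Mod N)" "card N"] p
      Q.order_pos card_normal_pos[OF N] by simp
  obtain x where x: "x \<in> carrier G" "ord x = p ^ ?v" using exists_sylow_generator[OF p] by blast
  let ?y = "N #> x"
  have y: "?y \<in> carrier (G Mod N)" using x by (simp add: carrier_FactGroup)
  have iff: "x [^] k \<in> N \<longleftrightarrow> Q.ord ?y dvd k" for k
    using FactGroup_pow_eq_one_iff[OF N x(1)] Q.pow_eq_id[OF y] by simp
  have "x [^] (p ^ ?v) \<in> N" using x subgroup.one_closed[OF normal_imp_subgroup[OF N]] by (simp flip: x(2))
  then obtain g where g: "g \<le> ?v" "Q.ord ?y = p ^ g"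
    using iff divides_primepow_nat[OF p] by blast
  have "p ^ g dvd order (G Mod N)" using Q.ord_dvd_group_order[OF y] g by simp
  then have "g \<le> ?f" using p1 Q.order_pos by (intro multiplicity_geI) auto
  have o: "ord (x [^] (p ^ g)) = p ^ (?v - g)"
    using ord_pow[OF x(1), of "p ^ g"] x(2) g(1) p1 by (simp add: power_diff le_imp_power_dvd)
  have "x [^] (p ^ g) \<in> N" using iff g by simp
  then have "p ^ (?v - g) dvd card N" using ord_dvd_card_subgroup[OF normal_imp_subgroup[OF N]] o by metis
  then have "?v - g \<le> ?e" using p1 card_normal_pos[OF N] by (intro multiplicity_geI) auto
  then have "g = ?f" using \<open>g \<le> ?f\<close> v by simp
  moreover have "?v - ?f = ?e" using v by simp
  ultimately show thesis using that[OF x] iff g(2) o by simp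
qed

lemma zgroup_FactGroup:
  assumes N: "N \<lhd> G"
  shows "zgroup (G Mod N)"
proof -
  interpret Q: finite_group "G Mod N" by (rule finite_group_FactGroup[OF N])
  have "\<exists>y\<in>carrier (G Mod N). Q.ord y = p ^ multiplicity p (order (G Mod N))" if p: "prime p" for p
  proof -
    obtain x where x: "x \<in> carrier G" "\<And>k. x [^] k \<in> N \<longleftrightarrow> p ^ multiplicity p (order (G Mod N)) dvd k"
      by (rule sylow_generator_mod_normal[OF N p]) blast
    have y: "N #> x \<in> carrier (G Mod N)" using x by (simp add: carrier_FactGroup)
    have "Q.ord (N #> x) = p ^ multiplicity p (order (G Mod N))"
      using Q.ord_unique[OF y] FactGroup_pow_eq_one_iff[OF N x(1)] x(2) by blast
    then show ?thesis using y by blast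
  qed
  then show ?thesis by (simp add: zgroup_def zgroup_axioms_def Q.finite_group_axioms)
qed

text \<open>Sylow generators commute here and have coprime orders, so the order of their product is
  the product of their orders.\<close>

lemma exists_generator_if_comm:
  assumes "comm_group G"
  shows "\<exists>x\<in>carrier G. ord x = order G"
proof -
  interpret comm_group G by fact
  have "\<exists>x\<in>carrier G. ord x = (\<Prod>q\<in>A. q ^ multiplicity q (order G))" if "finite A" "A \<subseteq> {q. prime q}" for A
    using that
  proof (induction A rule: finite_induct)
    case empty
    show ?case by (intro bexI[of _ \<one>]) simp_all
  next
    case (insert q A)
    then obtain x where x: "x \<in> carrier G" "ord x = (\<Prod>q\<in>A. q ^ multiplicity q (order G))" by auto
    obtain y where y: "y \<in> carrier G" "ord y = q ^ multiplicity q (order G)"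
      using exists_sylow_generator[of q] insert.prems by auto
    have "coprime (ord y) (ord x)" unfolding x y
      using insert.prems insert.hyps by (intro prod_coprime_right) (auto intro!: primes_coprime simp: coprime_power_left_iff coprime_power_right_iff)
    then have "ord (y \<otimes> x) = ord y * ord x" using x(1) y(1) by (intro ord_mult_coprime) (simp_all add: m_comm)
    then show ?case using x y insert.hyps by (intro bexI[of _ "y \<otimes> x"]) simp_all
  qed
  from this[of "prime_factors (order G)"] show ?thesis
    using prime_factorization_nat[OF order_pos] by auto
qed

text \<open>Descending induction on t. With p = t + 1, the generator z for p spans a cyclic normal
  subgroup, which the derived subgroup centralizes. Multiplying z by an element of
  \<open>?D t\<close> carrying the full p-part of its order gives a generator of
  \<open>?D t\<close>.\<close>

lemma derived_upper_part_cyclic: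
  "\<exists>z\<in>derived G (carrier G) \<inter> upper_part t. ord z = card (derived G (carrier G) \<inter> upper_part t)"
proof -
  let ?D = "\<lambda>t. derived G (carrier G) \<inter> upper_part t"
  have N: "?D t \<lhd> G" for t
    by (rule normal_subgroup_intersect[OF derived_self_is_normal upper_part_normal])
  have S: "subgroup (?D t) G" for t using normal_imp_subgroup[OF N] .
  have one: "?D t = {\<one>}" if "order G \<le> t" for t
  proof -
    have "upper_part t \<subseteq> {\<one>}" using that by (auto simp: upper_part_def upper_eq_1)
    then show ?thesis using subgroup.one_closed[OF S[of t]] by blast
  qed
  have main: "\<exists>z\<in>?D (order G - j). ord z = card (?D (order G - j))" for j
  proof (induction j)
    case 0
    show ?case using one[of "order G"] by simp
  next
    case (Suc j)
    show ?case
    proof (cases "j < order G")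
      case False
      then show ?thesis using Suc by simp
    next
      case True
      define t where "t = order G - Suc j"
      have t: "order G - j = Suc t" using True by (simp add: t_def)
      let ?p = "Suc t"
      obtain z where z: "z \<in> ?D ?p" "ord z = card (?D ?p)" using Suc t by auto
      show ?thesis unfolding t_def[symmetric]
      proof (cases "?p \<in> prime_factors (order G)")
        case False
        then have "upper_part t = upper_part ?p" using upper_step[of t] by (simp add: upper_part_def)
        then show "\<exists>z\<in>?D t. ord z = card (?D t)" using z by auto
      next
        case True
        define e where "e = multiplicity ?p (card (?D t))"
        have p: "prime ?p" using True by auto
        have u: "upper t = ?p ^ multiplicity ?p (order G) * upper ?p" using upper_step[of t] True by simp
        have sub: "?D ?p \<subseteq> ?D t" using u by (auto simp: upper_part_def pow_eq_one_iff)
        have D0: "0 < card (?D t)" using card_normal_pos[OF N] .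
        obtain d where d: "card (?D t) = ?p ^ e * d" "\<not> ?p dvd d"
          using multiplicity_decompose'[of "card (?D t)" ?p] D0 p
          unfolding e_def by (metis mult.commute less_irrefl not_prime_unit)
        have cpd: "coprime (?p ^ e) d" using p d(2) by (simp add: prime_imp_coprime)
        \<comment> \<open>Here d is the part of \<open>card (?D t)\<close> prime to p. Describing
          the smaller group as the d-th roots of the identity lets Frobenius' theorem show that d
          divides \<open>ord z\<close>.\<close>
        have "?D ?p = {x \<in> ?D t. x [^] d = \<one>}"
        proof (intro equalityI subsetI)
          fix x assume x: "x \<in> ?D ?p"
          then have xc: "x \<in> carrier G" and xu: "ord x dvd upper ?p" by (auto simp: upper_part_def pow_eq_one_iff)
          have "ord x dvd ?p ^ e * d" using ord_dvd_card_subgroup[OF S, of x t] x sub d(1) by auto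
          moreover have "coprime (ord x) (?p ^ e)"
            using coprime_divisors[OF xu dvd_refl coprime_upper[of ?p ?p]] by simp
          ultimately have "ord x dvd d" by (simp add: coprime_dvd_mult_right_iff)
          then show "x \<in> {x \<in> ?D t. x [^] d = \<one>}" using x sub xc by (auto simp: pow_eq_one_iff)
        next
          fix x assume x: "x \<in> {x \<in> ?D t. x [^] d = \<one>}"
          then have xc: "x \<in> carrier G" by (auto simp: upper_part_def)
          have "ord x dvd d" "ord x dvd ?p ^ multiplicity ?p (order G) * upper ?p"
            using x xc u by (auto simp: upper_part_def pow_eq_one_iff)
          moreover have "coprime d (?p ^ multiplicity ?p (order G))"
            using prime_imp_coprime[OF p d(2)] by (simp add: coprime_commute)
          ultimately have "ord x dvd upper ?p"
            using coprime_dvd_mult_right_iff coprime_divisors[OF _ dvd_refl] by blast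
          then show "x \<in> ?D ?p" using x xc by (auto simp: upper_part_def pow_eq_one_iff)
        qed
        then have "nroots (?D t) d = card (?D ?p)" by (simp add: nroots_def)
        then have dz: "d dvd ord z" using frobenius_dvd_nroots[OF S, of d t] d(1) z(2) by simp
        \<comment> \<open>The power of a Sylow generator that falls into \<open>?D t\<close> has
          order p^e, the full p-part of \<open>card (?D t)\<close>.\<close>
        obtain x where x: "x \<in> carrier G"
          "\<And>k. x [^] k \<in> ?D t \<longleftrightarrow> ?p ^ multiplicity ?p (order (G Mod ?D t)) dvd k"
          "ord (x [^] (?p ^ multiplicity ?p (order (G Mod ?D t)))) = ?p ^ e"
          unfolding e_def by (rule sylow_generator_mod_normal[OF N[of t] p]) blast
        define y where "y = x [^] (?p ^ multiplicity ?p (order (G Mod ?D t)))"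
        have y: "y \<in> ?D t" "ord y = ?p ^ e" using x by (simp_all add: y_def)
        have c: "y \<in> carrier G" "z \<in> carrier G" using y z by (auto simp: upper_part_def)
        have "y \<otimes> z = z \<otimes> y"
          using derived_centralizes_cyclic_normal[OF N z(1) z(2) _ z(1)] y(1) by blast
        moreover have "coprime (ord y) (ord z)"
        proof -
          have "ord z dvd upper ?p" using z c by (auto simp: upper_part_def pow_eq_one_iff)
          then have "coprime (ord z) (?p ^ e)"
            using coprime_divisors[OF _ dvd_refl coprime_upper[of ?p ?p]] by simp
          then show ?thesis using y(2) by (simp add: coprime_commute)
        qed
        ultimately have o: "ord (y \<otimes> z) = ord y * ord z" using c by (intro ord_mult_coprime)
        have yz: "y \<otimes> z \<in> ?D t" using subgroup.m_closed[OF S y(1)] z(1) sub by blast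
        have "card (?D t) dvd ord (y \<otimes> z)" unfolding o y(2) d(1) using dz by simp
        moreover have "ord (y \<otimes> z) dvd card (?D t)" using ord_dvd_card_subgroup[OF S yz] .
        ultimately have "ord (y \<otimes> z) = card (?D t)" by (rule dvd_antisym[rotated])
        then show "\<exists>z\<in>?D t. ord z = card (?D t)" using yz by blast
      qed
    qed
  qed
  show ?thesis
  proof (cases "t \<le> order G")
    case True
    then show ?thesis using main[of "order G - t"] by simp
  next
    case False
    then show ?thesis using one[of t] by simp
  qed
qed

lemma derived_cyclic: "\<exists>a\<in>derived G (carrier G). ord a = card (derived G (carrier G))"
proof -
  have "upper_part 0 = carrier G" by (auto simp: upper_part_def upper_0 pow_order_eq_1)
  then have "derived G (carrier G) \<inter> upper_part 0 = derived G (carrier G)"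
    using derived_in_carrier by auto
  then show ?thesis using derived_upper_part_cyclic[of 0] by simp
qed

end

section \<open>Metacyclic groups\<close>

text \<open>The relation b^-1 a b = a^r without inverses, so that products reduce to the form b^j
  a^i by arithmetic of natural exponents.\<close>

locale metacyclic_relation = group G for G (structure) +
  fixes a b :: 'a and r :: nat
  assumes a_closed [simp]: "a \<in> carrier G" and b_closed [simp]: "b \<in> carrier G"
    and a_mult_b: "a \<otimes> b = b \<otimes> a [^] r"
begin

definition elt :: "nat \<Rightarrow> nat \<Rightarrow> 'a" where
  "elt j i = b [^] j \<otimes> a [^] i"

lemma elt_closed [simp]: "elt j i \<in> carrier G"
  by (simp add: elt_def)

lemma a_pow_mult_b: "a [^] i \<otimes> b = b \<otimes> a [^] (i * r)"
proof (induction i)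
  case (Suc i)
  have "a [^] Suc i \<otimes> b = a [^] i \<otimes> b \<otimes> a [^] r" by (simp add: m_assoc a_mult_b)
  also have "\<dots> = b \<otimes> (a [^] (i * r) \<otimes> a [^] r)" unfolding Suc by (simp add: m_assoc)
  finally show ?case by (simp add: nat_pow_mult add.commute)
qed simp

lemma a_pow_mult_b_pow: "a [^] i \<otimes> b [^] k = b [^] k \<otimes> a [^] (i * r ^ k)"
proof (induction k)
  case (Suc k)
  have "a [^] i \<otimes> b [^] Suc k = b [^] k \<otimes> (a [^] (i * r ^ k) \<otimes> b)"
    using Suc by (simp add: m_assoc[symmetric])
  also have "\<dots> = b [^] Suc k \<otimes> a [^] (i * r ^ k * r)" unfolding a_pow_mult_b by (simp add: m_assoc)
  finally show ?case by (simp add: mult_ac)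
qed simp

lemma elt_mult: "elt j i \<otimes> elt k l = elt (j + k) (i * r ^ k + l)"
proof -
  have "elt j i \<otimes> elt k l = b [^] j \<otimes> (a [^] i \<otimes> b [^] k) \<otimes> a [^] l" by (simp add: elt_def m_assoc)
  also have "\<dots> = (b [^] j \<otimes> b [^] k) \<otimes> (a [^] (i * r ^ k) \<otimes> a [^] l)"
    unfolding a_pow_mult_b_pow by (simp add: m_assoc)
  finally show ?thesis by (simp add: elt_def nat_pow_mult)
qed

lemma elt_pow: "elt j i [^] k = elt (j * k) (i * (\<Sum>l<k. r ^ (j * l)))"
proof (induction k)
  case 0
  show ?case by (simp add: elt_def)
next
  case (Suc k)
  have "(\<Sum>l<Suc k. r ^ (j * l)) = (\<Sum>l<k. r ^ (j * l)) * r ^ j + 1"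
    unfolding sum.lessThan_Suc_shift by (simp add: sum_distrib_left power_add mult.commute)
  then have "i * (\<Sum>l<Suc k. r ^ (j * l)) = i * (\<Sum>l<k. r ^ (j * l)) * r ^ j + i"
    by (simp add: distrib_left mult.assoc)
  then show ?case using Suc by (simp add: elt_mult add.commute)
qed

end

text \<open>An intrinsic description of ZM(m, n, r): every element is b^j a^i with j unique modulo n
  and i unique modulo m.\<close>

locale zm_group = metacyclic_relation +
  fixes m n :: nat
  assumes m_pos: "0 < m" and n_pos: "0 < n"
    and elt_surj: "x \<in> carrier G \<Longrightarrow> \<exists>j i. x = elt j i"
    and elt_eq_iff: "elt j i = elt k l \<longleftrightarrow> [j = k] (mod n) \<and> [i = l] (mod m)"

lemma cong_sum_powers_one:
  fixes s p :: nat
  assumes "[s = 1] (mod p)"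
  shows "[(\<Sum>l<k. s ^ l) = k] (mod p)"
proof -
  have "[(\<Sum>l<k. s ^ l) = (\<Sum>l<k. 1)] (mod p)"
    using cong_pow[OF assms] by (intro cong_sum) simp
  then show ?thesis by simp
qed

text \<open>Fermat's little theorem, iterated. It turns r^(j p^f) = 1 modulo p into r^j = 1 modulo
  p.\<close>

lemma cong_power_prime_power:
  fixes s p :: nat
  assumes "prime p"
  shows "[s ^ p ^ k = s] (mod p)"
proof (induction k)
  case (Suc k)
  have fermat: "[t ^ p = t] (mod p)" for t :: nat
  proof (cases "p dvd t")
    case True
    then have "p dvd t ^ p" using assms prime_gt_0_nat by (simp add: dvd_power_same dvd_trans)
    then show ?thesis using True by (simp add: cong_def dvd_imp_mod_0)
  next
    case False
    then have "[t ^ (p - 1) * t = 1 * t] (mod p)"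
      using fermat_theorem[OF assms] by (intro cong_mult) simp_all
    moreover have "t ^ (p - 1) * t = t ^ p" using prime_gt_0_nat[OF assms] by (metis power_minus_mult)
    ultimately show ?thesis by simp
  qed
  have "s ^ p ^ Suc k = (s ^ p ^ k) ^ p" by (simp add: power_mult[symmetric] mult.commute)
  then show ?case using fermat[of "s ^ p ^ k"] Suc cong_trans by metis
qed simp

context zgroup
begin

text \<open>\<open>a\<close> generates the derived subgroup D and \<open>b\<close> lifts a generator
  of the cyclic quotient. That D is the whole derived subgroup gives gcd(m, r - 1) = 1; this forces
  b^n = 1, and the Sylow generators then give gcd(m, n) = 1.\<close>

theorem exists_zm_group:
  "\<exists>a b r m n. zm_group G a b r m n \<and> 0 < r \<and> gcd m n = 1 \<and> gcd m (r - 1) = 1"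
proof -
  define D where "D = derived G (carrier G)"
  have D: "D \<lhd> G" unfolding D_def by (rule derived_self_is_normal)
  have Ds: "subgroup D G" using normal_imp_subgroup[OF D] .
  obtain a where a: "a \<in> D" "ord a = card D" using derived_cyclic by (auto simp: D_def)
  define m where "m = card D"
  have m0: "0 < m" using card_normal_pos[OF D] by (simp add: m_def)
  have ac: "a \<in> carrier G" using a subgroup.mem_carrier[OF Ds] by blast
  have Dgen: "\<exists>i::nat. x = a [^] i" if "x \<in> D" for x
    using that generate_eq_of_ord[OF Ds a] generate_singleton[OF ac] by auto
  have aD: "a [^] (i::nat) \<in> D" for i using subgroup_pow_closed[OF Ds a(1)] .
  have a_eq: "a [^] i = a [^] l \<longleftrightarrow> [i = l] (mod m)" for i l :: nat
    using pow_eq_pow_iff[OF ac] a(2) by (simp add: m_def)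

  interpret Q: zgroup "G Mod D" by (rule zgroup_FactGroup[OF D])
  have "comm_group (G Mod D)" unfolding D_def by (rule derived_quot_is_comm_group)
  then obtain y where y: "y \<in> carrier (G Mod D)" "Q.ord y = order (G Mod D)"
    using Q.exists_generator_if_comm by blast
  then obtain b where b: "b \<in> carrier G" "y = D #> b" by (auto simp: carrier_FactGroup)
  define n where "n = order (G Mod D)"
  have n0: "0 < n" using Q.order_pos by (simp add: n_def)
  have bD: "b [^] k \<in> D \<longleftrightarrow> n dvd k" for k :: nat
    using FactGroup_pow_eq_one_iff[OF D b(1), of k] Q.pow_eq_id[OF y(1)] y(2) b(2) by (simp add: n_def)

  have "inv b \<otimes> a \<otimes> b \<in> D" using normal.inv_op_closed1[OF D b(1) a(1)] .
  then obtain r0 :: nat where r0: "inv b \<otimes> a \<otimes> b = a [^] r0" using Dgen by blast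
  \<comment> \<open>Adding m leaves a^r unchanged and makes r positive, so that \<open>r - 1\<close>
    is not truncated.\<close>
  define r where "r = r0 + m"
  have r: "0 < r" using m0 by (simp add: r_def)
  have "a [^] r = a [^] r0" by (simp add: a_eq r_def cong_def)
  then have "b \<otimes> (inv b \<otimes> a \<otimes> b) = b \<otimes> a [^] r" using r0 by simp
  then have ab: "a \<otimes> b = b \<otimes> a [^] r" using ac b by (simp add: m_assoc[symmetric])
  interpret metacyclic_relation G a b r by unfold_locales (use ac b ab in auto)

  have coset: "D #> elt j i = y [^]\<^bsub>G Mod D\<^esub> j" for i j
  proof -
    have "D #> elt j i = (D #> b [^] j) <#> (D #> a [^] i)"
      unfolding elt_def using normal.rcos_sum[OF D] b ac by simp
    also have "D #> a [^] i = D" using aD ac by (simp add: coset_join2 Ds)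
    finally show ?thesis
      using normal.FactGroup_pow[OF D b(1), of j] Q.r_one[of "D #> b [^] j"] b by (simp add: carrier_FactGroup)
  qed
  have surj: "\<exists>j i. x = elt j i" if x: "x \<in> carrier G" for x
  proof -
    have "carrier (G Mod D) = generate (G Mod D) {y}"
      using Q.generate_eq_of_ord[OF Q.subgroup_self y(1)] y(2) by (simp add: order_def)
    moreover have "D #> x \<in> carrier (G Mod D)" using x by (simp add: carrier_FactGroup)
    ultimately obtain j :: nat where "D #> x = y [^]\<^bsub>G Mod D\<^esub> j" using Q.generate_singleton[OF y(1)] by auto
    then have "D #> x = D #> b [^] j" using coset[of j 0] b by (simp add: elt_def)
    then have "x \<in> D #> b [^] j" using rcos_self[OF x Ds] by simp
    then obtain d where "d \<in> D" "x = d \<otimes> b [^] j" by (auto simp: r_coset_def)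
    then obtain i :: nat where "x = a [^] i \<otimes> b [^] j" using Dgen by blast
    then show ?thesis unfolding a_pow_mult_b_pow elt_def by blast
  qed

  \<comment> \<open>With d = gcd(m, r - 1), a and b commute modulo the normal subgroup generated by
    a^d, which therefore contains D. Since a^d has order m / d, d is 1.\<close>
  have gcd_r: "gcd m (r - 1) = 1"
  proof -
    define d where "d = gcd m (r - 1)"
    let ?A = "generate G {a [^] d}"
    have A: "subgroup ?A G" using subgroup_generate_singleton ac by simp
    have A_iff: "x \<in> ?A \<longleftrightarrow> (\<exists>k. x = a [^] (d * k))" for x
      using generate_singleton[of "a [^] d"] ac by (auto simp: nat_pow_pow)
    have conjA: "conj_by g x \<in> ?A" if g: "g \<in> carrier G" and x: "x \<in> ?A" for g x
    proof -
      obtain k where k: "x = a [^] (d * k)" using x A_iff by blast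
      have "conj_by g a \<in> D" using normal_invE(2)[OF D g a(1)] by (simp add: conj_by_def)
      then obtain i :: nat where "conj_by g a = a [^] i" using Dgen by blast
      then have "conj_by g x = a [^] (d * (k * i))"
        unfolding k using g ac by (simp add: conj_by_pow nat_pow_pow mult_ac)
      then show ?thesis using A_iff by blast
    qed
    have rd: "[r = 1] (mod d)" using r by (subst cong_altdef_nat) (auto simp: d_def)
    have "derived_set G (carrier G) \<subseteq> ?A"
    proof
      fix c assume "c \<in> derived_set G (carrier G)"
      then obtain g h where gh: "g \<in> carrier G" "h \<in> carrier G" "c = g \<otimes> h \<otimes> inv g \<otimes> inv h" by auto
      obtain j i k l where e: "g = elt j i" "h = elt k l" using surj gh by meson
      define s where "s = i * r ^ k + l"
      define t where "t = l * r ^ j + i"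
      have "[s = i * 1 ^ k + l] (mod d)" unfolding s_def using rd by (intro cong_add cong_mult cong_pow) auto
      moreover have "[t = l * 1 ^ j + i] (mod d)" unfolding t_def using rd by (intro cong_add cong_mult cong_pow) auto
      ultimately have "[s = t] (mod d)" by (simp add: cong_def add.commute)
      \<comment> \<open>The multiple m t, which does not affect powers of a, pads s so that the
        difference with t stays a natural number.\<close>
      moreover have "[m * t = 0] (mod d)" by (simp add: d_def cong_0_iff)
      ultimately have "[s + m * t = t + 0] (mod d)" by (rule cong_add)
      moreover have ge: "t \<le> s + m * t" using m0 by (cases m) auto
      ultimately have "d dvd s + m * t - t" using cong_altdef_nat[OF ge] by simp
      then obtain q where q: "s + m * t - t = d * q" by blast
      have "a [^] s = a [^] (d * q + t)"
        using q ge by (simp add: a_eq) (metis cong_def mod_mult_self2 le_add_diff_inverse2)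
      then have "elt (j + k) s = b [^] (j + k) \<otimes> a [^] (d * q) \<otimes> a [^] t"
        using ac b by (simp add: elt_def nat_pow_mult[symmetric] m_assoc)
      then have "g \<otimes> h = b [^] (j + k) \<otimes> a [^] (d * q) \<otimes> inv (b [^] (j + k)) \<otimes> (b [^] (j + k) \<otimes> a [^] t)"
        unfolding e elt_mult s_def[symmetric] using ac b by (simp add: m_assoc) (simp add: m_assoc[symmetric])
      moreover have "h \<otimes> g = b [^] (j + k) \<otimes> a [^] t"
        unfolding e elt_mult t_def by (simp add: elt_def add.commute)
      ultimately have "g \<otimes> h = conj_by (b [^] (j + k)) (a [^] (d * q)) \<otimes> (h \<otimes> g)"
        by (simp add: conj_by_def)
      then have "c = conj_by (b [^] (j + k)) (a [^] (d * q))"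
        using gh ac b by (metis (no_types, lifting) conj_by_closed inv_closed inv_mult_group inv_solve_right m_assoc m_closed nat_pow_closed)
      then show "c \<in> ?A" using conjA[of "b [^] (j + k)" "a [^] (d * q)"] A_iff b by auto
    qed
    then have "D \<subseteq> ?A" unfolding D_def derived_def by (rule generate_subgroup_incl[OF _ A])
    then have "m \<le> ord (a [^] d)"
      using card_mono[OF finite_subgroup[OF A]] generate_pow_card[of "a [^] d"] ac by (simp add: m_def)
    moreover have d0: "d \<noteq> 0" "d dvd m" using m0 by (simp_all add: d_def)
    then have "ord (a [^] d) = m div d" using ord_pow[OF ac, of d] a(2) by (simp add: m_def)
    ultimately have "m \<le> m div d" by simp
    then have "d = 1" using m0 d0(1) by (metis div_less_dividend linorder_not_le nat_neq_iff less_one)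
    then show ?thesis by (simp add: d_def)
  qed

  \<comment> \<open>b^n is a power a^i commuting with b, so m divides i (r - 1) and hence i.\<close>
  have bn: "b [^] n = \<one>"
  proof -
    have "b [^] n \<in> D" using bD by simp
    then obtain i :: nat where i: "b [^] n = a [^] i" using Dgen by blast
    have "b \<otimes> a [^] (i * r) = b [^] n \<otimes> b" using a_pow_mult_b[of i] i by simp
    also have "\<dots> = b \<otimes> a [^] i" unfolding i[symmetric] using b by (simp add: nat_pow_Suc2[symmetric])
    finally have "[i * r = i] (mod m)" using ac b a_eq by simp
    then have "m dvd i * r - i" using r by (metis cong_altdef_nat le_add1 mult.commute mult_le_mono1 nat_mult_1 Suc_leI One_nat_def)
    then have "m dvd i * (r - 1)" by (simp add: diff_mult_distrib2)
    then have "m dvd i" using gcd_r by (metis coprime_dvd_mult_left_iff coprime_iff_gcd_eq_1)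
    then show ?thesis using i a_eq[of i 0] by (simp add: cong_0_iff)
  qed
  have eq: "elt j i = elt k l \<longleftrightarrow> [j = k] (mod n) \<and> [i = l] (mod m)" for j i k l
  proof
    assume e: "elt j i = elt k l"
    then have "y [^]\<^bsub>G Mod D\<^esub> j = y [^]\<^bsub>G Mod D\<^esub> k" using coset by metis
    then have jk: "[j = k] (mod n)" using Q.pow_eq_pow_iff[OF y(1)] y(2) by (simp add: n_def)
    then have "b [^] j = b [^] k" using pow_eq_pow_of_cong[OF b(1) bn] by blast
    then have "a [^] i = a [^] l" using e ac b by (simp add: elt_def)
    then show "[j = k] (mod n) \<and> [i = l] (mod m)" using jk a_eq by blast
  next
    assume "[j = k] (mod n) \<and> [i = l] (mod m)"
    then show "elt j i = elt k l" using pow_eq_pow_of_cong[OF b(1) bn] a_eq by (metis elt_def)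
  qed

  \<comment> \<open>For a common prime p, the power x^(p^f) of a Sylow generator must have order
    p^e, the full p-part of m. It equals a^(i S) with S a sum of p^f terms, each 1 modulo p, so p
    divides S and the (m / p)-th power is already trivial.\<close>
  have gcd_mn: "gcd m n = 1"
  proof (rule ccontr)
    assume "gcd m n \<noteq> 1"
    then obtain p where p: "prime p" "p dvd m" "p dvd n" using prime_factor_nat[of "gcd m n"] by auto
    let ?e = "multiplicity p m" and ?f = "multiplicity p n"
    have p1: "1 < p" using prime_gt_1_nat[OF p(1)] .
    have f: "0 < ?f" using p n0 p1 by (simp add: multiplicity_gt_zero_iff)
    obtain x where x: "x \<in> carrier G" "\<And>k. x [^] k \<in> D \<longleftrightarrow> p ^ ?f dvd k" "ord (x [^] (p ^ ?f)) = p ^ ?e"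
      unfolding n_def m_def by (rule sylow_generator_mod_normal[OF D p(1)]) blast
    obtain j i where e: "x = elt j i" using surj x by blast
    define S where "S = (\<Sum>l<p ^ ?f. (r ^ j) ^ l)"
    have xp: "x [^] (p ^ ?f) = elt (j * p ^ ?f) (i * S)"
      unfolding e elt_pow S_def by (simp add: power_mult)
    have "x [^] (p ^ ?f) \<in> D" using x(2) by simp
    then have "D #> x [^] (p ^ ?f) = D" using x(1) by (intro coset_join2 Ds) auto
    then have "y [^]\<^bsub>G Mod D\<^esub> (j * p ^ ?f) = \<one>\<^bsub>G Mod D\<^esub>" using coset xp by simp
    then have nj: "n dvd j * p ^ ?f" using Q.pow_eq_id[OF y(1)] y(2) by (simp add: n_def)
    have bj: "b [^] (j * p ^ ?f) = \<one>" using nj bn b pow_eq_id dvd_trans by blast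
    have "a [^] (1::nat) \<otimes> b [^] (j * p ^ ?f) = b [^] (j * p ^ ?f) \<otimes> a [^] (1 * r ^ (j * p ^ ?f))"
      by (rule a_pow_mult_b_pow)
    then have "a [^] (1::nat) = a [^] (r ^ (j * p ^ ?f))" using bj ac by simp
    then have "[(r ^ j) ^ p ^ ?f = 1] (mod m)" unfolding a_eq power_mult by (rule cong_sym)
    then have "[(r ^ j) ^ p ^ ?f = 1] (mod p)" using p(2) cong_dvd_modulus_nat by blast
    then have "[r ^ j = 1] (mod p)" using cong_power_prime_power[OF p(1), of "r ^ j" ?f] cong_trans cong_sym by blast
    then have "[S = p ^ ?f] (mod p)" unfolding S_def by (rule cong_sum_powers_one)
    then have "p dvd S" using f by (metis cong_dvd_iff dvd_power)
    then obtain S' where S': "S = p * S'" by blast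
    obtain m' where m': "m = p * m'" using p(2) by blast
    have "x [^] (p ^ ?f) = a [^] (i * S)" using xp bj ac by (simp add: elt_def)
    then have "(x [^] (p ^ ?f)) [^] m' = a [^] (m * (i * S'))"
      using ac by (simp add: nat_pow_pow S' m' mult_ac)
    also have "\<dots> = \<one>" using a_eq[of "m * (i * S')" 0] by (simp add: cong_0_iff)
    finally have "p ^ ?e dvd m'" using x(1,3) by (simp add: pow_eq_id)
    then have "p ^ Suc ?e dvd m" using m' by simp
    then have "Suc ?e \<le> ?e" using m0 p1 by (intro multiplicity_geI) auto
    then show False by simp
  qed
  have "zm_group G a b r m n" by unfold_locales (use m0 n0 surj eq in auto)
  then show ?thesis using r gcd_mn gcd_r by (intro exI conjI)
qed

end

section \<open>Isomorphisms between groups with the same normal form\<close>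

context zm_group
begin

lemma elt_zero [simp]: "elt 0 0 = \<one>"
  by (simp add: elt_def)

lemma r_pow_n: "[r ^ n = 1] (mod m)"
proof -
  have "elt 0 1 \<otimes> elt n 0 = elt n (r ^ n)" by (simp add: elt_mult)
  moreover have "elt n 0 = \<one>" using elt_eq_iff[of n 0 0 0] by (simp add: cong_0_iff)
  ultimately have "elt 0 1 = elt n (r ^ n)" by simp
  then show ?thesis using elt_eq_iff cong_sym by blast
qed

lemma bij_betw_elt: "bij_betw (\<lambda>(j, i). elt j i) ({..<n} \<times> {..<m}) (carrier G)"
proof (rule bij_betwI')
  show "(\<lambda>(j, i). elt j i) x = (\<lambda>(j, i). elt j i) y \<longleftrightarrow> x = y"
    if "x \<in> {..<n} \<times> {..<m}" "y \<in> {..<n} \<times> {..<m}" for x y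
    using that by (auto simp: elt_eq_iff cong_def)
  fix x assume "x \<in> carrier G"
  then obtain j i where "x = elt j i" using elt_surj by blast
  then have "x = (\<lambda>(j, i). elt j i) (j mod n, i mod m)" by (simp add: elt_eq_iff)
  then show "\<exists>p\<in>{..<n} \<times> {..<m}. x = (\<lambda>(j, i). elt j i) p" using m_pos n_pos by force
qed auto

lemma order_eq: "order G = m * n"
  using bij_betw_same_card[OF bij_betw_elt] by (simp add: order_def card_cartesian_product mult.commute)

lemma finite_group: "finite_group G"
  using bij_betw_finite[OF bij_betw_elt] by unfold_locales simp

end

text \<open>Multiplication (\<open>elt_mult\<close>) and equality (\<open>elt_eq_iff\<close>) of
  normal forms depend only on m, n and r, so matching equal exponents is well defined and an
  isomorphism.\<close>

lemma zm_group_iso: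
  assumes "zm_group G a b r m n" "zm_group H a' b' r m n"
  shows "G \<cong> H"
proof -
  interpret G: zm_group G a b r m n by fact
  interpret H: zm_group H a' b' r m n by fact
  define f where "f x = (let p = (SOME p. x = G.elt (fst p) (snd p)) in H.elt (fst p) (snd p))" for x
  have f: "f (G.elt j i) = H.elt j i" for j i
  proof -
    let ?p = "SOME p. G.elt j i = G.elt (fst p) (snd p)"
    have "\<exists>p. G.elt j i = G.elt (fst p) (snd p)" by (intro exI[of _ "(j, i)"]) simp
    then have "G.elt j i = G.elt (fst ?p) (snd ?p)" by (rule someI_ex)
    then have "H.elt j i = H.elt (fst ?p) (snd ?p)" unfolding G.elt_eq_iff H.elt_eq_iff .
    then show ?thesis by (simp add: f_def Let_def)
  qed
  have "f \<in> iso G H"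
    unfolding iso_def
  proof (intro CollectI conjI homI)
    show "f x \<in> carrier H" if "x \<in> carrier G" for x
      using G.elt_surj[OF that] f by auto
    show "f (x \<otimes>\<^bsub>G\<^esub> y) = f x \<otimes>\<^bsub>H\<^esub> f y" if "x \<in> carrier G" "y \<in> carrier G" for x y
      using G.elt_surj[OF that(1)] G.elt_surj[OF that(2)] by (auto simp: G.elt_mult H.elt_mult f)
    show "bij_betw f (carrier G) (carrier H)"
    proof (rule bij_betwI')
      show "f x = f y \<longleftrightarrow> x = y" if "x \<in> carrier G" "y \<in> carrier G" for x y
        using G.elt_surj[OF that(1)] G.elt_surj[OF that(2)] by (auto simp: f G.elt_eq_iff H.elt_eq_iff)
      show "f x \<in> carrier H" if "x \<in> carrier G" for x
        using G.elt_surj[OF that] f by auto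
      show "\<exists>x\<in>carrier G. y = f x" if "y \<in> carrier H" for y
        using H.elt_surj[OF that] f G.elt_closed by metis
    qed
  qed
  then show ?thesis by (auto simp: is_iso_def)
qed

lemma zm_group_transfer:
  assumes "zm_group H a b r m n" "h \<in> iso H G" "group G"
  shows "zm_group G (h a) (h b) r m n"
proof -
  interpret H: zm_group H a b r m n by fact
  interpret G: group G by fact
  have hom: "h \<in> hom H G" and bij: "bij_betw h (carrier H) (carrier G)" using assms(2) by (auto simp: iso_def)
  interpret h: group_hom H G h using hom by unfold_locales
  have pow: "h x [^]\<^bsub>G\<^esub> k = h (x [^]\<^bsub>H\<^esub> k)" if "x \<in> carrier H" for x and k :: nat
    using h.hom_nat_pow[OF that] by simp
  interpret G: metacyclic_relation G "h a" "h b" r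
  proof unfold_locales
    show "h a \<otimes>\<^bsub>G\<^esub> h b = h b \<otimes>\<^bsub>G\<^esub> h a [^]\<^bsub>G\<^esub> r"
      using H.a_mult_b by (simp add: pow flip: h.hom_mult)
  qed auto
  have elt: "G.elt j i = h (H.elt j i)" for j i
    by (simp add: G.elt_def H.elt_def pow)
  show ?thesis
  proof unfold_locales
    show "\<exists>j i. x = G.elt j i" if "x \<in> carrier G" for x
    proof -
      obtain y where "y \<in> carrier H" "x = h y" using bij_betw_imp_surj_on[OF bij] \<open>x \<in> carrier G\<close> by blast
      then show ?thesis using H.elt_surj elt by metis
    qed
    show "G.elt j i = G.elt k l \<longleftrightarrow> [j = k] (mod n) \<and> [i = l] (mod m)" for j i k l
      using bij H.elt_eq_iff by (metis H.elt_closed bij_betw_def elt inj_on_eq_iff)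
  qed (rule H.m_pos H.n_pos)+
qed

section \<open>The normal form in the presented group\<close>

text \<open>
  The right regular action on the normal forms: a pair \<open>(j, i)\<close> stands for \<open>b^j a^i\<close>.
\<close>

fun zm_act :: "nat \<Rightarrow> nat \<Rightarrow> nat \<Rightarrow> zm_gen \<times> bool \<Rightarrow> nat \<times> nat \<Rightarrow> nat \<times> nat" where
  "zm_act m n r (Gen_a, True) (j, i) = (j, (i + 1) mod m)"
| "zm_act m n r (Gen_a, False) (j, i) = (j, (i + (m - 1)) mod m)"
| "zm_act m n r (Gen_b, True) (j, i) = ((j + 1) mod n, (i * r) mod m)"
| "zm_act m n r (Gen_b, False) (j, i) = ((j + (n - 1)) mod n, (i * r ^ (n - 1)) mod m)"

lemma mod_succ_pred:
  fixes x k :: nat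
  assumes "x < k"
  shows "((x + 1) mod k + (k - 1)) mod k = x" "((x + (k - 1)) mod k + 1) mod k = x"
proof -
  have "x + 1 + (k - 1) = x + k" "x + (k - 1) + 1 = x + k" using assms by simp_all
  then show "((x + 1) mod k + (k - 1)) mod k = x" "((x + (k - 1)) mod k + 1) mod k = x"
    unfolding mod_add_left_eq using assms by simp_all
qed

definition zm_relators :: "nat \<Rightarrow> nat \<Rightarrow> nat \<Rightarrow> (zm_gen group_word \<times> zm_gen group_word) set" where
  "zm_relators m n r = {(replicate m (Gen_a, True), []),
     (replicate n (Gen_b, True), []),
     ([(Gen_b, False), (Gen_a, True), (Gen_b, True)], replicate r (Gen_a, True))}"

context
  fixes m n r :: nat
  assumes m0: "0 < m" and n0: "0 < n" and rn: "[r ^ n = 1] (mod m)"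
begin

lemma zm_act_closed: "p \<in> {..<n} \<times> {..<m} \<Longrightarrow> zm_act m n r l p \<in> {..<n} \<times> {..<m}"
  using m0 n0 by (cases "(m, n, r, l, p)" rule: zm_act.cases) auto

lemma fold_zm_act_closed:
  "p \<in> {..<n} \<times> {..<m} \<Longrightarrow> fold (zm_act m n r) w p \<in> {..<n} \<times> {..<m}"
  by (induction w arbitrary: p) (simp_all only: fold_simps zm_act_closed)

lemma fold_zm_act_replicate_a:
  "i < m \<Longrightarrow> fold (zm_act m n r) (replicate k (Gen_a, True)) (j, i) = (j, (i + k) mod m)"
proof (induction k arbitrary: i)
  case (Suc k)
  have "((i + 1) mod m + k) mod m = (i + Suc k) mod m" by (simp add: mod_simps)
  then show ?case using Suc.IH[of "(i + 1) mod m"] m0 by simp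
qed simp

lemma fold_zm_act_replicate_b:
  "j < n \<Longrightarrow> i < m \<Longrightarrow>
    fold (zm_act m n r) (replicate k (Gen_b, True)) (j, i) = ((j + k) mod n, (i * r ^ k) mod m)"
proof (induction k arbitrary: i j)
  case (Suc k)
  have "((j + 1) mod n + k) mod n = (j + Suc k) mod n" by (simp add: mod_simps)
  moreover have "((i * r) mod m * r ^ k) mod m = (i * r ^ Suc k) mod m" by (simp add: mod_simps mult.assoc)
  ultimately show ?case using Suc.IH[of "(j + 1) mod n" "(i * r) mod m"] m0 n0 by simp
qed simp

lemma mult_r_pow_n_mod: "(i * r ^ n + k) mod m = (i + k) mod m"
proof -
  have "[i * r ^ n + k = i * 1 + k] (mod m)" using rn by (intro cong_add cong_mult) auto
  then show ?thesis by (simp add: cong_def)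
qed

text \<open>\<open>fold\<close> reads a word from left to right, as a right action does. Letters
  with opposite flags cancel because r^(n-1) inverts r modulo m. Invariance under the relators makes
  the action an obstruction to any collapse of normal forms.\<close>

lemma word_equiv_imp_fold_zm_act_eq:
  assumes "word_equiv (zm_relators m n r) u v" "p \<in> {..<n} \<times> {..<m}"
  shows "fold (zm_act m n r) u p = fold (zm_act m n r) v p"
  using assms
proof (induction arbitrary: p rule: word_equiv.induct)
  case (relator u v)
  obtain j i where p: "p = (j, i)" "j < n" "i < m" using relator by auto
  have rr: "r ^ (n - 1) * r = r ^ n" by (rule power_minus_mult[OF n0])
  \<comment> \<open>The word b^-1 a b sends the exponent i to (i r^(n-1) + 1) r, which is i + r
    modulo m.\<close>
  have "((i * r ^ (n - 1) mod m + 1) mod m * r) mod m = ((i * r ^ (n - 1) + 1) * r) mod m"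
    by (simp add: mod_simps)
  also have "(i * r ^ (n - 1) + 1) * r = i * r ^ n + r" by (simp add: algebra_simps flip: rr)
  finally have third: "((i * r ^ (n - 1) mod m + 1) mod m * r) mod m = (i + r) mod m"
    by (simp add: mult_r_pow_n_mod)
  have "((j + (n - 1)) mod n + 1) mod n = j" using mod_succ_pred(2)[OF p(2)] .
  then show ?case
    using relator(1) p third fold_zm_act_replicate_a[of i _ j] fold_zm_act_replicate_b[of j i] mult_r_pow_n_mod[of i 0]
    by (auto simp: zm_relators_def)
next
  case (cancel x e)
  obtain j i where p: "p = (j, i)" "j < n" "i < m" using cancel by auto
  have "r ^ (n - 1) * r = r ^ n" by (rule power_minus_mult[OF n0])
  then have rr: "r ^ (n - Suc 0) * r = r ^ n" "r * r ^ (n - Suc 0) = r ^ n" by (simp_all add: mult.commute)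
  have 1: "((i + 1) mod m + (m - 1)) mod m = i" "((i + (m - 1)) mod m + 1) mod m = i"
    using mod_succ_pred[OF p(3)] .
  have 2: "((j + 1) mod n + (n - 1)) mod n = j" "((j + (n - 1)) mod n + 1) mod n = j"
    using mod_succ_pred[OF p(2)] .
  have 3: "((i * r) mod m * r ^ (n - 1)) mod m = i" "((i * r ^ (n - 1)) mod m * r) mod m = i"
    using mult_r_pow_n_mod[of i 0] p by (simp_all add: mod_simps mult.assoc rr)
  have "zm_act m n r (x, \<not> e) (zm_act m n r (x, e) (j, i)) = (j, i)"
    by (cases x; cases e) (simp_all only: zm_act.simps 1 2 3 simp_thms)
  then show ?case by (simp add: p(1))
next
  case (append u u' v v')
  then show ?case using fold_zm_act_closed by simp
qed auto

text \<open>Existence of normal forms follows by multiplying letters together. Uniqueness holds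
  because the word b^j a^i moves (0, 0) to (j mod n, i mod m), by \<open>nf\<close>, and equivalent
  words act equally.\<close>

lemma zm_group_ZM: "\<exists>a b. zm_group (ZM m n r) a b r m n"
proof -
  define R where "R = zm_relators m n r"
  have ZM: "ZM m n r = presented_group R" by (simp add: ZM_def R_def zm_relators_def)
  let ?P = "presented_group R" and ?c = "word_class R"
  interpret P: group ?P by (rule group_presented_group)
  have carr: "carrier ?P = range ?c" and one: "\<one>\<^bsub>?P\<^esub> = ?c []" by (simp_all add: presented_group_def)
  have c_closed: "?c w \<in> carrier ?P" for w by (simp add: carr)
  define a where "a = ?c [(Gen_a, True)]"
  define b where "b = ?c [(Gen_b, True)]"
  have pow: "?c [l] [^]\<^bsub>?P\<^esub> k = ?c (replicate k l)" for l and k :: nat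
  proof (induction k)
    case (Suc k)
    then show ?case by (simp add: word_class_mult flip: replicate_append_same)
  qed (simp add: one)
  have rel: "?c u = ?c v" if "(u, v) \<in> R" for u v
    using that by (simp add: word_class_eq_iff word_equiv.relator)
  have am: "a [^]\<^bsub>?P\<^esub> m = \<one>\<^bsub>?P\<^esub>" and bn: "b [^]\<^bsub>?P\<^esub> n = \<one>\<^bsub>?P\<^esub>"
    unfolding a_def b_def pow one by (rule rel; simp add: R_def zm_relators_def)+
  have inv: "?c [(x, False)] = inv\<^bsub>?P\<^esub> ?c [(x, True)]" for x
  proof (rule P.inv_equality[symmetric])
    show "?c [(x, False)] \<otimes>\<^bsub>?P\<^esub> ?c [(x, True)] = \<one>\<^bsub>?P\<^esub>"
      using word_equiv.cancel[of R x False] by (simp add: word_class_mult one word_class_eq_iff)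
  qed (rule c_closed)+
  have "inv\<^bsub>?P\<^esub> b \<otimes>\<^bsub>?P\<^esub> a \<otimes>\<^bsub>?P\<^esub> b = a [^]\<^bsub>?P\<^esub> r"
    unfolding a_def b_def pow inv[symmetric]
    by (simp add: word_class_mult) (rule rel; simp add: R_def zm_relators_def)
  then have "b \<otimes>\<^bsub>?P\<^esub> (inv\<^bsub>?P\<^esub> b \<otimes>\<^bsub>?P\<^esub> a \<otimes>\<^bsub>?P\<^esub> b) = b \<otimes>\<^bsub>?P\<^esub> a [^]\<^bsub>?P\<^esub> r" by simp
  then have ab: "a \<otimes>\<^bsub>?P\<^esub> b = b \<otimes>\<^bsub>?P\<^esub> a [^]\<^bsub>?P\<^esub> r"
    using c_closed by (simp add: a_def b_def P.m_assoc[symmetric])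
  interpret P: metacyclic_relation ?P a b r
    by unfold_locales (use ab c_closed in \<open>auto simp: a_def b_def\<close>)
  have elt: "P.elt j i = ?c (replicate j (Gen_b, True) @ replicate i (Gen_a, True))" for j i
    unfolding P.elt_def unfolding a_def b_def pow word_class_mult ..
  have nf: "fold (zm_act m n r) (replicate j (Gen_b, True) @ replicate i (Gen_a, True)) (0, 0)
      = (j mod n, i mod m)" for j i
    by (simp only: fold_append comp_apply fold_zm_act_replicate_b[OF n0 m0] mult_zero_left mod_0 add_0
      fold_zm_act_replicate_a[OF m0])
  \<comment> \<open>An inverse generator is a positive power of the generator, hence itself in
    normal form.\<close>
  have letter: "\<exists>j i. ?c [l] = P.elt j i" for l
  proof -
    have pred: "inv\<^bsub>?P\<^esub> x = x [^]\<^bsub>?P\<^esub> (k - 1)" if "x \<in> carrier ?P" "x [^]\<^bsub>?P\<^esub> k = \<one>\<^bsub>?P\<^esub>" "0 < k" for x and k :: nat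
    proof (rule P.inv_equality)
      have "x [^]\<^bsub>?P\<^esub> (k - 1) \<otimes>\<^bsub>?P\<^esub> x = x [^]\<^bsub>?P\<^esub> Suc (k - 1)" by simp
      then show "x [^]\<^bsub>?P\<^esub> (k - 1) \<otimes>\<^bsub>?P\<^esub> x = \<one>\<^bsub>?P\<^esub>" using that by simp
    qed (use that in auto)
    obtain x e where l: "l = (x, e)" by (cases l)
    show ?thesis
    proof (cases x; cases e)
      assume "x = Gen_a" "e"
      moreover have "?c [(Gen_a, True)] = P.elt 0 1" by (simp add: P.elt_def flip: a_def)
      ultimately show ?thesis using l by auto
    next
      assume "x = Gen_b" "e"
      moreover have "?c [(Gen_b, True)] = P.elt 1 0" by (simp add: P.elt_def flip: b_def)
      ultimately show ?thesis using l by auto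
    next
      assume "x = Gen_a" "\<not> e"
      moreover have "?c [(Gen_a, False)] = P.elt 0 (m - 1)"
        unfolding inv a_def[symmetric] pred[OF P.a_closed am m0] by (simp add: P.elt_def)
      ultimately show ?thesis using l by auto
    next
      assume "x = Gen_b" "\<not> e"
      moreover have "?c [(Gen_b, False)] = P.elt (n - 1) 0"
        unfolding inv b_def[symmetric] pred[OF P.b_closed bn n0] by (simp add: P.elt_def)
      ultimately show ?thesis using l by auto
    qed
  qed
  have "zm_group ?P a b r m n"
  proof unfold_locales
    fix x assume "x \<in> carrier ?P"
    then obtain w where "x = ?c w" by (auto simp: carr)
    moreover have "\<exists>j i. ?c w = P.elt j i" for w
    proof (induction w)
      case Nil
      show ?case by (rule exI[of _ 0], rule exI[of _ 0]) (simp add: elt)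
    next
      case (Cons l w)
      then obtain j i where "?c w = P.elt j i" by blast
      moreover obtain j' i' where "?c [l] = P.elt j' i'" using letter by blast
      moreover have "?c (l # w) = ?c [l] \<otimes>\<^bsub>?P\<^esub> ?c w" by (simp add: word_class_mult)
      ultimately show ?case by (auto simp: P.elt_mult)
    qed
    ultimately show "\<exists>j i. x = P.elt j i" by blast
  next
    fix j i k l
    show "P.elt j i = P.elt k l \<longleftrightarrow> [j = k] (mod n) \<and> [i = l] (mod m)"
    proof
      assume "P.elt j i = P.elt k l"
      then have "word_equiv (zm_relators m n r) (replicate j (Gen_b, True) @ replicate i (Gen_a, True))
        (replicate k (Gen_b, True) @ replicate l (Gen_a, True))"
        unfolding elt word_class_eq_iff unfolding R_def .
      from word_equiv_imp_fold_zm_act_eq[OF this, of "(0, 0)"]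
      have "(j mod n, i mod m) = (k mod n, l mod m)" using m0 n0 by (simp only: nf) simp
      then show "[j = k] (mod n) \<and> [i = l] (mod m)" by (simp add: cong_def)
    next
      assume "[j = k] (mod n) \<and> [i = l] (mod m)"
      then show "P.elt j i = P.elt k l"
        using P.pow_eq_pow_of_cong[OF P.a_closed am] P.pow_eq_pow_of_cong[OF P.b_closed bn]
        by (metis P.elt_def)
    qed
  qed (rule m0 n0)+
  then show ?thesis unfolding ZM by blast
qed

end

section \<open>Counting the subgroups of a ZM group\<close>

text \<open>The condition says that s is a multiple of k / gcd(k, R).\<close>

lemma card_dvd_mult_less:
  assumes "0 < (k::nat)"
  shows "card {s. s < k \<and> k dvd s * R} = gcd k R"
proof -
  define g where "g = gcd k R"
  have g0: "0 < g" using assms by (simp add: g_def)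
  have "\<exists>k' R'. k = k' * g \<and> R = R' * g \<and> coprime k' R'"
    unfolding g_def by (rule gcd_coprime_exists) (use assms in simp)
  then obtain k' R' where kR: "k = k' * g" "R = R' * g" "coprime k' R'" by blast
  have k'0: "0 < k'" using assms kR by simp
  have "{s. s < k \<and> k dvd s * R} = (\<lambda>t. k' * t) ` {..<g}"
  proof (intro equalityI subsetI)
    fix s assume "s \<in> {s. s < k \<and> k dvd s * R}"
    then have s: "s < k" "k' * g dvd (s * R') * g" by (simp_all add: kR mult.assoc)
    then have "k' dvd s * R'" using g0 by simp
    then have "k' dvd s" using kR(3) by (simp add: coprime_dvd_mult_left_iff)
    then obtain t where "s = k' * t" by blast
    then show "s \<in> (\<lambda>t. k' * t) ` {..<g}" using s(1) kR(1) k'0 by auto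
  next
    fix s assume "s \<in> (\<lambda>t. k' * t) ` {..<g}"
    then show "s \<in> {s. s < k \<and> k dvd s * R}" using k'0 by (auto simp: kR)
  qed
  moreover have "inj_on (\<lambda>t. k' * t) {..<g}" using k'0 by (auto intro: inj_onI)
  ultimately show ?thesis by (simp add: card_image g_def)
qed

text \<open>The least positive element divides all others, by division with remainder. It yields the
  parameters m1 and n1 of a subgroup.\<close>

lemma exists_common_divisor_if_mod_closed:
  fixes S :: "nat set"
  assumes "y \<in> S" "0 < y" and closed: "\<And>x y. x \<in> S \<Longrightarrow> y \<in> S \<Longrightarrow> 0 < y \<Longrightarrow> x mod y \<in> S"
  obtains d where "d \<in> S" "0 < d" "\<And>x. x \<in> S \<Longrightarrow> d dvd x"
proof -
  define d where "d = (LEAST d. d \<in> S \<and> 0 < d)"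
  have d: "d \<in> S \<and> 0 < d" unfolding d_def by (rule LeastI[of _ y]) (use assms in auto)
  have "d dvd x" if "x \<in> S" for x
  proof (rule ccontr)
    assume "\<not> d dvd x"
    then have "x mod d \<in> S \<and> 0 < x mod d" using closed that d by (auto simp: dvd_eq_mod_eq_0)
    then have "d \<le> x mod d" unfolding d_def by (rule Least_le)
    then show False using mod_less_divisor[of d x] d by linarith
  qed
  then show thesis using that d by blast
qed

lemma (in finite_group) subgroup_if_mult_closed:
  assumes "H \<subseteq> carrier G" "\<one> \<in> H" "\<And>x y. x \<in> H \<Longrightarrow> y \<in> H \<Longrightarrow> x \<otimes> y \<in> H"
  shows "subgroup H G"
proof (rule subgroupI)
  fix x assume x: "x \<in> H"
  then have xc: "x \<in> carrier G" using assms(1) by blast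
  have "x [^] (k::nat) \<in> H" for k by (induction k) (use assms x in auto)
  moreover have "inv x = x [^] (ord x - 1)"
  proof (rule inv_equality)
    have "x [^] (ord x - 1) \<otimes> x = x [^] Suc (ord x - 1)" by simp
    then show "x [^] (ord x - 1) \<otimes> x = \<one>" using ord_pos[OF xc] xc by simp
  qed (use xc in auto)
  ultimately show "inv x \<in> H" by simp
qed (use assms in auto)

context zm_group
begin

text \<open>The exponent arising in powers: (b^n1 a^s)^k = b^(n1 k) a^(s
  \<open>geom_sum n1 k\<close>). At k = n / n1 it is R(n1).\<close>

definition geom_sum :: "nat \<Rightarrow> nat \<Rightarrow> nat" where
  "geom_sum n1 k = (\<Sum>l<k. r ^ (n1 * l))"

lemma geom_sum_add: "geom_sum n1 (k + k') = geom_sum n1 k * r ^ (n1 * k') + geom_sum n1 k'"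
proof (induction k)
  case (Suc k)
  have shift: "geom_sum n1 (Suc j) = geom_sum n1 j + r ^ (n1 * j)" for j by (simp add: geom_sum_def)
  then show ?case using Suc by (simp add: algebra_simps power_add)
qed (simp add: geom_sum_def)

lemma R_sum_eq: "R_sum n r n1 = geom_sum n1 (n div n1)"
  by (simp add: R_sum_def geom_sum_def mult.commute)

lemma elt_pow_geom_sum: "elt n1 s [^] k = elt (n1 * k) (s * geom_sum n1 k)"
  by (simp add: elt_pow geom_sum_def)

text \<open>
  \<open>zm_sub (m1, n1, s)\<close> is generated by \<open>a^m1\<close> and \<open>b^n1 a^s\<close>; it meets \<open>\<langle>a\<rangle>\<close> in
  \<open>\<langle>a^m1\<rangle>\<close> precisely when \<open>m1\<close> divides \<open>s R(n1)\<close>.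
\<close>

definition zm_sub :: "nat \<times> nat \<times> nat \<Rightarrow> 'a set" where
  "zm_sub = (\<lambda>(m1, n1, s). {elt (n1 * k) (s * geom_sum n1 k + m1 * l) | k l. True})"

definition zm_triples :: "(nat \<times> nat \<times> nat) set" where
  "zm_triples = (SIGMA m1:{m1. m1 dvd m}. SIGMA n1:{n1. n1 dvd n}. {s. s < m1 \<and> m1 dvd s * R_sum n r n1})"

lemma card_zm_triples:
  "card zm_triples = (\<Sum>m1 | m1 dvd m. \<Sum>n1 | n1 dvd n. gcd m1 (R_sum n r n1))"
proof -
  have fin: "finite {m1. m1 dvd m}" "finite {n1. n1 dvd n}" using m_pos n_pos by simp_all
  have "card (SIGMA n1:{n1. n1 dvd n}. {s. s < m1 \<and> m1 dvd s * R_sum n r n1})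
    = (\<Sum>n1 | n1 dvd n. gcd m1 (R_sum n r n1))" if "m1 dvd m" for m1
  proof -
    have "0 < m1" using that m_pos dvd_pos_nat by blast
    then show ?thesis using fin by (subst card_SigmaI) (simp_all add: card_dvd_mult_less)
  qed
  then show ?thesis unfolding zm_triples_def using fin by (subst card_SigmaI) auto
qed

lemma subgroup_zm_sub: "subgroup (zm_sub (m1, n1, s)) G"
proof (rule finite_group.subgroup_if_mult_closed[OF finite_group])
  have "\<one> = elt (n1 * 0) (s * geom_sum n1 0 + m1 * 0)" by (simp add: geom_sum_def)
  then show "\<one> \<in> zm_sub (m1, n1, s)" unfolding zm_sub_def by blast
  fix x y assume "x \<in> zm_sub (m1, n1, s)" "y \<in> zm_sub (m1, n1, s)"
  then obtain k l k' l' where "x = elt (n1 * k) (s * geom_sum n1 k + m1 * l)"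
    "y = elt (n1 * k') (s * geom_sum n1 k' + m1 * l')" by (auto simp: zm_sub_def)
  moreover have "(s * geom_sum n1 k + m1 * l) * r ^ (n1 * k') + (s * geom_sum n1 k' + m1 * l')
    = s * geom_sum n1 (k + k') + m1 * (l * r ^ (n1 * k') + l')"
    unfolding geom_sum_add by (simp add: algebra_simps)
  ultimately have "x \<otimes> y = elt (n1 * (k + k')) (s * geom_sum n1 (k + k') + m1 * (l * r ^ (n1 * k') + l'))"
    by (simp only: elt_mult distrib_left)
  then show "x \<otimes> y \<in> zm_sub (m1, n1, s)" unfolding zm_sub_def by blast
qed (auto simp: zm_sub_def)

lemma elt_cong: "[i = l] (mod m) \<Longrightarrow> elt j i = elt j l"
  by (simp add: elt_eq_iff)

text \<open>The quotient of the two elements is a^(i - s); the summand m s, trivial as an exponent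
  of a, prevents truncation.\<close>

lemma elt_zero_diff_mem:
  assumes H: "subgroup H G" and "elt j s \<in> H" "elt j i \<in> H"
  shows "elt 0 (i + m * s - s) \<in> H"
proof -
  have "s \<le> i + m * s" using m_pos by (cases m) auto
  then have "s + (i + m * s - s) = i + m * s" by (rule le_add_diff_inverse)
  then have "elt j s \<otimes> elt 0 (i + m * s - s) = elt j (i + m * s)" by (simp add: elt_mult)
  also have "\<dots> = elt j i" by (rule elt_cong) (simp add: cong_def)
  finally have "elt 0 (i + m * s - s) = inv (elt j s) \<otimes> elt j i"
    by (metis elt_closed inv_solve_left')
  then show ?thesis using assms by (simp add: subgroup.m_closed subgroup.m_inv_closed)
qed

text \<open>An element of the subgroup with trivial b-part has k a multiple of n / n1. Then
  \<open>geom_sum n1 k\<close> splits into blocks of length n / n1, each contributing a multiple of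
  R(n1), and m1 divides s R(n1).\<close>

lemma elt_zero_mem_zm_sub_iff:
  assumes "(m1, n1, s) \<in> zm_triples"
  shows "elt 0 i \<in> zm_sub (m1, n1, s) \<longleftrightarrow> m1 dvd i"
proof
  have t: "m1 dvd m" "n1 dvd n" "m1 dvd s * geom_sum n1 (n div n1)"
    using assms by (auto simp: zm_triples_def R_sum_eq)
  assume "elt 0 i \<in> zm_sub (m1, n1, s)"
  then obtain k l where e: "[0 = n1 * k] (mod n)" "[i = s * geom_sum n1 k + m1 * l] (mod m)"
    by (auto simp: zm_sub_def elt_eq_iff)
  have n1: "n1 \<noteq> 0" using t(2) n_pos by auto
  have "n1 * (n div n1) dvd n1 * k" using cong_sym[OF e(1)] t(2) by (simp add: cong_0_iff)
  then have "n div n1 dvd k" using n1 by simp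
  then obtain q where q: "k = n div n1 * q" by blast
  have "m1 dvd s * geom_sum n1 (n div n1 * q)" for q
  proof (induction q)
    case (Suc q)
    have "s * geom_sum n1 (n div n1 * Suc q)
      = s * geom_sum n1 (n div n1) * r ^ (n1 * (n div n1 * q)) + s * geom_sum n1 (n div n1 * q)"
      by (simp add: geom_sum_add algebra_simps)
    then show ?case using Suc t(3) by simp
  qed (simp add: geom_sum_def)
  then have "m1 dvd s * geom_sum n1 k + m1 * l" using q by simp
  moreover have "[i = s * geom_sum n1 k + m1 * l] (mod m1)" using e(2) t(1) cong_dvd_modulus_nat by blast
  ultimately show "m1 dvd i" using cong_dvd_iff by blast
next
  assume "m1 dvd i"
  then obtain l where "i = m1 * l" by blast
  then have "elt 0 i = elt (n1 * 0) (s * geom_sum n1 0 + m1 * l)" by (simp add: geom_sum_def)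
  then show "elt 0 i \<in> zm_sub (m1, n1, s)" unfolding zm_sub_def by blast
qed

lemma elt_mem_zm_sub: "elt n1 s \<in> zm_sub (m1, n1, s)"
proof -
  have "elt n1 s = elt (n1 * 1) (s * geom_sum n1 1 + m1 * 0)" by (simp add: geom_sum_def)
  then show ?thesis unfolding zm_sub_def by blast
qed

lemma dvd_if_elt_mem_zm_sub:
  assumes "(m1, n1, s) \<in> zm_triples" "elt j i \<in> zm_sub (m1, n1, s)"
  shows "n1 dvd j"
proof -
  obtain k where "[j = n1 * k] (mod n)" using assms(2) by (auto simp: zm_sub_def elt_eq_iff)
  then have "[j = n1 * k] (mod n1)" using assms(1) cong_dvd_modulus_nat by (auto simp: zm_triples_def)
  then show ?thesis using cong_dvd_iff by fastforce
qed

text \<open>The subgroup determines m1 through its powers of a, n1 through its exponents of b, and s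
  as the only residue modulo m1 for which b^n1 a^s belongs to it.\<close>

lemma inj_on_zm_sub: "inj_on zm_sub zm_triples"
proof (rule inj_onI)
  fix x y assume xy: "x \<in> zm_triples" "y \<in> zm_triples" "zm_sub x = zm_sub y"
  obtain m1 n1 s m2 n2 t where x: "x = (m1, n1, s)" and y: "y = (m2, n2, t)"
    by (cases x, cases y) blast
  note X = xy(1)[unfolded x] and Y = xy(2)[unfolded y] and eq = xy(3)[unfolded x y]
  have m: "m1 = m2"
    using elt_zero_mem_zm_sub_iff[OF X] elt_zero_mem_zm_sub_iff[OF Y] eq
    by (metis dvd_antisym dvd_refl)
  have n: "n1 = n2"
    using dvd_if_elt_mem_zm_sub[OF X] dvd_if_elt_mem_zm_sub[OF Y] elt_mem_zm_sub eq
    by (metis dvd_antisym)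
  have "elt 0 (t + m * s - s) \<in> zm_sub (m1, n1, s)"
    using elt_zero_diff_mem[OF subgroup_zm_sub elt_mem_zm_sub] elt_mem_zm_sub eq n by metis
  then have "m1 dvd t + m * s - s" using elt_zero_mem_zm_sub_iff[OF X] by blast
  moreover have "s \<le> t + m * s" using m_pos by (cases m) auto
  ultimately have "[t + m * s = s] (mod m1)" by (simp add: cong_altdef_nat)
  moreover have "[t + m * s = t + 0] (mod m1)"
    using X by (intro cong_add) (auto simp: zm_triples_def cong_0_iff)
  ultimately have "[t = s] (mod m1)" by (metis add_0_right cong_sym cong_trans)
  moreover have "s < m1" "t < m1" using X Y m by (auto simp: zm_triples_def)
  ultimately have "s = t" by (simp add: cong_def)
  then show "x = y" using m n x y by simp
qed

text \<open>m1 and n1 are the least positive exponents of a in H and of b modulo powers of a. Some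
  b^n1 a^s lies in H, and multiplying by powers of a^m1 brings s below m1.\<close>

lemma subgroup_mem_zm_sub_image:
  assumes H: "subgroup H G"
  shows "H \<in> zm_sub ` zm_triples"
proof -
  interpret finite_group G by (rule finite_group)
  have Hc: "\<And>x. x \<in> H \<Longrightarrow> x \<in> carrier G" using subgroup.mem_carrier[OF H] .
  have cancel: "y \<in> H" if "x \<in> H" "x \<otimes> y \<in> H" "y \<in> carrier G" for x y
  proof -
    have "y = inv x \<otimes> (x \<otimes> y)" using that Hc by (simp add: m_assoc[symmetric])
    then show ?thesis using that H by (metis subgroup.m_closed subgroup.m_inv_closed)
  qed
  have one: "elt n 0 = \<one>" "elt 0 m = \<one>" using elt_eq_iff[of n 0 0 0] elt_eq_iff[of 0 m 0 0] by (simp_all add: cong_0_iff)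
  obtain m1 where m1: "elt 0 m1 \<in> H" "0 < m1" "\<And>i. elt 0 i \<in> H \<Longrightarrow> m1 dvd i"
  proof (rule exists_common_divisor_if_mod_closed[of m "{i. elt 0 i \<in> H}"])
    show "m \<in> {i. elt 0 i \<in> H}" using one subgroup.one_closed[OF H] by simp
    show "x mod y \<in> {i. elt 0 i \<in> H}" if xy: "x \<in> {i. elt 0 i \<in> H}" "y \<in> {i. elt 0 i \<in> H}" for x y
    proof -
      have "elt 0 y [^] (x div y) \<otimes> elt 0 (x mod y) = elt 0 x"
        by (simp add: elt_pow elt_mult)
      then show ?thesis
        using cancel[of "elt 0 y [^] (x div y)" "elt 0 (x mod y)"] xy subgroup_pow_closed[OF H] by simp
    qed
  qed (use m_pos in auto)
  obtain n1 where n1: "\<exists>i. elt n1 i \<in> H" "0 < n1" "\<And>j i. elt j i \<in> H \<Longrightarrow> n1 dvd j"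
  proof (rule exists_common_divisor_if_mod_closed[of n "{j. \<exists>i. elt j i \<in> H}"])
    have "elt n 0 \<in> H" using one subgroup.one_closed[OF H] by simp
    then show "n \<in> {j. \<exists>i. elt j i \<in> H}" by blast
    show "x mod y \<in> {j. \<exists>i. elt j i \<in> H}" if xy: "x \<in> {j. \<exists>i. elt j i \<in> H}" "y \<in> {j. \<exists>i. elt j i \<in> H}" for x y
    proof -
      obtain i l where il: "elt x i \<in> H" "elt y l \<in> H" using xy by blast
      \<comment> \<open>Dividing by this power of b^y a^l leaves an element whose b-exponent is x
        mod y modulo n.\<close>
      let ?z = "inv (elt y l [^] (x div y)) \<otimes> elt x i"
      have zH: "?z \<in> H" using il subgroup_pow_closed[OF H] H by (simp add: subgroup.m_closed subgroup.m_inv_closed)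
      obtain j k where z: "?z = elt j k" using elt_surj Hc[OF zH] by blast
      have "elt y l [^] (x div y) \<otimes> elt j k = elt x i" by (simp add: z[symmetric] m_assoc[symmetric])
      then obtain q where "elt (y * (x div y) + j) q = elt x i" by (auto simp: elt_pow elt_mult)
      then have "[y * (x div y) + j = y * (x div y) + x mod y] (mod n)" by (simp add: elt_eq_iff)
      then have "[j = x mod y] (mod n)" by (simp only: cong_add_lcancel_nat)
      then have "elt (x mod y) k = elt j k" by (simp add: elt_eq_iff cong_sym_eq)
      then have "elt (x mod y) k \<in> H" using zH unfolding z by simp
      then show ?thesis by blast
    qed
  qed (use n_pos in auto)
  obtain s0 where s0: "elt n1 s0 \<in> H" using n1(1) by blast
  define s where "s = s0 mod m1"
  have am1: "elt 0 (m1 * q) \<in> H" for q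
  proof -
    have "elt 0 m1 [^] q = elt 0 (m1 * q)" by (simp add: elt_pow)
    then show ?thesis using subgroup_pow_closed[OF H m1(1), of q] by simp
  qed
  have s: "elt n1 s \<in> H"
  proof -
    have "elt n1 s \<otimes> elt 0 (m1 * (s0 div m1)) = elt n1 s0" by (simp add: elt_mult s_def)
    then have "elt n1 s = elt n1 s0 \<otimes> inv (elt 0 (m1 * (s0 div m1)))"
      by (metis elt_closed inv_solve_right)
    then show ?thesis using s0 am1 H by (simp add: subgroup.m_closed subgroup.m_inv_closed)
  qed
  have dvd: "m1 dvd m" "n1 dvd n"
    using m1(3)[of m] n1(3)[of n 0] one subgroup.one_closed[OF H] by simp_all
  \<comment> \<open>This power of b^n1 a^s has trivial b-part, which is where the condition m1 | s
    R(n1) comes from.\<close>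
  have "elt n1 s [^] (n div n1) = elt 0 (s * R_sum n r n1)"
    using dvd(2) by (simp add: elt_pow_geom_sum R_sum_eq elt_eq_iff cong_0_iff)
  then have "m1 dvd s * R_sum n r n1" using m1(3) subgroup_pow_closed[OF H s] by metis
  then have triple: "(m1, n1, s) \<in> zm_triples" using dvd m1(2) by (simp add: zm_triples_def s_def)
  have "H = zm_sub (m1, n1, s)"
  proof (intro equalityI subsetI)
    fix x assume "x \<in> zm_sub (m1, n1, s)"
    then obtain k l where "x = elt (n1 * k) (s * geom_sum n1 k + m1 * l)" by (auto simp: zm_sub_def)
    then have "x = elt n1 s [^] k \<otimes> elt 0 (m1 * l)" by (simp add: elt_pow_geom_sum elt_mult)
    then show "x \<in> H" using am1 subgroup_pow_closed[OF H s] H by (simp add: subgroup.m_closed)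
  next
    fix x assume x: "x \<in> H"
    then obtain j i where e: "x = elt j i" using elt_surj Hc by blast
    then obtain k where k: "j = n1 * k" using n1(3) x by blast
    let ?t = "s * geom_sum n1 k"
    have "elt j ?t \<in> H" using subgroup_pow_closed[OF H s, of k] by (simp add: elt_pow_geom_sum k)
    then have "m1 dvd i + m * ?t - ?t" using elt_zero_diff_mem[OF H] x e m1(3) by blast
    then obtain l where l: "i + m * ?t - ?t = m1 * l" by blast
    have "?t \<le> i + m * ?t" using m_pos by (cases m) auto
    then have "?t + m1 * l = i + m * ?t" unfolding l[symmetric] by (rule le_add_diff_inverse)
    then have "x = elt (n1 * k) (?t + m1 * l)" unfolding e k by (intro elt_cong) (simp add: cong_def)
    then show "x \<in> zm_sub (m1, n1, s)" unfolding zm_sub_def by blast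
  qed
  then show ?thesis using triple by blast
qed

theorem sub_count_eq: "sub_count G = (\<Sum>m1 | m1 dvd m. \<Sum>n1 | n1 dvd n. gcd m1 (R_sum n r n1))"
proof -
  have "{H. subgroup H G} = zm_sub ` zm_triples"
    using subgroup_mem_zm_sub_image subgroup_zm_sub by auto
  then show ?thesis by (simp add: sub_count_def card_image[OF inj_on_zm_sub] card_zm_triples)
qed

end

lemma iso_imp_sub_count_eq_zm:
  assumes "group G" "G \<cong> ZM m n r" and pos: "0 < m" "0 < n" and rn: "[r ^ n = 1] (mod m)"
  shows "order G = m * n"
    and "sub_count G = (\<Sum>m1 | m1 dvd m. \<Sum>n1 | n1 dvd n. gcd m1 (R_sum n r n1))"
proof -
  obtain a b where ab: "zm_group (ZM m n r) a b r m n" using zm_group_ZM[OF pos rn] by blast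
  interpret G: group G by fact
  obtain h where "h \<in> iso (ZM m n r) G" using G.iso_sym[OF assms(2)] by (auto simp: is_iso_def)
  from zm_group_transfer[OF ab this assms(1)] interpret zm_group G "h a" "h b" r m n .
  show "order G = m * n" by (rule order_eq)
  show "sub_count G = (\<Sum>m1 | m1 dvd m. \<Sum>n1 | n1 dvd n. gcd m1 (R_sum n r n1))" by (rule sub_count_eq)
qed

text \<open>The integer power is needed for the trivial group, where the exponent is -1 and natural
  subtraction would give 0.\<close>

lemma lambda_ratio_less_iff:
  "lambda_ratio G < 5 / 2 \<longleftrightarrow> real (sub_count G) < 5 * 2 powi (int (prime_count (order G)) - 1)"
proof -
  have e: "(2::real) powi (int k - 1) = 2 ^ k / 2" for k by (simp add: power_int_diff)
  show ?thesis unfolding e by (simp add: lambda_ratio_def field_simps)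
qed

theorem corollary4p14:
  fixes G :: "('a, 'b) monoid_scheme"
  assumes "group G" and "finite (carrier G)"
  shows "lambda_ratio G < 5 / 2 \<longleftrightarrow>
    (\<exists>m n r :: nat. 0 < m \<and> 0 < n \<and> 0 < r \<and>
       gcd m n = 1 \<and> gcd m (r - 1) = 1 \<and> [r ^ n = 1] (mod m) \<and>
       G \<cong> ZM m n r \<and>
       real (\<Sum>m1 | m1 dvd m. \<Sum>n1 | n1 dvd n. gcd m1 (R_sum n r n1))
         < 5 * 2 powi (int (prime_count (m * n)) - 1))"
    (is "?L \<longleftrightarrow> ?R")
proof -
  interpret finite_group G using assms by (simp add: finite_group_def finite_group_axioms_def)
  note lambda = lambda_ratio_less_iff[of G]
  show ?thesis
  proof
    assume ?L
    then have few: "real (sub_count G) < 5 * 2 powi (int (prime_count (order G)) - 1)" using lambda by blast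
    have "\<exists>x\<in>carrier G. ord x = p ^ multiplicity p (order G)" if p: "prime p" for p
    proof (cases "p dvd order G")
      case False
      then show ?thesis by (intro bexI[of _ "\<one>\<^bsub>G\<^esub>"]) (simp_all add: not_dvd_imp_multiplicity_0)
    next
      case True
      have "p \<in> prime_factors (order G)" using p True order_pos by (simp add: prime_factors_dvd)
      \<comment> \<open>A prime divisor makes the exponent nonnegative, so the integer power agrees
        with the natural one in the Sylow bound.\<close>
      then have "0 < prime_count (order G)" using order_pos by (auto simp: prime_count_eq card_gt_0_iff)
      then have "(2::real) powi (int (prime_count (order G)) - 1) = 2 ^ (prime_count (order G) - 1)"
        by (simp add: power_int_def nat_diff_distrib)
      then have "real (sub_count G) < real (5 * 2 ^ (prime_count (order G) - 1))" using few by simp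
      then have "sub_count G < 5 * 2 ^ (prime_count (order G) - 1)" by (simp only: of_nat_less_iff)
      then show ?thesis using sub_count_ge_of_noncyclic_sylow[OF p True] by (metis not_less)
    qed
    then interpret zgroup G by unfold_locales
    obtain a b r m n where zm: "zm_group G a b r m n" and r: "0 < r" "gcd m n = 1" "gcd m (r - 1) = 1"
      using exists_zm_group by (elim exE conjE)
    interpret Z: zm_group G a b r m n by (rule zm)
    obtain a' b' where "zm_group (ZM m n r) a' b' r m n"
      using zm_group_ZM[OF Z.m_pos Z.n_pos Z.r_pow_n] by blast
    then have iso: "G \<cong> ZM m n r" by (rule zm_group_iso[OF zm])
    show ?R
      by (rule exI[of _ m], rule exI[of _ n], rule exI[of _ r], intro conjI)
        (fact Z.m_pos Z.n_pos r Z.r_pow_n iso few[unfolded Z.sub_count_eq Z.order_eq])+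
  next
    assume ?R
    then obtain m n r :: nat where "0 < m" "0 < n" "[r ^ n = 1] (mod m)" "G \<cong> ZM m n r"
      and sum: "real (\<Sum>m1 | m1 dvd m. \<Sum>n1 | n1 dvd n. gcd m1 (R_sum n r n1))
         < 5 * 2 powi (int (prime_count (m * n)) - 1)" by blast
    with iso_imp_sub_count_eq_zm[OF assms(1)] show ?L unfolding lambda by metis
  qed
qed

end
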